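(* Let $m,p\ge1$ be integers and let $\mathcal{M}$ be a closed subspace of $H^2_{\mathbb{C}^m}(\mathbb{D})$. Let $\{W_1,\dots,W_r\}$ be an orthonormal basis of $\mathcal{M}\ominus(\mathcal{M}\cap zH^2_{\mathbb{C}^m}(\mathbb{D}))$ and let $F_0$ be the $m\times r$ matrix-valued function whose columns are $W_1,\dots,W_r$. Then $\mathcal{M}$ is almost invariant for $S^*$ with defect $p$ if and only if there is a $p$-dimensional subspace $\mathcal{F}\subset H^2_{\mathbb{C}^m}(\mathbb{D})$ orthogonal to $\mathcal{M}$, with an orthonormal basis $\{E_1,\dots,E_p\}$, such that one of the following holds: (i) there are functions in $\mathcal{M}$ that do not vanish at $0$; there is a closed subspace $\mathcal{K}$ of $H^2_{\mathbb{C}^{r+p}}(\mathbb{D})=H^2_{\mathbb{C}^r}(\mathbb{D})\times H^2_{\mathbb{C}}(\mathbb{D})\times\cdots\times H^2_{\mathbb{C}}(\mathbb{D})$ ($p$ scalar factors), invariant under $S^*\oplus\cdots\oplus S^*$, such that $$\mathcal{M}=\Big\{F:\ F(z)=F_0(z)K_0(z)+\sum_{j=1}^{p}z\,k_j(z)E_j(z),\ (K_0,k_1,\dots,k_p)\in\mathcal{K}\Big\}$$ with $\|F\|^2=\|K_0\|^2+\sum_{j=1}^p\|k_j\|^2$ for all $(K_0,k_1,\dots,k_p)\in\mathcal{K}$ and the corresponding $F$; and $S^*W_i\in\mathcal{M}\oplus\mathcal{F}$ for all $i=1,\dots,r$; (ii) all functions in $\mathcal{M}$ vanish at $0$, and there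 is a closed $S^*\oplus\cdots\oplus S^*$-invariant subspace $\mathcal{K}$ of $H^2_{\mathbb{C}^{p}}(\mathbb{D})$ such that $$\mathcal{M}=\Big\{F:\ F(z)=\sum_{j=1}^{p}z\,k_j(z)E_j(z),\ (k_1,\dots,k_p)\in\mathcal{K}\Big\}$$ with $\|F\|^2=\sum_{j=1}^p\|k_j\|^2$ for all $(k_1,\dots,k_p)\in\mathcal{K}$ and the corresponding $F$.
   Context: $H^2_{\mathbb{C}^m}(\mathbb{D})$ is the Hilbert space of $\mathbb{C}^m$-valued analytic functions $F(z)=\sum_{n\ge0}A_nz^n$ on the unit disc $\mathbb{D}$ with $\|F\|^2=\sum_n\|A_n\|^2<\infty$. $S$ is the shift $(SF)(z)=zF(z)$ and $S^*$ its adjoint, the backward shift $(S^*F)(z)=(F(z)-F(0))/z$; $S^*\oplus\cdots\oplus S^*$ denotes the backward shift on $H^2_{\mathbb{C}^{r+p}}(\mathbb{D})$ (resp. $H^2_{\mathbb{C}^{p}}(\mathbb{D})$). A closed subspace $\mathcal{M}\subset H^2_{\mathbb{C}^m}(\mathbb{D})$ is almost invariant for $S^*$ with defect $p$ if there is a $p$-dimensional subspace $\mathcal{F}\subset H^2_{\mathbb{C}^m}(\mathbb{D})$, orthogonal to $\mathcal{M}$, such that $S^*\mathcal{M}\subset\mathcal{M}\oplus\mathcal{F}$. The dimension $p$ is not required to be minimal. *)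

theory Defs
  imports "HOL-Complex_Analysis.Complex_Analysis" "HOL-Library.Function_Algebras"
begin

text \<open>
  A function on the unit disc with values in \<open>\<complex>\<^sup>d\<close> is a function \<open>F\<close> with \<open>F z i\<close> the \<open>i\<close>-th
  coordinate (\<open>i < d\<close>, counted from 0) of \<open>F(z)\<close>.  So that equality of such functions is plain
  equality, they are 0 off the disc and at coordinates \<open>i \<ge> d\<close>.  Dimensions are natural numbers
  since they may be 0 and vary within one statement.
\<close>

type_synonym cvfun = "complex \<Rightarrow> nat \<Rightarrow> complex"

definition cscale :: "complex \<Rightarrow> cvfun \<Rightarrow> cvfun" where
  "cscale c F = (\<lambda>z i. c * F z i)"

interpretation cvfun: vector_space cscale
  by unfold_locales (auto simp: cscale_def fun_eq_iff algebra_simps)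

definition taylor_coeff :: "cvfun \<Rightarrow> nat \<Rightarrow> nat \<Rightarrow> complex" where
  "taylor_coeff F n i = (deriv ^^ n) (\<lambda>z. F z i) 0 / fact n"

definition H2 :: "nat \<Rightarrow> cvfun set" where
  "H2 d = {F. (\<forall>z i. z \<notin> ball 0 1 \<or> d \<le> i \<longrightarrow> F z i = 0) \<and>
              (\<forall>i<d. (\<lambda>z. F z i) holomorphic_on ball 0 1) \<and>
              summable (\<lambda>n. \<Sum>i<d. (cmod (taylor_coeff F n i))\<^sup>2)}"

definition H2_inner :: "nat \<Rightarrow> cvfun \<Rightarrow> cvfun \<Rightarrow> complex" where
  "H2_inner d F G = (\<Sum>n. \<Sum>i<d. taylor_coeff F n i * cnj (taylor_coeff G n i))"

definition H2_norm :: "nat \<Rightarrow> cvfun \<Rightarrow> real" where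
  "H2_norm d F = sqrt (\<Sum>n. \<Sum>i<d. (cmod (taylor_coeff F n i))\<^sup>2)"

definition closed_subspace_H2 :: "nat \<Rightarrow> cvfun set \<Rightarrow> bool" where
  "closed_subspace_H2 d M \<longleftrightarrow> M \<subseteq> H2 d \<and> cvfun.subspace M \<and>
     (\<forall>X F. (\<forall>n. X n \<in> M) \<and> F \<in> H2 d \<and> (\<lambda>n. H2_norm d (X n - F)) \<longlonglongrightarrow> 0 \<longrightarrow> F \<in> M)"

definition subspace_H2_dim :: "nat \<Rightarrow> nat \<Rightarrow> cvfun set \<Rightarrow> bool" where
  "subspace_H2_dim d p V \<longleftrightarrow> V \<subseteq> H2 d \<and>
     (\<exists>B. finite B \<and> card B = p \<and> cvfun.independent B \<and> cvfun.span B = V)"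

definition orthogonal_H2 :: "nat \<Rightarrow> cvfun set \<Rightarrow> cvfun set \<Rightarrow> bool" where
  "orthogonal_H2 d A B \<longleftrightarrow> (\<forall>F\<in>A. \<forall>G\<in>B. H2_inner d F G = 0)"

definition ominus_H2 :: "nat \<Rightarrow> cvfun set \<Rightarrow> cvfun set \<Rightarrow> cvfun set" where
  "ominus_H2 d M N = {F \<in> M. \<forall>G\<in>N. H2_inner d F G = 0}"

text \<open>Only the values \<open>E 0, \<dots>, E (n - 1)\<close> matter; \<open>V\<close> is finite-dimensional, so the linear
  span is already closed.\<close>

definition orthonormal_basis_H2 :: "nat \<Rightarrow> nat \<Rightarrow> (nat \<Rightarrow> cvfun) \<Rightarrow> cvfun set \<Rightarrow> bool" where
  "orthonormal_basis_H2 d n E V \<longleftrightarrow> E ` {..<n} \<subseteq> H2 d \<and>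
     (\<forall>i<n. \<forall>j<n. H2_inner d (E i) (E j) = (if i = j then 1 else 0)) \<and>
     cvfun.span (E ` {..<n}) = V"

definition shift :: "cvfun \<Rightarrow> cvfun" where
  "shift F = (\<lambda>z i. z * F z i)"

text \<open>\<open>(F(z) - F(0))/z\<close> with its removable singularity at 0 filled in.  As it acts
  coordinatewise, the same function on \<open>H2 (r + p)\<close> is \<open>S\<^sup>* \<oplus> \<dots> \<oplus> S\<^sup>*\<close>.\<close>

definition bshift :: "cvfun \<Rightarrow> cvfun" where
  "bshift F = (\<lambda>z i. if z = 0 then deriv (\<lambda>w. F w i) 0
                     else if z \<in> ball 0 1 then (F z i - F 0 i) / z else 0)"

text \<open>Below, \<open>M + V\<close> is the pointwise sum of sets, i.e. \<open>M \<oplus> V\<close> when \<open>V\<close> is orthogonal to \<open>M\<close>.\<close>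

definition almost_invariant_bshift :: "nat \<Rightarrow> nat \<Rightarrow> cvfun set \<Rightarrow> bool" where
  "almost_invariant_bshift m p M \<longleftrightarrow> closed_subspace_H2 m M \<and>
     (\<exists>V. subspace_H2_dim m p V \<and> orthogonal_H2 m V M \<and> bshift ` M \<subseteq> M + V)"

text \<open>The identification of \<open>H2 (r + p)\<close> with \<open>H2 r \<times> H2 1 \<times> \<dots> \<times> H2 1\<close>: an element \<open>K\<close> is
  \<open>(K\<^sub>0, k\<^sub>1, \<dots>, k\<^sub>p)\<close> with \<open>K\<^sub>0 = vec_part r K\<close> and \<open>k\<^sub>j\<^sub>+\<^sub>1 = scalar_part r K j\<close> for \<open>j < p\<close>.\<close>

definition vec_part :: "nat \<Rightarrow> cvfun \<Rightarrow> cvfun" where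
  "vec_part r K = (\<lambda>z i. if i < r then K z i else 0)"

definition scalar_part :: "nat \<Rightarrow> cvfun \<Rightarrow> nat \<Rightarrow> complex \<Rightarrow> complex" where
  "scalar_part r K j = (\<lambda>z. K z (r + j))"

definition scalar_norm :: "(complex \<Rightarrow> complex) \<Rightarrow> real" where
  "scalar_norm f = H2_norm 1 (\<lambda>z i. if i = 0 then f z else 0)"

definition matrix_of_columns :: "(nat \<Rightarrow> cvfun) \<Rightarrow> complex \<Rightarrow> nat \<Rightarrow> nat \<Rightarrow> complex" where
  "matrix_of_columns W z i l = W l z i"

definition mat_vec :: "nat \<Rightarrow> (nat \<Rightarrow> nat \<Rightarrow> complex) \<Rightarrow> (nat \<Rightarrow> complex) \<Rightarrow> nat \<Rightarrow> complex" where
  "mat_vec r A v = (\<lambda>i. \<Sum>l<r. A i l * v l)"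

end

theory Submission
  imports Defs
begin

text \<open>
  Let \<open>P\<close> and \<open>Q\<close> be the orthogonal projections onto \<open>M\<close> and \<open>M \<inter> zH\<^sup>2\<close>, and \<open>A = P S\<^sup>* Q\<close> on \<open>M\<close>.
  Writing \<open>F \<in> M\<close> as \<open>F\<^sub>0 c + z (\<Sum>j. d\<^sub>j E\<^sub>j) + z A F\<close> with \<open>\<parallel>F\<parallel>\<^sup>2 = \<parallel>c\<parallel>\<^sup>2 + \<parallel>d\<parallel>\<^sup>2 + \<parallel>A F\<parallel>\<^sup>2\<close> and iterating
  gives the Taylor coefficients of the element \<open>(K\<^sub>0, k)\<close> representing \<open>F\<close>; this representation is isometric
  exactly when \<open>A\<^sup>n F \<rightarrow> 0\<close>.  That convergence is proved by a smoothness argument in the style of scattering theory,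
  using that \<open>f - S A f\<close> ranges over a finite-dimensional space for \<open>f \<in> M\<close> and that
  \<open>S\<^sup>*\<^sup>n \<rightarrow> 0\<close> strongly.  Conversely, if \<open>D = [F\<^sub>0, zE\<^sub>1, \<dots>, zE\<^sub>p]\<close>, then \<open>S\<^sup>*(D k) = (S\<^sup>* D) k(0) + D S\<^sup>* k\<close>.
\<close>

section \<open>Compressions of a pure backward shift\<close>

text \<open>The powers of \<open>bshift\<close> tend strongly to 0, but \<open>A\<close> does not
  inherit this directly: projections stand between successive backward shifts. What helps is that
  the norm lost by \<open>A\<close> pays for the finitely many coefficients of f - S A f, so this
  remainder tends to 0 along orbits and A^k f approaches S^j A^(k+j) f for each fixed j. To let j
  grow, the comparison must be uniform in j. Its error is a sum of products of a coefficient with an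
  inner product of the orbit against a fixed vector; square summability of the coefficients alone
  does not control such a sum. For f of the form P T (x - Q x), with T the backward shift, the inner
  products are square summable as well, paid for by the norm lost by the adjoint of
  \<open>A\<close>. These special f suffice: a vector orthogonal to all vectors with orbit tending
  to 0 is moved by the adjoint of \<open>A\<close> exactly as by S, which again meets the strong
  convergence of the backward shift. The argument runs in real Hilbert spaces; complex scalars enter
  by counting each column twice, once multiplied by the imaginary unit.\<close>

definition orth_proj :: "'a::real_inner set \<Rightarrow> 'a \<Rightarrow> 'a" where
  "orth_proj M x = (SOME p. p \<in> M \<and> (\<forall>y\<in>M. inner (x - p) y = 0))"

text \<open>A minimizing sequence for the distance from x to M is Cauchy by the parallelogram law,
  and its limit is the projection because no perturbation inside M can reduce the distance.\<close>

lemma exists_orth_proj: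
  fixes M :: "'a::{real_inner,banach} set"
  assumes "subspace M" "closed M"
  shows "\<exists>p\<in>M. \<forall>y\<in>M. inner (x - p) y = 0"
proof -
  define \<delta> where "\<delta> = infdist x M"
  have ne: "M \<noteq> {}" using subspace_0[OF assms(1)] by auto
  have d0: "\<delta> \<ge> 0" by (simp add: \<delta>_def infdist_nonneg)
  have dle: "\<delta> \<le> norm (x - y)" if "y \<in> M" for y
    unfolding \<delta>_def using infdist_le[OF that] by (simp add: dist_norm)
  have "\<exists>y\<in>M. norm (x - y) < \<delta> + 1 / Suc n" for n
  proof -
    have "infdist x M < \<delta> + 1 / Suc n" by (simp add: \<delta>_def)
    then show ?thesis unfolding infdist_notempty[OF ne]
      by (subst (asm) cINF_less_iff) (use ne in \<open>auto simp: dist_norm intro!: bdd_belowI2[where m=0]\<close>)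
  qed
  then obtain Y where Y: "\<And>n. Y n \<in> M" "\<And>n. norm (x - Y n) < \<delta> + 1 / Suc n" by metis
  have lim: "(\<lambda>n. norm (x - Y n)) \<longlonglongrightarrow> \<delta>"
  proof (rule tendsto_sandwich[OF _ _ tendsto_const])
    show "(\<lambda>n. \<delta> + 1 / real (Suc n)) \<longlonglongrightarrow> \<delta>"
      using tendsto_add[OF tendsto_const[of \<delta>] LIMSEQ_inverse_real_of_nat]
      by (simp add: inverse_eq_divide)
  qed (use Y dle in \<open>auto intro!: always_eventually less_imp_le simp del: of_nat_Suc\<close>)
  \<comment> \<open>The midpoint of two members of the sequence lies in M, so its distance to x is
    at least \<delta>; the parallelogram law does the rest.\<close>
  have par: "(norm (Y m - Y n))\<^sup>2 \<le> 2 * ((norm (x - Y m))\<^sup>2 - \<delta>\<^sup>2) + 2 * ((norm (x - Y n))\<^sup>2 - \<delta>\<^sup>2)" for m n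
  proof -
    have "(1/2) *\<^sub>R (Y m + Y n) \<in> M"
      using assms(1) Y by (intro subspace_scale subspace_add)
    then have "\<delta>\<^sup>2 \<le> (norm (x - (1/2) *\<^sub>R (Y m + Y n)))\<^sup>2"
      using dle d0 by (intro power_mono)
    moreover have "(norm (Y m - Y n))\<^sup>2 + 4 * (norm (x - (1/2) *\<^sub>R (Y m + Y n)))\<^sup>2
        = 2 * (norm (x - Y m))\<^sup>2 + 2 * (norm (x - Y n))\<^sup>2"
      unfolding power2_norm_eq_inner
      by (simp add: inner_simps inner_commute field_simps)
    ultimately show ?thesis by simp
  qed
  have lim2: "(\<lambda>n. (norm (x - Y n))\<^sup>2 - \<delta>\<^sup>2) \<longlonglongrightarrow> 0"
    using tendsto_diff[OF tendsto_power[OF lim, of 2] tendsto_const[of "\<delta>\<^sup>2"]] by simp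
  have "Cauchy Y"
  proof (rule metric_CauchyI)
    fix e :: real assume e: "e > 0"
    then have "e\<^sup>2/4 > 0" by simp
    from order_tendstoD(2)[OF lim2 this] obtain N where
      N: "\<And>n. n \<ge> N \<Longrightarrow> (norm (x - Y n))\<^sup>2 - \<delta>\<^sup>2 < e\<^sup>2/4" by (auto simp: eventually_sequentially)
    have "dist (Y m) (Y n) < e" if "m \<ge> N" "n \<ge> N" for m n
      using par[of m n] N[OF that(1)] N[OF that(2)] e
      by (auto simp: dist_norm intro: power2_less_imp_less)
    then show "\<exists>N. \<forall>m\<ge>N. \<forall>n\<ge>N. dist (Y m) (Y n) < e" by blast
  qed
  then obtain q where q: "Y \<longlonglongrightarrow> q" using Cauchy_convergent_iff convergent_def by blast
  have qM: "q \<in> M" using assms(2) Y q closed_sequentially by blast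
  have "(\<lambda>n. norm (x - Y n)) \<longlonglongrightarrow> norm (x - q)" by (intro tendsto_intros q)
  with lim have nq: "norm (x - q) = \<delta>" using LIMSEQ_unique by blast
  have "inner (x - q) y = 0" if y: "y \<in> M" for y
  proof (cases "y = 0")
    case False
    \<comment> \<open>This \<open>t\<close> minimizes the quadratic t |-> norm (x - (q + t
      y))^2.\<close>
    define t where "t = inner (x - q) y / inner y y"
    have yy: "inner y y > 0" using False by simp
    have "q + t *\<^sub>R y \<in> M" using assms(1) y qM by (intro subspace_scale subspace_add)
    then have "\<delta>\<^sup>2 \<le> (norm (x - (q + t *\<^sub>R y)))\<^sup>2" using dle d0 by (intro power_mono)
    also have "\<dots> = \<delta>\<^sup>2 - 2 * t * inner (x - q) y + t\<^sup>2 * inner y y"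
      unfolding nq[symmetric] power2_norm_eq_inner
      by (simp add: inner_simps inner_commute field_simps power2_eq_square)
    also have "\<dots> = \<delta>\<^sup>2 - (inner (x - q) y)\<^sup>2 / inner y y"
      using yy by (simp add: t_def field_simps power2_eq_square)
    finally have "(inner (x - q) y)\<^sup>2 / inner y y \<le> 0" by simp
    with yy show ?thesis by (auto simp add: divide_le_0_iff simp del: inner_gt_zero_iff)
  qed simp
  with qM show ?thesis by blast
qed

context
  fixes M :: "'a::{real_inner,banach} set"
  assumes M: "subspace M" "closed M"
begin

lemma orth_proj_in: "orth_proj M x \<in> M"
  and orth_proj_orth: "y \<in> M \<Longrightarrow> inner (x - orth_proj M x) y = 0"
proof -
  have "orth_proj M x \<in> M \<and> (\<forall>y\<in>M. inner (x - orth_proj M x) y = 0)"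
    unfolding orth_proj_def by (rule someI_ex) (use exists_orth_proj[OF M] in blast)
  then show "orth_proj M x \<in> M" "y \<in> M \<Longrightarrow> inner (x - orth_proj M x) y = 0" by auto
qed

lemma orth_proj_unique:
  assumes "p \<in> M" "\<And>y. y \<in> M \<Longrightarrow> inner (x - p) y = 0"
  shows "orth_proj M x = p"
proof -
  let ?d = "orth_proj M x - p"
  have d: "?d \<in> M" using M(1) assms(1) orth_proj_in subspace_diff by blast
  have "inner ?d ?d = inner (x - p) ?d - inner (x - orth_proj M x) ?d"
    by (simp add: inner_simps)
  also have "\<dots> = 0" using d assms orth_proj_orth by simp
  finally show ?thesis by simp
qed

lemma orth_proj_id: "x \<in> M \<Longrightarrow> orth_proj M x = x"
  by (rule orth_proj_unique) auto

lemma orth_proj_add: "orth_proj M (x + y) = orth_proj M x + orth_proj M y"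
proof (rule orth_proj_unique)
  show "orth_proj M x + orth_proj M y \<in> M" using M(1) orth_proj_in by (intro subspace_add)
  show "inner (x + y - (orth_proj M x + orth_proj M y)) z = 0" if "z \<in> M" for z
    using orth_proj_orth[OF that, of x] orth_proj_orth[OF that, of y] by (simp add: inner_simps)
qed

lemma orth_proj_scale: "orth_proj M (c *\<^sub>R x) = c *\<^sub>R orth_proj M x"
proof (rule orth_proj_unique)
  show "c *\<^sub>R orth_proj M x \<in> M" using M(1) orth_proj_in by (intro subspace_scale)
  show "inner (c *\<^sub>R x - c *\<^sub>R orth_proj M x) z = 0" if "z \<in> M" for z
    using orth_proj_orth[OF that, of x] by (simp flip: scaleR_diff_right)
qed

lemma linear_orth_proj: "linear (orth_proj M)"
  by (intro linearI orth_proj_add orth_proj_scale)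

lemma orth_proj_selfadjoint: "inner (orth_proj M x) y = inner x (orth_proj M y)"
  using orth_proj_orth[OF orth_proj_in, of x y] orth_proj_orth[OF orth_proj_in, of y x]
  by (simp add: inner_simps inner_commute)

lemma orth_proj_pythagoras:
  "(norm (x - orth_proj M x))\<^sup>2 = (norm x)\<^sup>2 - (norm (orth_proj M x))\<^sup>2"
  using orth_proj_orth[OF orth_proj_in, of x x]
  unfolding power2_norm_eq_inner by (simp add: inner_simps inner_commute)

lemma norm_orth_proj_le: "norm (orth_proj M x) \<le> norm x"
proof -
  have "0 \<le> (norm x)\<^sup>2 - (norm (orth_proj M x))\<^sup>2"
    using zero_le_power2[of "norm (x - orth_proj M x)"] by (simp only: orth_proj_pythagoras)
  then show ?thesis by (intro power2_le_imp_le[of "norm (orth_proj M x)" "norm x"]) auto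
qed

end

text \<open>Cauchy-Schwarz in the form needed for the telescoped sums: one factor contributes a
  small tail, the other only a uniform bound.\<close>

lemma sum_mult_le_sqrt:
  fixes u v :: "nat \<Rightarrow> real"
  assumes "(\<Sum>s\<in>J. (u s)\<^sup>2) \<le> r\<^sup>2" "(\<Sum>s\<in>J. (v s)\<^sup>2) \<le> t\<^sup>2" "r \<ge> 0" "t \<ge> 0"
  shows "\<bar>\<Sum>s\<in>J. u s * v s\<bar> \<le> r * t"
proof -
  have "\<bar>\<Sum>s\<in>J. u s * v s\<bar> \<le> (\<Sum>s\<in>J. \<bar>u s\<bar> * \<bar>v s\<bar>)"
    using sum_abs[of "\<lambda>s. u s * v s" J] by (simp add: abs_mult)
  also have "\<dots> \<le> L2_set u J * L2_set v J" by (rule L2_set_mult_ineq)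
  also have "\<dots> \<le> r * t"
    unfolding L2_set_def using assms by (intro mult_mono real_le_lsqrt) (auto intro: sum_nonneg)
  finally show ?thesis .
qed

text \<open>In the application \<open>S\<close> and \<open>T\<close> are the two shifts on
  coefficient families, \<open>M1\<close> consists of the vectors of \<open>M\<close> vanishing at
  0, and the \<open>D a\<close> are the columns with their multiples by the imaginary unit.
  Finiteness of \<open>I\<close> turns decay of each coefficient into decay of the whole remainder
  in \<open>decomp\<close>.\<close>

locale compressed_backward_shift =
  fixes S T :: "'a::{real_inner,banach} \<Rightarrow> 'a" and M M1 :: "'a set"
    and I :: "'b set" and c :: "'b \<Rightarrow> 'a \<Rightarrow> real" and D :: "'b \<Rightarrow> 'a"
  assumes S: "linear S" "\<And>x. norm (S x) = norm x"
    and T: "linear T" "\<And>x y. inner (T x) y = inner x (S y)"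
    and T_stable: "\<And>x. (\<lambda>n. (T ^^ n) x) \<longlonglongrightarrow> 0"
    and M: "subspace M" "closed M" and M1: "subspace M1" "closed M1" and sub: "M1 \<subseteq> M"
    and finI: "finite I"
    and decomp: "\<And>f. f \<in> M \<Longrightarrow> f = (\<Sum>a\<in>I. c a f *\<^sub>R D a) + S (orth_proj M (T (orth_proj M1 f)))"
    and defect: "\<And>f. f \<in> M \<Longrightarrow>
      (\<Sum>a\<in>I. (c a f)\<^sup>2) \<le> (norm f)\<^sup>2 - (norm (orth_proj M (T (orth_proj M1 f))))\<^sup>2"
begin

abbreviation "P \<equiv> orth_proj M"
abbreviation "Q \<equiv> orth_proj M1"

text \<open>Both operators live on the whole space, so that \<open>B\<close> is the adjoint of
  \<open>A\<close> and \<open>A\<close> kills everything orthogonal to \<open>M1\<close>.\<close>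

definition "A f = P (T (Q f))"
definition "B y = Q (S (P y))"

lemma norm_T: "norm (T x) \<le> norm x"
proof -
  have "norm (T x) * norm (T x) = inner (T x) (T x)"
    by (metis power2_norm_eq_inner power2_eq_square)
  also have "\<dots> = inner x (S (T x))" by (rule T(2))
  also have "\<dots> \<le> norm x * norm (T x)" using norm_cauchy_schwarz[of x "S (T x)"] by (simp only: S(2))
  finally show ?thesis by (cases "T x = 0") auto
qed

lemma linear_A: "linear A"
  unfolding A_def
  using linear_compose[OF linear_compose[OF linear_orth_proj[OF M1] T(1)] linear_orth_proj[OF M]]
  by (simp add: o_def)

lemma norm_A: "norm (A f) \<le> norm f"
  unfolding A_def by (rule order_trans[OF norm_orth_proj_le[OF M] order_trans[OF norm_T norm_orth_proj_le[OF M1]]])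

lemma linear_A_pow: "linear (A ^^ n)"
  by (induction n) (simp_all only: funpow.simps linear_id linear_compose linear_A)

lemma norm_A_pow: "norm ((A ^^ n) f) \<le> norm f"
  by (induction n) (auto intro: order_trans norm_A)

lemma norm_T_pow: "norm ((T ^^ n) f) \<le> norm f"
  by (induction n) (auto intro: order_trans norm_T)

lemma norm_S_pow: "norm ((S ^^ n) f) = norm f"
  by (induction n) (auto simp: S)

lemma linear_S_pow: "linear (S ^^ n)"
  by (induction n) (simp_all only: funpow.simps linear_id linear_compose S)

lemma A_in: "A f \<in> M" unfolding A_def by (rule orth_proj_in[OF M])

lemma A_pow_in: "f \<in> M \<Longrightarrow> (A ^^ n) f \<in> M"
  by (induction n) (auto intro: A_in)

lemma A_B_adjoint: "inner (A f) y = inner f (B y)"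
  unfolding A_def B_def by (simp add: orth_proj_selfadjoint[OF M] orth_proj_selfadjoint[OF M1] T(2))

lemma A_B_pow_adjoint: "inner ((A ^^ n) f) y = inner f ((B ^^ n) y)"
  by (induction n arbitrary: y) (auto simp: A_B_adjoint funpow_swap1[of B])

lemma T_S_pow_adjoint: "inner ((T ^^ n) f) y = inner f ((S ^^ n) y)"
  by (induction n arbitrary: y) (auto simp: T(2) funpow_swap1[of S])

text \<open>The range of the adjoint of the defect operator of \<open>A\<^sup>*\<close> consists of vectors with
  square summable orbits against every vector.\<close>

lemma smooth_vectors:
  assumes "f = P (T (x - Q x))"
  shows "(\<Sum>s<n. (inner ((A ^^ s) f) y)\<^sup>2) \<le> (norm x)\<^sup>2 * (norm y)\<^sup>2"
proof -
  let ?u = "\<lambda>s. S (P ((B ^^ s) y))"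
  \<comment> \<open>All operators move to the second argument, where x - Q x becomes the component
    of \<open>?u s\<close> orthogonal to \<open>M1\<close>.\<close>
  have eq: "inner ((A ^^ s) f) y = inner x (?u s - Q (?u s))" for s
    by (simp add: A_B_pow_adjoint assms orth_proj_selfadjoint[OF M] T(2) inner_simps
        orth_proj_selfadjoint[OF M1])
  have "(inner ((A ^^ s) f) y)\<^sup>2 \<le> (norm x)\<^sup>2 * ((norm ((B ^^ s) y))\<^sup>2 - (norm ((B ^^ Suc s) y))\<^sup>2)" for s
  proof -
    have "(inner ((A ^^ s) f) y)\<^sup>2 \<le> (norm x * norm (?u s - Q (?u s)))\<^sup>2"
      unfolding eq using Cauchy_Schwarz_ineq2 abs_le_square_iff
      by (metis abs_mult abs_norm_cancel)
    \<comment> \<open>Pythagoras for \<open>Q\<close>: since \<open>S\<close> is isometric, the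
      squared distance of \<open>?u s\<close> from \<open>M1\<close> is the norm of P (B^s y)
      squared minus that of B^(s+1) y squared.\<close>
    also have "\<dots> = (norm x)\<^sup>2 * ((norm (P ((B ^^ s) y)))\<^sup>2 - (norm ((B ^^ Suc s) y))\<^sup>2)"
      by (simp add: power_mult_distrib orth_proj_pythagoras[OF M1] S B_def)
    also have "\<dots> \<le> (norm x)\<^sup>2 * ((norm ((B ^^ s) y))\<^sup>2 - (norm ((B ^^ Suc s) y))\<^sup>2)"
      by (intro mult_left_mono diff_mono power_mono norm_orth_proj_le[OF M]) auto
    finally show ?thesis .
  qed
  then have "(\<Sum>s<n. (inner ((A ^^ s) f) y)\<^sup>2) \<le> 
     (\<Sum>s<n. (norm x)\<^sup>2 * ((norm ((B ^^ s) y))\<^sup>2 - (norm ((B ^^ Suc s) y))\<^sup>2))"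
    by (intro sum_mono)
  also have "\<dots> = (norm x)\<^sup>2 * ((norm y)\<^sup>2 - (norm ((B ^^ n) y))\<^sup>2)"
    using sum_lessThan_telescope'[of "\<lambda>s. (norm ((B ^^ s) y))\<^sup>2" n] by (simp flip: sum_distrib_left)
  also have "\<dots> \<le> (norm x)\<^sup>2 * (norm y)\<^sup>2" by (intro mult_left_mono) auto
  finally show ?thesis .
qed

definition "Y f = (\<Sum>a\<in>I. c a f *\<^sub>R D a)"

lemma decomp': "f \<in> M \<Longrightarrow> f = Y f + S (A f)"
  using decomp unfolding Y_def A_def by blast

text \<open>At each time the squared coefficient is at most the drop of the squared orbit norm, and
  the drops telescope.\<close>

lemma defect_sum:
  assumes "f \<in> M" "a \<in> I" "k \<le> n"
  shows "(\<Sum>s=k..<n. (c a ((A ^^ s) f))\<^sup>2) \<le> (norm ((A ^^ k) f))\<^sup>2 - (norm ((A ^^ n) f))\<^sup>2"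
proof -
  have "(c a ((A ^^ s) f))\<^sup>2 \<le> (norm ((A ^^ s) f))\<^sup>2 - (norm ((A ^^ Suc s) f))\<^sup>2" for s
  proof -
    have "(c a ((A ^^ s) f))\<^sup>2 \<le> (\<Sum>a\<in>I. (c a ((A ^^ s) f))\<^sup>2)"
      using assms(2) finI by (intro member_le_sum) auto
    also have "\<dots> \<le> (norm ((A ^^ s) f))\<^sup>2 - (norm ((A ^^ Suc s) f))\<^sup>2"
      using defect[OF A_pow_in[OF assms(1)], of s] by (simp add: A_def)
    finally show ?thesis .
  qed
  then have "(\<Sum>s=k..<n. (c a ((A ^^ s) f))\<^sup>2) \<le>
      (\<Sum>s=k..<n. (norm ((A ^^ s) f))\<^sup>2 - (norm ((A ^^ Suc s) f))\<^sup>2)" by (intro sum_mono)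
  also have "\<dots> = (norm ((A ^^ k) f))\<^sup>2 - (norm ((A ^^ n) f))\<^sup>2"
    using sum_Suc_diff'[OF assms(3), of "\<lambda>s. - (norm ((A ^^ s) f))\<^sup>2"] by simp
  finally show ?thesis .
qed

lemma orbit_norm_limit:
  obtains l where "l \<ge> 0" "(\<lambda>n. (norm ((A ^^ n) f))\<^sup>2) \<longlonglongrightarrow> l" "\<And>n. l \<le> (norm ((A ^^ n) f))\<^sup>2"
proof -
  have "decseq (\<lambda>n. (norm ((A ^^ n) f))\<^sup>2)"
    by (intro decseq_SucI power_mono) (auto intro: norm_A)
  from decseq_convergent[OF this, of 0] obtain l where
    l: "(\<lambda>n. (norm ((A ^^ n) f))\<^sup>2) \<longlonglongrightarrow> l" "\<And>n. l \<le> (norm ((A ^^ n) f))\<^sup>2" by auto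
  have "l \<ge> 0" by (rule LIMSEQ_le_const[OF l(1)]) auto
  with l that show ?thesis by blast
qed

text \<open>The squared norms along the orbit converge, so their successive drops, and with them the
  finitely many coefficients, tend to 0.\<close>

lemma Y_orbit_tendsto_0:
  assumes f: "f \<in> M"
  shows "(\<lambda>n. Y ((A ^^ n) f)) \<longlonglongrightarrow> 0"
proof -
  obtain l where l: "(\<lambda>n. (norm ((A ^^ n) f))\<^sup>2) \<longlonglongrightarrow> l" using orbit_norm_limit by blast
  have "(\<lambda>n. c a ((A ^^ n) f)) \<longlonglongrightarrow> 0" if a: "a \<in> I" for a
  proof -
    have d0: "(\<lambda>n. (norm ((A ^^ n) f))\<^sup>2 - (norm ((A ^^ Suc n) f))\<^sup>2) \<longlonglongrightarrow> 0"
      using tendsto_diff[OF l LIMSEQ_Suc[OF l]] by simp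
    have "(\<lambda>n. (c a ((A ^^ n) f))\<^sup>2) \<longlonglongrightarrow> 0"
    proof (rule tendsto_sandwich[OF _ _ tendsto_const d0])
      show "\<forall>\<^sub>F n in sequentially. (c a ((A ^^ n) f))\<^sup>2 \<le> (norm ((A ^^ n) f))\<^sup>2 - (norm ((A ^^ Suc n) f))\<^sup>2"
        using defect_sum[OF f a, of n "Suc n" for n] by (intro always_eventually allI) simp
    qed auto
    then show ?thesis by (simp add: power_tendsto_0_iff)
  qed
  then have "(\<lambda>n. Y ((A ^^ n) f)) \<longlonglongrightarrow> (\<Sum>a\<in>I. 0 *\<^sub>R D a)"
    unfolding Y_def by (intro tendsto_sum tendsto_scaleR tendsto_const)
  then show ?thesis by simp
qed

text \<open>Raising j by one replaces a vector g of the orbit by S (A g), with error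
  \<open>Y g\<close>. The isometry \<open>S ^^ j\<close> preserves the size of that error, so a
  fixed number of such errors still tends to 0.\<close>

lemma shifted_orbit_close:
  assumes f: "f \<in> M"
  shows "(\<lambda>n. (A ^^ n) f - (S ^^ j) ((A ^^ (n + j)) f)) \<longlonglongrightarrow> 0"
proof (induction j)
  case (Suc j)
  have eq: "(A ^^ n) f - (S ^^ Suc j) ((A ^^ (n + Suc j)) f) =
    ((A ^^ n) f - (S ^^ j) ((A ^^ (n + j)) f)) + (S ^^ j) (Y ((A ^^ (n + j)) f))" for n
  proof -
    have "(S ^^ j) ((A ^^ (n + j)) f) = (S ^^ j) (Y ((A ^^ (n + j)) f) + S (A ((A ^^ (n + j)) f)))"
      using decomp'[OF A_pow_in[OF f]] by metis
    then show ?thesis by (simp add: linear_add[OF linear_S_pow] funpow_swap1)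
  qed
  have "(\<lambda>n. norm ((S ^^ j) (Y ((A ^^ (n + j)) f)))) \<longlonglongrightarrow> 0"
    unfolding norm_S_pow using tendsto_norm_zero[OF LIMSEQ_ignore_initial_segment[OF Y_orbit_tendsto_0[OF f]]] .
  then have "(\<lambda>n. (S ^^ j) (Y ((A ^^ (n + j)) f))) \<longlonglongrightarrow> 0" using tendsto_norm_zero_iff by blast
  from tendsto_add[OF Suc this] show ?case unfolding eq by simp
qed simp

text \<open>Here \<open>\<beta> j k = \<langle>S\<^sup>j A\<^sup>k\<^sup>+\<^sup>j f, A\<^sup>k f\<rangle>\<close> tends to 0 as \<open>j\<close> grows, and, uniformly
  in \<open>j\<close>, it is close for large \<open>k\<close> to the limit of \<open>\<parallel>A\<^sup>k f\<parallel>\<^sup>2\<close>; the difference is a telescoping sum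
  of finite rank terms controlled by the smoothness of \<open>f\<close>.\<close>

lemma smooth_orbit_tendsto_0:
  assumes f_def: "f = P (T (x - Q x))"
  shows "(\<lambda>n. (A ^^ n) f) \<longlonglongrightarrow> 0"
proof -
  have f: "f \<in> M" unfolding f_def by (rule orth_proj_in[OF M])
  define G where "G = (\<lambda>n. (A ^^ n) f)"
  have GM: "G n \<in> M" for n unfolding G_def by (rule A_pow_in[OF f])
  obtain l where l: "l \<ge> 0" "(\<lambda>n. (norm (G n))\<^sup>2) \<longlonglongrightarrow> l" "\<And>n. l \<le> (norm (G n))\<^sup>2"
    using orbit_norm_limit unfolding G_def by blast
  \<comment> \<open>The square of \<open>R k\<close> is the squared norm that the orbit has still to
    lose after time k; it bounds the tails of the squared coefficients.\<close>
  define R where "R = (\<lambda>k. sqrt ((norm (G k))\<^sup>2 - l))"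
  have R0: "R k \<ge> 0" and R2: "(R k)\<^sup>2 = (norm (G k))\<^sup>2 - l" for k
    unfolding R_def using l(3)[of k] by auto
  have Rlim: "R \<longlonglongrightarrow> 0"
    using tendsto_real_sqrt[OF tendsto_diff[OF l(2) tendsto_const[of l]]] by (simp add: R_def)
  have Rmono: "R (k + j) \<le> R k" for k j
  proof -
    have "norm (G (k + j)) \<le> norm (G k)"
      unfolding G_def by (subst add.commute) (simp add: funpow_add norm_A_pow)
    then show ?thesis unfolding R_def by (simp add: power_mono)
  qed
  have csum: "(\<Sum>s=k..<n. (c a (G s))\<^sup>2) \<le> (R k)\<^sup>2" if "a \<in> I" for a k n
  proof (cases "k \<le> n")
    case True
    then show ?thesis using defect_sum[OF f that True] l(3)[of n] by (simp add: R2 G_def)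
  qed simp
  \<comment> \<open>This is where the special form of f enters. The bound depends on y only through
    its norm, hence is uniform over the vectors built from \<open>T ^^ j\<close> and
    \<open>S ^^ j\<close> below.\<close>
  have ysum: "(\<Sum>s=k..<n. (inner (G s) y)\<^sup>2) \<le> (norm x * norm y)\<^sup>2" for y k n
  proof -
    have "(\<Sum>s=k..<n. (inner (G s) y)\<^sup>2) \<le> (\<Sum>s<n. (inner (G s) y)\<^sup>2)"
      by (intro sum_mono2) auto
    then show ?thesis using smooth_vectors[OF f_def, of y n] by (simp add: G_def power_mult_distrib)
  qed
  define \<beta> where "\<beta> = (\<lambda>j k. inner ((S ^^ j) (G (k + j))) (G k))"
  have Gdec: "G k = Y (G k) + S (G (Suc k))" for k
    using decomp'[OF GM, of k] by (simp add: G_def)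
  \<comment> \<open>Both arguments are split into a \<open>Y\<close> part and an \<open>S\<close>
    part; since \<open>S\<close> preserves inner products, the product of the two \<open>S\<close>
    parts is \<open>\<beta> j (Suc k)\<close>.\<close>
  have step: "\<beta> j k - \<beta> j (Suc k) =
      inner ((S ^^ j) (G (k + j))) (Y (G k)) + inner ((S ^^ j) (Y (G (k + j)))) (S (G (Suc k)))" for j k
  proof -
    have "\<beta> j k = inner ((S ^^ j) (G (k + j))) (Y (G k)) + inner ((S ^^ j) (G (k + j))) (S (G (Suc k)))"
      unfolding \<beta>_def by (subst (2) Gdec) (rule inner_add_right)
    moreover have "(S ^^ j) (G (k + j)) = (S ^^ j) (Y (G (k + j))) + S ((S ^^ j) (G (Suc k + j)))"
      by (subst Gdec) (simp add: linear_add[OF linear_S_pow] funpow_swap1)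
    moreover have "inner (S u) (S v) = inner u v" for u v
      by (simp add: dot_norm S flip: linear_add[OF S(1)])
    ultimately show ?thesis by (simp add: \<beta>_def inner_simps)
  qed
  \<comment> \<open>The factor 2 counts the two sums produced by \<open>step\<close>; norm x comes
    from the smoothness bound and norm (D a) from moving the powers of the shifts onto the
    columns.\<close>
  define C where "C = 2 * norm x * (\<Sum>a\<in>I. norm (D a))"
  have bound: "\<bar>\<beta> j k - \<beta> j n\<bar> \<le> C * R k" if "k \<le> n" for j k n
  proof -
    have "\<beta> j k - \<beta> j n = (\<Sum>s=k..<n. \<beta> j s - \<beta> j (Suc s))"
      using sum_Suc_diff'[OF that, of "\<lambda>s. - \<beta> j s"] by simp
    also have "\<dots> = (\<Sum>s=k..<n. \<Sum>a\<in>I. c a (G s) * inner (G (s + j)) ((T ^^ j) (D a))) +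
        (\<Sum>s=k..<n. \<Sum>a\<in>I. c a (G (s + j)) * inner (G (Suc s)) (T ((S ^^ j) (D a))))"
    proof -
      have "inner ((S ^^ j) (G (s + j))) (Y (G s)) = (\<Sum>a\<in>I. c a (G s) * inner (G (s + j)) ((T ^^ j) (D a)))" for s
        by (simp add: Y_def inner_sum_right inner_commute[of _ "(T ^^ j) _"] T_S_pow_adjoint)
          (simp add: inner_commute)
      moreover have "inner ((S ^^ j) (Y (G (s + j)))) (S (G (Suc s))) = 
         (\<Sum>a\<in>I. c a (G (s + j)) * inner (G (Suc s)) (T ((S ^^ j) (D a))))" for s
        by (simp add: Y_def linear_sum[OF linear_S_pow] linear_scale[OF linear_S_pow] inner_sum_left
            inner_commute[of _ "T _"] T(2))
      ultimately show ?thesis by (simp add: step sum.distrib)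
    qed
    also have "\<bar>\<dots>\<bar> \<le> (\<Sum>a\<in>I. R k * (norm x * norm (D a))) + (\<Sum>a\<in>I. R k * (norm x * norm (D a)))"
    proof (rule order_trans[OF abs_triangle_ineq] add_mono)+
      have s1: "\<bar>\<Sum>s=k..<n. c a (G s) * inner (G (s + j)) ((T ^^ j) (D a))\<bar> \<le> R k * (norm x * norm (D a))"
        if a: "a \<in> I" for a
      proof (rule sum_mult_le_sqrt[OF csum[OF a]])
        have "(\<Sum>s=k..<n. (inner (G (s + j)) ((T ^^ j) (D a)))\<^sup>2)
           = (\<Sum>s=k+j..<n+j. (inner (G s) ((T ^^ j) (D a)))\<^sup>2)"
          by (simp add: sum.shift_bounds_nat_ivl)
        also have "\<dots> \<le> (norm x * norm ((T ^^ j) (D a)))\<^sup>2" by (rule ysum)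
        also have "\<dots> \<le> (norm x * norm (D a))\<^sup>2"
          by (intro power_mono mult_left_mono norm_T_pow) auto
        finally show "(\<Sum>s=k..<n. (inner (G (s + j)) ((T ^^ j) (D a)))\<^sup>2) \<le> (norm x * norm (D a))\<^sup>2" .
      qed (auto simp: R0)
      \<comment> \<open>The coefficients now sit at time s + j, which costs nothing because
        \<open>R\<close> is decreasing; j therefore disappears from the bound.\<close>
      have s2: "\<bar>\<Sum>s=k..<n. c a (G (s + j)) * inner (G (Suc s)) (T ((S ^^ j) (D a)))\<bar> \<le> R k * (norm x * norm (D a))"
        if a: "a \<in> I" for a
      proof (rule sum_mult_le_sqrt)
        have "(\<Sum>s=k..<n. (c a (G (s + j)))\<^sup>2) = (\<Sum>s=k+j..<n+j. (c a (G s))\<^sup>2)"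
          by (simp add: sum.shift_bounds_nat_ivl)
        also have "\<dots> \<le> (R (k + j))\<^sup>2" by (rule csum[OF a])
        also have "\<dots> \<le> (R k)\<^sup>2" by (intro power_mono Rmono R0)
        finally show "(\<Sum>s=k..<n. (c a (G (s + j)))\<^sup>2) \<le> (R k)\<^sup>2" .
        have "(\<Sum>s=k..<n. (inner (G (Suc s)) (T ((S ^^ j) (D a))))\<^sup>2)
           = (\<Sum>s=Suc k..<Suc n. (inner (G s) (T ((S ^^ j) (D a))))\<^sup>2)"
          by (simp add: sum.shift_bounds_Suc_ivl del: sum.op_ivl_Suc)
        also have "\<dots> \<le> (norm x * norm (T ((S ^^ j) (D a))))\<^sup>2" by (rule ysum)
        also have "\<dots> \<le> (norm x * norm (D a))\<^sup>2"
          by (intro power_mono mult_left_mono order_trans[OF norm_T]) (auto simp: norm_S_pow)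
        finally show "(\<Sum>s=k..<n. (inner (G (Suc s)) (T ((S ^^ j) (D a))))\<^sup>2) \<le> (norm x * norm (D a))\<^sup>2" .
      qed (auto simp: R0)
      show "\<bar>\<Sum>s=k..<n. \<Sum>a\<in>I. c a (G s) * inner (G (s + j)) ((T ^^ j) (D a))\<bar>
          \<le> (\<Sum>a\<in>I. R k * (norm x * norm (D a)))"
        by (subst sum.swap, rule order_trans[OF sum_abs], rule sum_mono, rule s1)
      show "\<bar>\<Sum>s=k..<n. \<Sum>a\<in>I. c a (G (s + j)) * inner (G (Suc s)) (T ((S ^^ j) (D a)))\<bar>
          \<le> (\<Sum>a\<in>I. R k * (norm x * norm (D a)))"
        by (subst sum.swap, rule order_trans[OF sum_abs], rule sum_mono, rule s2)
    qed
    also have "\<dots> = C * R k" by (simp add: C_def sum_distrib_left mult_ac)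
    finally show ?thesis .
  qed
  have \<beta>lim: "(\<lambda>n. \<beta> j n) \<longlonglongrightarrow> l" for j
  proof -
    have "(\<lambda>n. inner (G n - (S ^^ j) (G (n + j))) (G n)) \<longlonglongrightarrow> 0"
    proof (rule Lim_null_comparison[OF always_eventually])
      show "\<forall>n. norm (inner (G n - (S ^^ j) (G (n + j))) (G n)) \<le> norm (G n - (S ^^ j) (G (n + j))) * norm f"
      proof
        fix n
        have "norm (inner (G n - (S ^^ j) (G (n + j))) (G n)) \<le> norm (G n - (S ^^ j) (G (n + j))) * norm (G n)"
          by (simp add: Cauchy_Schwarz_ineq2)
        also have "\<dots> \<le> norm (G n - (S ^^ j) (G (n + j))) * norm f"
          by (intro mult_left_mono) (auto simp: G_def norm_A_pow)
        finally show "norm (inner (G n - (S ^^ j) (G (n + j))) (G n)) \<le> \<dots>" .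
      qed
      show "(\<lambda>n. norm (G n - (S ^^ j) (G (n + j))) * norm f) \<longlonglongrightarrow> 0"
        using tendsto_mult_left_zero[OF tendsto_norm_zero[OF shifted_orbit_close[OF f, of j]]]
        by (simp add: G_def)
    qed
    from tendsto_diff[OF l(2) this] show ?thesis
      by (simp add: \<beta>_def inner_diff_left power2_norm_eq_inner)
  qed
  \<comment> \<open>Letting n tend to infinity in \<open>bound\<close> keeps the estimate uniform in
    j.\<close>
  have "\<bar>\<beta> j k - l\<bar> \<le> C * R k" for j k
    by (rule LIMSEQ_le_const2[OF tendsto_rabs[OF tendsto_diff[OF tendsto_const \<beta>lim]]])
      (use bound in blast)
  moreover have "(\<lambda>j. \<beta> j k) \<longlonglongrightarrow> 0" for k
  proof (rule Lim_null_comparison[OF always_eventually])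
    show "(\<lambda>j. norm f * norm ((T ^^ j) (G k))) \<longlonglongrightarrow> 0"
      using tendsto_mult_right_zero[OF tendsto_norm_zero[OF T_stable]] by blast
    show "\<forall>j. norm (\<beta> j k) \<le> norm f * norm ((T ^^ j) (G k))"
    proof
      fix j
      have "norm (\<beta> j k) = \<bar>inner (G (k + j)) ((T ^^ j) (G k))\<bar>"
        by (simp add: \<beta>_def inner_commute[of _ "(T ^^ j) _"] T_S_pow_adjoint) (simp add: inner_commute)
      also have "\<dots> \<le> norm (G (k + j)) * norm ((T ^^ j) (G k))" by (rule Cauchy_Schwarz_ineq2)
      also have "\<dots> \<le> norm f * norm ((T ^^ j) (G k))"
        by (intro mult_right_mono) (auto simp: G_def norm_A_pow)
      finally show "norm (\<beta> j k) \<le> norm f * norm ((T ^^ j) (G k))" .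
    qed
  qed
  \<comment> \<open>With k fixed, j tends to infinity and the term with \<beta> vanishes. What
    remains is a bound for l by a multiple of \<open>R k\<close>, which tends to 0 with growing
    k.\<close>
  ultimately have "\<bar>0 - l\<bar> \<le> C * R k" for k
    using LIMSEQ_le_const2[OF tendsto_rabs[OF tendsto_diff[OF _ tendsto_const[of l]]], of "\<lambda>j. \<beta> j k" 0 "C * R k"] by blast
  then have "l \<le> 0"
    using l(1) by (intro LIMSEQ_le_const[OF tendsto_mult_right_zero[OF Rlim, of C]]) auto
  with l have "(\<lambda>n. (norm (G n))\<^sup>2) \<longlonglongrightarrow> 0" by simp
  then show ?thesis by (simp add: power_tendsto_0_iff tendsto_norm_zero_iff G_def)
qed

section \<open>Vectors with orbit tending to 0, and their orthogonal complement\<close>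

definition "H0 = {f. (\<lambda>n. (A ^^ n) f) \<longlonglongrightarrow> 0}"

lemma subspace_H0: "subspace H0"
  unfolding subspace_def H0_def
  by (auto simp: linear_0[OF linear_A_pow] linear_add[OF linear_A_pow] linear_scale[OF linear_A_pow]
      intro: tendsto_add_zero tendsto_scaleR[OF tendsto_const, of _ 0 _ , simplified])

text \<open>All powers of \<open>A\<close> are contractions, so an approximation of f by a member of
  \<open>H0\<close> stays equally good along the whole orbit.\<close>

lemma closed_H0: "closed H0"
  unfolding closed_sequential_limits
proof (intro allI impI, elim conjE)
  fix X f assume X: "\<forall>n. X n \<in> H0" "X \<longlonglongrightarrow> f"
  have "(\<lambda>n. (A ^^ n) f) \<longlonglongrightarrow> 0"
  proof (rule LIMSEQ_I)
    fix e :: real assume "e > 0"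
    then have e: "e / 2 > 0" by simp
    from LIMSEQ_D[OF X(2) e] obtain k where k: "norm (X k - f) < e/2" by blast
    from X(1) have "(\<lambda>n. (A ^^ n) (X k)) \<longlonglongrightarrow> 0" by (auto simp: H0_def)
    from LIMSEQ_D[OF this e] obtain N where N: "\<And>n. n \<ge> N \<Longrightarrow> norm ((A ^^ n) (X k)) < e/2" by auto
    have "norm ((A ^^ n) f - 0) < e" if "n \<ge> N" for n
    proof -
      have "norm ((A ^^ n) f) \<le> norm ((A ^^ n) (X k)) + norm ((A ^^ n) (f - X k))"
        using norm_triangle_ineq[of "(A ^^ n) (X k)" "(A ^^ n) (f - X k)"]
        by (simp flip: linear_add[OF linear_A_pow])
      also have "\<dots> < e/2 + e/2"
        using N[OF that] k norm_A_pow[of n "f - X k"] by (intro add_strict_mono) (auto simp: norm_minus_commute)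
      finally show ?thesis by simp
    qed
    then show "\<exists>N. \<forall>n\<ge>N. norm ((A ^^ n) f - 0) < e" by blast
  qed
  then show "f \<in> H0" by (simp add: H0_def)
qed

text \<open>On the complement of \<open>H0\<close> both projections in B = Q S P act trivially.
  Vectors killed by \<open>A\<close> lie in \<open>H0\<close>, which forces y into \<open>M\<close>;
  smooth vectors lie in \<open>H0\<close>, which forces S y into \<open>M1\<close>. Since
  \<open>A\<close> maps \<open>H0\<close> into itself, \<open>B\<close> preserves the complement and
  the identity can be iterated.\<close>

lemma orthogonal_H0:
  assumes "\<And>f. f \<in> H0 \<Longrightarrow> inner y f = 0"
  shows "(B ^^ n) y = (S ^^ n) y"
proof -
  have in_M: "y \<in> M" and BS: "B y = S y" and B_orth: "f \<in> H0 \<Longrightarrow> inner (B y) f = 0"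
    if y: "\<And>f. f \<in> H0 \<Longrightarrow> inner y f = 0" for y f
  proof -
    let ?z = "y - P y"
    have "Q ?z = 0"
      using orth_proj_orth[OF M] sub subspace_0[OF M1(1)] by (intro orth_proj_unique[OF M1]) auto
    then have "A ?z = 0"
      by (simp add: A_def linear_0[OF T(1)] linear_0[OF linear_orth_proj[OF M]])
    then have "(A ^^ Suc n) ?z = 0" for n
      by (simp add: funpow_Suc_right linear_0[OF linear_A_pow] del: funpow.simps)
    then have "(\<lambda>n. (A ^^ Suc n) ?z) \<longlonglongrightarrow> 0" by (simp del: funpow.simps)
    then have "?z \<in> H0" unfolding H0_def mem_Collect_eq by (rule LIMSEQ_imp_Suc)
    then have "inner y ?z = 0" using y by blast
    then have "inner ?z ?z = 0"
      using orth_proj_orth[OF M orth_proj_in[OF M], of y y] by (simp add: inner_simps inner_commute)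
    then have "y = P y" by simp
    then show yM: "y \<in> M" using orth_proj_in[OF M, of y] by simp
    \<comment> \<open>Orthogonality of y to P (T (x - Q x)) for every x says, read on the other
      side, that S y has no component orthogonal to \<open>M1\<close>.\<close>
    have "inner (S y - Q (S y)) x = 0" for x
    proof -
      have "P (T (x - Q x)) \<in> H0" unfolding H0_def using smooth_orbit_tendsto_0 by blast
      then have "inner y (P (T (x - Q x))) = 0" using y by blast
      then have "inner (T (x - Q x)) y = 0"
        using orth_proj_selfadjoint[OF M, of y "T (x - Q x)"] orth_proj_id[OF M yM] by (simp add: inner_commute)
      then have "inner (x - Q x) (S y) = 0" by (simp add: T(2))
      then show ?thesis using orth_proj_selfadjoint[OF M1, of x "S y"] by (simp add: inner_simps inner_commute)
    qed
    from this[of "S y - Q (S y)"] have "S y = Q (S y)" by simp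
    then show "B y = S y" using orth_proj_id[OF M yM] by (simp add: B_def)
    show "inner (B y) f = 0" if "f \<in> H0"
    proof -
      have "(\<lambda>n. (A ^^ Suc n) f) \<longlonglongrightarrow> 0" using that LIMSEQ_Suc unfolding H0_def by blast
      then have "A f \<in> H0" by (simp add: H0_def funpow_swap1)
      then show ?thesis using y[of "A f"] by (simp add: inner_commute[of _ f] flip: A_B_adjoint) (simp add: inner_commute)
    qed
  qed
  have "(\<forall>f\<in>H0. inner ((B ^^ n) y) f = 0) \<and> (B ^^ n) y = (S ^^ n) y"
  proof (induction n)
    case 0
    then show ?case using assms by simp
  next
    case (Suc n)
    then have orth: "\<And>f. f \<in> H0 \<Longrightarrow> inner ((B ^^ n) y) f = 0" by blast
    from Suc show ?case using BS[OF orth] B_orth[OF orth] by simp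
  qed
  then show ?thesis by blast
qed

text \<open>The component y of A^n f orthogonal to \<open>H0\<close> has norm at most that of T^n f,
  which is small for large n. The other component has an orbit tending to 0, and further powers of
  \<open>A\<close> do not enlarge y.\<close>

theorem orbit_tendsto_0: "(\<lambda>n. (A ^^ n) f) \<longlonglongrightarrow> 0"
proof (rule LIMSEQ_I)
  fix e :: real assume "e > 0"
  then have e: "e / 2 > 0" by simp
  from LIMSEQ_D[OF T_stable e] obtain n where n: "norm ((T ^^ n) f) < e/2" by force
  define b where "b = orth_proj H0 ((A ^^ n) f)"
  define y where "y = (A ^^ n) f - b"
  have b: "b \<in> H0" unfolding b_def by (rule orth_proj_in[OF subspace_H0 closed_H0])
  have y: "inner y f = 0" if "f \<in> H0" for f
    unfolding y_def b_def by (rule orth_proj_orth[OF subspace_H0 closed_H0 that])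
  have "norm y * norm y = inner ((A ^^ n) f) y"
    using y[OF b] by (simp add: y_def inner_simps inner_commute flip: power2_eq_square power2_norm_eq_inner)
      (simp add: power2_norm_eq_inner inner_simps inner_commute)
  \<comment> \<open>Against y the powers of \<open>B\<close> are powers of \<open>S\<close>, so A^n
    f may be exchanged for T^n f.\<close>
  also have "\<dots> = inner ((T ^^ n) f) y"
    by (simp add: A_B_pow_adjoint T_S_pow_adjoint orthogonal_H0[OF y])
  also have "\<dots> \<le> norm ((T ^^ n) f) * norm y" by (rule norm_cauchy_schwarz)
  finally have "norm y \<le> norm ((T ^^ n) f)" by (cases "y = 0") auto
  with n have ny: "norm y < e/2" by simp
  from b have "(\<lambda>n. (A ^^ n) b) \<longlonglongrightarrow> 0" by (auto simp: H0_def)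
  from LIMSEQ_D[OF this e] obtain N where N: "\<And>n. n \<ge> N \<Longrightarrow> norm ((A ^^ n) b) < e/2" by auto
  have "norm ((A ^^ k) f - 0) < e" if "k \<ge> N + n" for k
  proof -
    have "(A ^^ k) f = (A ^^ (k - n)) (b + y)"
      using that by (simp add: y_def flip: funpow_add[unfolded o_def, THEN fun_cong])
    then have "norm ((A ^^ k) f) \<le> norm ((A ^^ (k - n)) b) + norm ((A ^^ (k - n)) y)"
      by (simp add: linear_add[OF linear_A_pow] norm_triangle_ineq)
    also have "\<dots> < e/2 + e/2"
      using N[of "k - n"] that ny norm_A_pow[of "k - n" y] by (intro add_strict_mono) auto
    finally show ?thesis by simp
  qed
  then show "\<exists>N. \<forall>k\<ge>N. norm ((A ^^ k) f - 0) < e" by blast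
qed

end

section \<open>The space of square summable families\<close>

definition square_summable :: "('i \<Rightarrow> complex) \<Rightarrow> bool" where
  "square_summable f \<longleftrightarrow> (\<lambda>i. (cmod (f i))\<^sup>2) summable_on UNIV"

lemma square_summable_0: "square_summable (\<lambda>_. 0)"
  by (simp add: square_summable_def)

lemma square_summable_add:
  assumes "square_summable f" "square_summable g"
  shows "square_summable (\<lambda>i. f i + g i)"
  unfolding square_summable_def
proof (rule summable_on_comparison_test)
  show "(\<lambda>i. 2 * (cmod (f i))\<^sup>2 + 2 * (cmod (g i))\<^sup>2) summable_on UNIV"
    using assms unfolding square_summable_def by (intro summable_on_add summable_on_cmult_right)
  show "(cmod (f i + g i))\<^sup>2 \<le> 2 * (cmod (f i))\<^sup>2 + 2 * (cmod (g i))\<^sup>2" for i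
  proof -
    have "(cmod (f i + g i))\<^sup>2 \<le> (cmod (f i) + cmod (g i))\<^sup>2"
      by (intro power_mono norm_triangle_ineq) auto
    also have "\<dots> \<le> 2 * (cmod (f i))\<^sup>2 + 2 * (cmod (g i))\<^sup>2"
      using sum_squares_bound[of "cmod (f i)" "cmod (g i)"] by (simp add: power2_sum)
    finally show ?thesis .
  qed
qed auto

lemma square_summable_mult: "square_summable f \<Longrightarrow> square_summable (\<lambda>i. c * f i)"
  unfolding square_summable_def by (simp add: norm_mult power_mult_distrib summable_on_cmult_right)

lemma square_summable_scaleR: "square_summable f \<Longrightarrow> square_summable (\<lambda>i. c *\<^sub>R f i)"
  using square_summable_mult[of f "of_real c"] by (simp add: scaleR_conv_of_real)

lemma square_summable_uminus: "square_summable f \<Longrightarrow> square_summable (\<lambda>i. - f i)"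
  by (simp add: square_summable_def)

lemma square_summable_diff:
  "square_summable f \<Longrightarrow> square_summable g \<Longrightarrow> square_summable (\<lambda>i. f i - g i)"
  using square_summable_add[OF _ square_summable_uminus, of f g] by simp

lemma square_summable_inner:
  assumes "square_summable f" "square_summable g"
  shows "(\<lambda>i. inner (f i) (g i)) summable_on UNIV"
proof -
  have "(\<lambda>i. norm (inner (f i) (g i))) summable_on UNIV"
  proof (rule summable_on_comparison_test)
    show "(\<lambda>i. (cmod (f i))\<^sup>2 + (cmod (g i))\<^sup>2) summable_on UNIV"
      using assms unfolding square_summable_def by (rule summable_on_add)
    show "norm (inner (f i) (g i)) \<le> (cmod (f i))\<^sup>2 + (cmod (g i))\<^sup>2" for i
    proof -
      have "norm (inner (f i) (g i)) \<le> cmod (f i) * cmod (g i)" by (simp add: Cauchy_Schwarz_ineq2)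
      also have "\<dots> \<le> (cmod (f i))\<^sup>2 + (cmod (g i))\<^sup>2"
        using sum_squares_bound[of "cmod (f i)" "cmod (g i)"]
          mult_nonneg_nonneg[OF norm_ge_zero norm_ge_zero, of "f i" "g i"] by linarith
      finally show ?thesis .
    qed
  qed auto
  then show ?thesis by (rule abs_summable_summable)
qed

lemma square_summable_reindex:
  assumes "inj h" "square_summable f"
  shows "square_summable (\<lambda>i. f (h i))"
proof -
  have "(\<lambda>i. (cmod (f i))\<^sup>2) summable_on range h"
    using assms(2) unfolding square_summable_def by (rule summable_on_subset_banach) simp
  then show ?thesis
    by (simp add: square_summable_def summable_on_reindex[OF assms(1), unfolded o_def])
qed

text \<open>Complex families viewed as a real Hilbert space: the inner product defined below is the
  real part of the complex one, which makes the preceding section applicable.\<close>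

typedef 'i ell2 = "{f :: 'i \<Rightarrow> complex. square_summable f}"
  using square_summable_0 by blast

setup_lifting type_definition_ell2

instantiation ell2 :: (type) real_inner
begin

lift_definition zero_ell2 :: "'a ell2" is "\<lambda>_. 0" by (rule square_summable_0)
lift_definition plus_ell2 :: "'a ell2 \<Rightarrow> 'a ell2 \<Rightarrow> 'a ell2" is "\<lambda>f g i. f i + g i"
  by (rule square_summable_add)
lift_definition minus_ell2 :: "'a ell2 \<Rightarrow> 'a ell2 \<Rightarrow> 'a ell2" is "\<lambda>f g i. f i - g i"
  by (rule square_summable_diff)
lift_definition uminus_ell2 :: "'a ell2 \<Rightarrow> 'a ell2" is "\<lambda>f i. - f i"
  by (rule square_summable_uminus)
lift_definition scaleR_ell2 :: "real \<Rightarrow> 'a ell2 \<Rightarrow> 'a ell2" is "\<lambda>c f i. c *\<^sub>R f i"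
  by (rule square_summable_scaleR)
lift_definition inner_ell2 :: "'a ell2 \<Rightarrow> 'a ell2 \<Rightarrow> real" is
  "\<lambda>f g. \<Sum>\<^sub>\<infinity>i. inner (f i) (g i)" .
definition norm_ell2 :: "'a ell2 \<Rightarrow> real" where "norm_ell2 x = sqrt (inner x x)"
definition dist_ell2 :: "'a ell2 \<Rightarrow> 'a ell2 \<Rightarrow> real" where "dist_ell2 x y = norm (x - y)"
definition sgn_ell2 :: "'a ell2 \<Rightarrow> 'a ell2" where "sgn_ell2 x = inverse (norm x) *\<^sub>R x"
definition uniformity_ell2 :: "('a ell2 \<times> 'a ell2) filter" where
  "uniformity_ell2 = (INF e\<in>{0<..}. principal {(x, y). dist x y < e})"
definition open_ell2 :: "'a ell2 set \<Rightarrow> bool" where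
  "open_ell2 U = (\<forall>x\<in>U. eventually (\<lambda>(x', y). x' = x \<longrightarrow> y \<in> U) uniformity)"

instance
proof
  fix x y z :: "'a ell2" and a b :: real
  show "x + y + z = x + (y + z)" by transfer (simp add: add.assoc)
  show "x + y = y + x" by transfer (simp add: add.commute)
  show "0 + x = x" by transfer simp
  show "- x + x = 0" by transfer simp
  show "x - y = x + - y" by transfer simp
  show "a *\<^sub>R (x + y) = a *\<^sub>R x + a *\<^sub>R y" by transfer (simp add: scaleR_add_right)
  show "(a + b) *\<^sub>R x = a *\<^sub>R x + b *\<^sub>R x" by transfer (simp add: scaleR_add_left)
  show "a *\<^sub>R b *\<^sub>R x = (a * b) *\<^sub>R x" by transfer simp
  show "1 *\<^sub>R x = x" by transfer simp
  show "dist x y = norm (x - y)" by (rule dist_ell2_def)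
  show "sgn x = inverse (norm x) *\<^sub>R x" by (rule sgn_ell2_def)
  show "uniformity = (INF e\<in>{0<..}. principal {(x, y). dist (x :: 'a ell2) y < e})"
    by (rule uniformity_ell2_def)
  show "open U = (\<forall>x\<in>U. eventually (\<lambda>(x', y). x' = x \<longrightarrow> y \<in> U) uniformity)" for U :: "'a ell2 set"
    by (rule open_ell2_def)
  show "inner x y = inner y x" by transfer (simp add: inner_commute)
  show "inner (x + y) z = inner x z + inner y z"
    by transfer (simp add: inner_add_left infsum_add square_summable_inner)
  show "inner (a *\<^sub>R x) y = a * inner x y"
    by transfer (simp add: infsum_cmult_right square_summable_inner)
  show "0 \<le> inner x x" by transfer (simp add: infsum_nonneg)
  show "inner x x = 0 \<longleftrightarrow> x = 0"
  proof
    show "inner x x = 0 \<Longrightarrow> x = 0"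
    proof transfer
      fix f :: "'a \<Rightarrow> complex" assume "square_summable f" "(\<Sum>\<^sub>\<infinity>i. inner (f i) (f i)) = 0"
      then show "f = (\<lambda>_. 0)"
        using nonneg_infsum_le_0D[of "\<lambda>i. inner (f i) (f i)" UNIV] square_summable_inner[of f f]
        by (auto simp: fun_eq_iff)
    qed
    show "x = 0 \<Longrightarrow> inner x x = 0" by transfer simp
  qed
  show "norm x = sqrt (inner x x)" by (rule norm_ell2_def)
qed

end

lemma ell2_norm_square: "(norm x)\<^sup>2 = (\<Sum>\<^sub>\<infinity>i. (cmod (Rep_ell2 x i))\<^sup>2)"
  unfolding power2_norm_eq_inner by transfer simp

lemma square_summable_Rep: "square_summable (Rep_ell2 x)"
  using Rep_ell2 by blast

lemma ell2_sum_le_norm: "finite F \<Longrightarrow> (\<Sum>i\<in>F. (cmod (Rep_ell2 x i))\<^sup>2) \<le> (norm x)\<^sup>2"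
  unfolding ell2_norm_square using square_summable_Rep[of x]
  by (intro finite_sum_le_infsum) (auto simp: square_summable_def)

lemma norm_coord_le: "cmod (Rep_ell2 x i) \<le> norm x"
  using ell2_sum_le_norm[of "{i}" x] by (auto intro: power2_le_imp_le)

lemma bounded_linear_coord: "bounded_linear (\<lambda>x. Rep_ell2 x i)"
  by (rule bounded_linear_intro[where K=1])
    (auto simp: plus_ell2.rep_eq scaleR_ell2.rep_eq norm_coord_le)

lemmas tendsto_coord = bounded_linear.tendsto[OF bounded_linear_coord]

text \<open>A Cauchy sequence converges in each coordinate. The Cauchy estimate survives the limit
  on every finite set of indices, with a bound independent of the set, and thus gives both square
  summability and norm convergence.\<close>

instance ell2 :: (type) banach
proof
  fix X :: "nat \<Rightarrow> 'a ell2" assume X: "Cauchy X"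
  have "Cauchy (\<lambda>n. Rep_ell2 (X n) i)" for i
    by (rule bounded_linear.Cauchy[OF bounded_linear_coord X])
  then have "\<exists>l. (\<lambda>n. Rep_ell2 (X n) i) \<longlonglongrightarrow> l" for i
    using Cauchy_convergent_iff convergent_def by blast
  then obtain f where f: "\<And>i. (\<lambda>n. Rep_ell2 (X n) i) \<longlonglongrightarrow> f i" by metis
  have close: "\<exists>N. \<forall>n\<ge>N. \<forall>F. finite F \<longrightarrow> (\<Sum>i\<in>F. (cmod (Rep_ell2 (X n) i - f i))\<^sup>2) \<le> e\<^sup>2"
    if e: "e > 0" for e :: real
  proof -
    from CauchyD[OF X e] obtain N where N: "\<And>m n. m \<ge> N \<Longrightarrow> n \<ge> N \<Longrightarrow> norm (X m - X n) < e" by blast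
    have "(\<Sum>i\<in>F. (cmod (Rep_ell2 (X n) i - f i))\<^sup>2) \<le> e\<^sup>2" if "n \<ge> N" "finite F" for n F
    proof (rule LIMSEQ_le_const2)
      show "(\<lambda>k. \<Sum>i\<in>F. (cmod (Rep_ell2 (X n) i - Rep_ell2 (X k) i))\<^sup>2)
          \<longlonglongrightarrow> (\<Sum>i\<in>F. (cmod (Rep_ell2 (X n) i - f i))\<^sup>2)"
        by (intro tendsto_intros f)
      have "(\<Sum>i\<in>F. (cmod (Rep_ell2 (X n) i - Rep_ell2 (X k) i))\<^sup>2) \<le> e\<^sup>2" if "k \<ge> N" for k
      proof -
        have "(\<Sum>i\<in>F. (cmod (Rep_ell2 (X n) i - Rep_ell2 (X k) i))\<^sup>2) \<le> (norm (X n - X k))\<^sup>2"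
          using ell2_sum_le_norm[OF \<open>finite F\<close>, of "X n - X k"] by (simp add: minus_ell2.rep_eq)
        also have "\<dots> \<le> e\<^sup>2" using N[OF \<open>n \<ge> N\<close> that] by (intro power_mono) auto
        finally show ?thesis .
      qed
      then show "\<exists>N. \<forall>k\<ge>N. (\<Sum>i\<in>F. (cmod (Rep_ell2 (X n) i - Rep_ell2 (X k) i))\<^sup>2) \<le> e\<^sup>2" by blast
    qed
    then show ?thesis by blast
  qed
  have ss: "square_summable (\<lambda>i. Rep_ell2 (X n) i - f i)"
    if "\<forall>F. finite F \<longrightarrow> (\<Sum>i\<in>F. (cmod (Rep_ell2 (X n) i - f i))\<^sup>2) \<le> b" for n b
    unfolding square_summable_def
    by (rule nonneg_bdd_above_summable_on) (use that in \<open>auto intro!: bdd_aboveI2\<close>)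
  from close[of 1] obtain N where "\<forall>F. finite F \<longrightarrow> (\<Sum>i\<in>F. (cmod (Rep_ell2 (X N) i - f i))\<^sup>2) \<le> 1\<^sup>2"
    by auto
  from square_summable_diff[OF square_summable_Rep[of "X N"] ss[OF this]]
  have sf: "square_summable f" by simp
  define l where "l = Abs_ell2 f"
  have l: "Rep_ell2 l = f" unfolding l_def using sf by (simp add: Abs_ell2_inverse)
  have "X \<longlonglongrightarrow> l"
  proof (rule LIMSEQ_I)
    fix e :: real assume e: "e > 0"
    then have "e / 2 > 0" by simp
    from close[OF this] obtain N where
      N: "\<And>n F. n \<ge> N \<Longrightarrow> finite F \<Longrightarrow> (\<Sum>i\<in>F. (cmod (Rep_ell2 (X n) i - f i))\<^sup>2) \<le> (e/2)\<^sup>2" by blast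
    have "norm (X n - l) < e" if n: "n \<ge> N" for n
    proof -
      have "(norm (X n - l))\<^sup>2 \<le> (e/2)\<^sup>2"
        unfolding ell2_norm_square
        by (rule infsum_le_finite_sums)
          (use square_summable_Rep[of "X n - l"] N[OF n] in \<open>auto simp: square_summable_def minus_ell2.rep_eq l\<close>)
      then have "norm (X n - l) \<le> e/2" by (rule power2_le_imp_le) (use e in auto)
      with e show ?thesis by simp
    qed
    then show "\<exists>N. \<forall>n\<ge>N. norm (X n - l) < e" by blast
  qed
  then show "convergent X" by (auto simp: convergent_def)
qed

lemma ell2_eqI: "(\<And>i. Rep_ell2 x i = Rep_ell2 y i) \<Longrightarrow> x = y"
  by (simp add: Rep_ell2_inject[symmetric] fun_eq_iff)

text \<open>The real part is the real inner product of f and g, the imaginary part that of f and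
  \<i> g.\<close>

lemma square_summable_mult_cnj:
  assumes "square_summable f" "square_summable g"
  shows "(\<lambda>i. f i * cnj (g i)) summable_on UNIV"
proof -
  have 1: "(\<lambda>i. Re (f i * cnj (g i))) summable_on UNIV"
    using square_summable_inner[OF assms] by (simp add: inner_complex_def)
  have 2: "(\<lambda>i. Im (f i * cnj (g i))) summable_on UNIV"
    using square_summable_inner[OF assms(1) square_summable_mult[OF assms(2), of \<i>]]
    by (simp add: inner_complex_def algebra_simps)
  have "(\<lambda>i. of_real (Re (f i * cnj (g i))) + \<i> * of_real (Im (f i * cnj (g i)))) summable_on UNIV"
    by (intro summable_on_add summable_on_cmult_right summable_on_of_real 1 2)
  then show ?thesis by (simp only: complex_eq[symmetric])
qed

section \<open>Forward and backward shift on coefficient families\<close>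

lemma infsum_shift_fst:
  fixes f :: "nat \<times> nat \<Rightarrow> real"
  assumes "\<And>i. f (0, i) = 0"
  shows "infsum f UNIV = (\<Sum>\<^sub>\<infinity>p. f (Suc (fst p), snd p))"
proof -
  have "infsum f UNIV = infsum f (range (\<lambda>p. (Suc (fst p), snd p)))"
  proof (rule infsum_cong_neutral)
    fix p assume "p \<in> UNIV - range (\<lambda>p. (Suc (fst p), snd p :: nat))"
    then have "fst p = 0" by (cases p; cases "fst p") (auto simp: image_iff)
    then show "f p = 0" using assms by (metis prod.collapse)
  qed auto
  also have "\<dots> = (\<Sum>\<^sub>\<infinity>p. f (Suc (fst p), snd p))"
    by (subst infsum_reindex) (auto simp: inj_on_def o_def prod_eq_iff)
  finally show ?thesis .
qed

text \<open>In an index pair the first entry is the Taylor degree and the second the coordinate, so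
  only the first is shifted.\<close>

lift_definition ell2_bshift :: "(nat \<times> nat) ell2 \<Rightarrow> (nat \<times> nat) ell2" is
  "\<lambda>f p. f (Suc (fst p), snd p)"
  by (rule square_summable_reindex) (auto simp: inj_on_def prod_eq_iff)

lift_definition ell2_shift :: "(nat \<times> nat) ell2 \<Rightarrow> (nat \<times> nat) ell2" is
  "\<lambda>f p. if fst p = 0 then 0 else f (fst p - 1, snd p)"
proof -
  fix f :: "nat \<times> nat \<Rightarrow> complex" assume f: "square_summable f"
  let ?h = "\<lambda>p :: nat \<times> nat. (Suc (fst p), snd p)"
  let ?g = "\<lambda>p. if fst p = 0 then 0 else f (fst p - 1, snd p)"
  have "inj ?h" by (auto simp: inj_on_def prod_eq_iff)
  from summable_on_reindex[OF this, of "\<lambda>p. (cmod (?g p))\<^sup>2"] f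
  have "(\<lambda>p. (cmod (?g p))\<^sup>2) summable_on range ?h" by (simp add: square_summable_def o_def)
  also have "?this \<longleftrightarrow> (\<lambda>p. (cmod (?g p))\<^sup>2) summable_on UNIV"
  proof (rule summable_on_cong_neutral)
    fix p :: "nat \<times> nat" assume "p \<in> UNIV - range ?h"
    then have "fst p = 0" by (cases p; cases "fst p") (auto simp: image_iff)
    then show "(cmod (?g p))\<^sup>2 = 0" by simp
  qed auto
  finally show "square_summable ?g" by (simp add: square_summable_def)
qed

lemma linear_ell2_shift: "linear ell2_shift"
  by (rule linearI; transfer) (auto simp: fun_eq_iff)

lemma linear_ell2_bshift: "linear ell2_bshift"
  by (rule linearI; transfer) (auto simp: fun_eq_iff)

lemma norm_ell2_shift: "norm (ell2_shift x) = norm x"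
proof -
  have "inner (ell2_shift x) (ell2_shift x) = inner x x"
    by transfer (subst infsum_shift_fst, auto)
  then show ?thesis by (simp add: norm_eq_sqrt_inner)
qed

lemma ell2_shift_adjoint: "inner (ell2_bshift x) y = inner x (ell2_shift y)"
  by transfer (subst (2) infsum_shift_fst, auto)

lemma Rep_ell2_bshift_pow: "Rep_ell2 ((ell2_bshift ^^ n) x) p = Rep_ell2 x (fst p + n, snd p)"
  by (induction n arbitrary: p) (auto simp: ell2_bshift.rep_eq)

text \<open>The squared norm of the n-th iterate is the sum over degrees at least n. A finite set F
  carries the total sum up to e^2/2, and once n exceeds all degrees in F, only the rest
  contributes.\<close>

lemma ell2_bshift_stable: "(\<lambda>n. (ell2_bshift ^^ n) x) \<longlonglongrightarrow> 0"
proof (rule LIMSEQ_I)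
  fix e :: real assume e: "e > 0"
  let ?g = "\<lambda>p. (cmod (Rep_ell2 x p))\<^sup>2"
  have g: "?g summable_on UNIV" using square_summable_Rep[of x] by (simp add: square_summable_def)
  from infsum_finite_approximation[OF g, of "e\<^sup>2/2"] e obtain F where
    F: "finite F" "dist (sum ?g F) (infsum ?g UNIV) \<le> e\<^sup>2/2" by auto
  define N where "N = Suc (Max (insert 0 (fst ` F)))"
  have "norm ((ell2_bshift ^^ n) x) < e" if n: "n \<ge> N" for n
  proof -
    have "(norm ((ell2_bshift ^^ n) x))\<^sup>2 \<le> e\<^sup>2/2"
      unfolding ell2_norm_square Rep_ell2_bshift_pow
    proof (rule infsum_le_finite_sums)
      let ?h = "\<lambda>p :: nat \<times> nat. (fst p + n, snd p)"
      show "(\<lambda>p. ?g (?h p)) summable_on UNIV"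
        using square_summable_reindex[of ?h, OF _ square_summable_Rep[of x]]
        by (auto simp: square_summable_def inj_on_def prod_eq_iff)
      fix G :: "(nat \<times> nat) set" assume G: "finite G"
      have "fst q < N" if "q \<in> F" for q
        unfolding N_def less_Suc_eq_le by (rule Max_ge) (use F(1) that in auto)
      then have disj: "F \<inter> ?h ` G = {}" using n by force
      have "sum ?g F + sum ?g (?h ` G) = sum ?g (F \<union> ?h ` G)"
        using F(1) G disj by (simp add: sum.union_disjoint)
      also have "\<dots> \<le> infsum ?g UNIV" using F(1) G by (intro finite_sum_le_infsum g) auto
      finally have "sum ?g (?h ` G) \<le> e\<^sup>2/2" using F(2) unfolding dist_real_def by linarith
      also have "sum ?g (?h ` G) = (\<Sum>p\<in>G. ?g (?h p))"
        by (subst sum.reindex) (auto simp: inj_on_def prod_eq_iff)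
      finally show "(\<Sum>p\<in>G. ?g (?h p)) \<le> e\<^sup>2/2" .
    qed
    also have "\<dots> < e\<^sup>2" using e by simp
    finally show ?thesis by (rule power2_less_imp_less) (use e in simp)
  qed
  then show "\<exists>N. \<forall>n\<ge>N. norm ((ell2_bshift ^^ n) x - 0) < e" by auto
qed

section \<open>Taylor coefficients and the Hardy space\<close>

text \<open>Weaker than membership in \<open>H2\<close>, because a product of a matrix with a vector
  of Hardy functions is holomorphic on the disc but not known in advance to be square
  summable.\<close>

definition disc_holomorphic :: "cvfun \<Rightarrow> bool" where
  "disc_holomorphic F \<longleftrightarrow> (\<forall>i. (\<lambda>z. F z i) holomorphic_on ball 0 1)"

definition taylor_fps :: "cvfun \<Rightarrow> nat \<Rightarrow> complex fps" where
  "taylor_fps F i = fps_expansion (\<lambda>z. F z i) 0"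

lemma taylor_coeff_fps: "taylor_coeff F n i = fps_nth (taylor_fps F i) n"
  by (simp add: taylor_coeff_def taylor_fps_def fps_expansion_def)

lemma has_fps_expansion_taylor_fps:
  "disc_holomorphic F \<Longrightarrow> (\<lambda>z. F z i) has_fps_expansion taylor_fps F i"
  unfolding taylor_fps_def disc_holomorphic_def
  by (intro analytic_at_imp_has_fps_expansion_0) (auto intro: holomorphic_on_imp_analytic_at)

lemma taylor_fps_eqI: "(\<lambda>z. F z i) has_fps_expansion P \<Longrightarrow> taylor_fps F i = P"
  unfolding taylor_fps_def fps_expansion_def
  by (simp add: fps_eq_iff fps_nth_fps_expansion)

lemma eq_on_disc_if_taylor_fps_eq:
  assumes "disc_holomorphic F" "disc_holomorphic G" "taylor_fps F i = taylor_fps G i" "z \<in> ball 0 1"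
  shows "F z i = G z i"
proof (rule holomorphic_fun_eq_on_ball[OF _ _ assms(4)])
  show "(deriv ^^ n) (\<lambda>z. F z i) 0 = (deriv ^^ n) (\<lambda>z. G z i) 0" for n
    using arg_cong[OF assms(3), of "\<lambda>P. fps_nth P n"] by (simp add: taylor_fps_def fps_expansion_def)
qed (use assms in \<open>auto simp: disc_holomorphic_def\<close>)

lemma disc_holomorphic_add: "disc_holomorphic F \<Longrightarrow> disc_holomorphic G \<Longrightarrow> disc_holomorphic (F + G)"
  and disc_holomorphic_cscale: "disc_holomorphic F \<Longrightarrow> disc_holomorphic (cscale c F)"
  and disc_holomorphic_shift: "disc_holomorphic F \<Longrightarrow> disc_holomorphic (shift F)"
  by (auto simp: disc_holomorphic_def cscale_def shift_def intro!: holomorphic_intros)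

lemma taylor_fps_add:
  "disc_holomorphic F \<Longrightarrow> disc_holomorphic G \<Longrightarrow> taylor_fps (F + G) i = taylor_fps F i + taylor_fps G i"
  by (rule taylor_fps_eqI) (auto intro!: fps_expansion_intros has_fps_expansion_taylor_fps)

lemma taylor_fps_cscale:
  "disc_holomorphic F \<Longrightarrow> taylor_fps (cscale c F) i = fps_const c * taylor_fps F i"
  by (rule taylor_fps_eqI) (auto simp: cscale_def intro!: fps_expansion_intros has_fps_expansion_taylor_fps)

lemma taylor_fps_shift:
  "disc_holomorphic F \<Longrightarrow> taylor_fps (shift F) i = fps_X * taylor_fps F i"
  by (rule taylor_fps_eqI) (auto simp: shift_def intro!: fps_expansion_intros has_fps_expansion_taylor_fps)

lemma disc_holomorphic_bshift:
  assumes "disc_holomorphic F" shows "disc_holomorphic (bshift F)"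
  unfolding disc_holomorphic_def
proof
  fix i
  have "(\<lambda>z. if z = 0 then deriv (\<lambda>w. F w i) 0 else (F z i - F 0 i) / (z - 0)) holomorphic_on ball 0 1"
    using assms by (intro pole_lemma_open) (auto simp: disc_holomorphic_def)
  also have "?this \<longleftrightarrow> (\<lambda>z. bshift F z i) holomorphic_on ball 0 1"
    by (rule holomorphic_cong) (auto simp: bshift_def)
  finally show "(\<lambda>z. bshift F z i) holomorphic_on ball 0 1" .
qed

lemma bshift_decomp: "z \<in> ball 0 1 \<Longrightarrow> F z i = F 0 i + z * bshift F z i"
  by (auto simp: bshift_def)

lemma taylor_fps_decomp:
  assumes "disc_holomorphic F"
  shows "taylor_fps F i = fps_const (F 0 i) + fps_X * taylor_fps (bshift F) i"
proof (rule taylor_fps_eqI)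
  have "(\<lambda>z. F 0 i + z * bshift F z i) has_fps_expansion fps_const (F 0 i) + fps_X * taylor_fps (bshift F) i"
    by (intro fps_expansion_intros has_fps_expansion_taylor_fps disc_holomorphic_bshift assms)
  moreover have "eventually (\<lambda>z. F 0 i + z * bshift F z i = F z i) (nhds 0)"
    using eventually_nhds_in_open[of "ball 0 1" "0::complex"]
    by (auto simp: bshift_decomp[symmetric] elim!: eventually_mono)
  ultimately show "(\<lambda>z. F z i) has_fps_expansion fps_const (F 0 i) + fps_X * taylor_fps (bshift F) i"
    unfolding has_fps_expansion_def by (auto elim: eventually_elim2)
qed

lemma taylor_coeff_0: "taylor_coeff F 0 i = F 0 i"
  by (simp add: taylor_coeff_def)

lemma taylor_coeff_bshift: "disc_holomorphic F \<Longrightarrow> taylor_coeff (bshift F) n i = taylor_coeff F (Suc n) i"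
  by (simp add: taylor_coeff_fps taylor_fps_decomp[of F])

section \<open>Unordered sums over pairs and series of finite sums\<close>

lemma infsum_pairs_finite_snd:
  fixes f :: "nat \<times> nat \<Rightarrow> 'a::banach"
  assumes "f summable_on UNIV" "\<And>n i. d \<le> i \<Longrightarrow> f (n, i) = 0"
  shows "(\<lambda>n. \<Sum>i<d. f (n, i)) sums infsum f UNIV"
proof -
  have z: "f p = 0" if "p \<notin> UNIV \<times> {..<d}" for p
    using assms(2)[of "snd p" "fst p"] that by (cases p) (auto simp: not_less)
  have "(f has_sum infsum f UNIV) UNIV" using assms(1) by simp
  also have "?this \<longleftrightarrow> (f has_sum infsum f UNIV) (Sigma UNIV (\<lambda>_. {..<d}))"
    by (rule has_sum_cong_neutral) (blast intro: z)+
  finally have "((\<lambda>n. \<Sum>i<d. f (n, i)) has_sum infsum f UNIV) UNIV"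
    by (rule has_sum_SigmaD) (auto intro: has_sum_finite)
  then show ?thesis by (rule has_sum_imp_sums)
qed

lemma summable_pairs_finite_snd:
  fixes f :: "nat \<times> nat \<Rightarrow> real"
  assumes "summable (\<lambda>n. \<Sum>i<d. f (n, i))" "\<And>n i. d \<le> i \<Longrightarrow> f (n, i) = 0" "\<And>p. f p \<ge> 0"
  shows "f summable_on UNIV"
proof -
  have z: "f p = 0" if "p \<notin> UNIV \<times> {..<d}" for p
    using assms(2)[of "snd p" "fst p"] that by (cases p) (auto simp: not_less)
  have "f summable_on (Sigma UNIV (\<lambda>_. {..<d}))"
    by (rule summable_on_SigmaI[where g = "\<lambda>n. \<Sum>i<d. f (n, i)"])
      (use assms in \<open>auto intro!: has_sum_finite summable_nonneg_imp_summable_on sum_nonneg\<close>)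
  also have "?this \<longleftrightarrow> f summable_on UNIV"
    by (rule summable_on_cong_neutral) (blast intro: z)+
  finally show ?thesis .
qed

definition H2_coeffs :: "nat \<Rightarrow> cvfun \<Rightarrow> nat \<times> nat \<Rightarrow> complex" where
  "H2_coeffs d F p = (if snd p < d then taylor_coeff F (fst p) (snd p) else 0)"

text \<open>One index type serves every dimension d: the coefficients in coordinates from d on are
  zero, and the image of \<open>H2 d\<close> is the set of families with this property.\<close>

definition to_ell2 :: "nat \<Rightarrow> cvfun \<Rightarrow> (nat \<times> nat) ell2" where
  "to_ell2 d F = Abs_ell2 (H2_coeffs d F)"

lemma H2_disc_holomorphic: "F \<in> H2 d \<Longrightarrow> disc_holomorphic F"
  unfolding disc_holomorphic_def
proof
  fix i assume F: "F \<in> H2 d"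
  show "(\<lambda>z. F z i) holomorphic_on ball 0 1"
  proof (cases "i < d")
    case False
    then have "(\<lambda>z. F z i) = (\<lambda>_. 0)" using F by (auto simp: H2_def fun_eq_iff)
    then show ?thesis by simp
  qed (use F in \<open>auto simp: H2_def\<close>)
qed

lemma H2_zero: "F \<in> H2 d \<Longrightarrow> z \<notin> ball 0 1 \<or> d \<le> i \<Longrightarrow> F z i = 0"
  unfolding H2_def by blast

lemma square_summable_iff:
  "square_summable (H2_coeffs d F) \<longleftrightarrow> summable (\<lambda>n. \<Sum>i<d. (cmod (taylor_coeff F n i))\<^sup>2)"
proof
  assume "square_summable (H2_coeffs d F)"
  then have "(\<lambda>p. (cmod (H2_coeffs d F p))\<^sup>2) summable_on UNIV" by (simp add: square_summable_def)
  from infsum_pairs_finite_snd[OF this, of d]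
  show "summable (\<lambda>n. \<Sum>i<d. (cmod (taylor_coeff F n i))\<^sup>2)"
    by (simp add: H2_coeffs_def sums_iff)
next
  assume "summable (\<lambda>n. \<Sum>i<d. (cmod (taylor_coeff F n i))\<^sup>2)"
  then show "square_summable (H2_coeffs d F)" unfolding square_summable_def
    by (intro summable_pairs_finite_snd[where d = d]) (auto simp: H2_coeffs_def)
qed

lemma H2I:
  assumes "disc_holomorphic F" "\<And>z i. z \<notin> ball 0 1 \<or> d \<le> i \<Longrightarrow> F z i = 0" "square_summable (H2_coeffs d F)"
  shows "F \<in> H2 d"
  using assms unfolding H2_def square_summable_iff disc_holomorphic_def by blast

lemma H2_square_summable: "F \<in> H2 d \<Longrightarrow> square_summable (H2_coeffs d F)"
  unfolding square_summable_iff by (simp add: H2_def)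

lemma Rep_to_ell2: "F \<in> H2 d \<Longrightarrow> Rep_ell2 (to_ell2 d F) = H2_coeffs d F"
  by (simp add: to_ell2_def Abs_ell2_inverse H2_square_summable)

lemma H2_inner_eq_infsum:
  assumes "F \<in> H2 d" "G \<in> H2 d"
  shows "H2_inner d F G = (\<Sum>\<^sub>\<infinity>p. H2_coeffs d F p * cnj (H2_coeffs d G p))"
proof -
  have "(\<lambda>n. \<Sum>i<d. H2_coeffs d F (n, i) * cnj (H2_coeffs d G (n, i))) sums
      (\<Sum>\<^sub>\<infinity>p. H2_coeffs d F p * cnj (H2_coeffs d G p))"
  proof (rule infsum_pairs_finite_snd)
    show "(\<lambda>p. H2_coeffs d F p * cnj (H2_coeffs d G p)) summable_on UNIV"
      by (intro square_summable_mult_cnj H2_square_summable assms)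
  qed (simp add: H2_coeffs_def)
  then show ?thesis by (simp add: H2_inner_def sums_iff H2_coeffs_def)
qed

lemma inner_to_ell2:
  assumes "F \<in> H2 d" "G \<in> H2 d"
  shows "inner (to_ell2 d F) (to_ell2 d G) = Re (H2_inner d F G)"
proof -
  have "Re (H2_inner d F G) = (\<Sum>\<^sub>\<infinity>p. Re (H2_coeffs d F p * cnj (H2_coeffs d G p)))"
    unfolding H2_inner_eq_infsum[OF assms]
    by (rule infsum_Re[symmetric]) (intro square_summable_mult_cnj H2_square_summable assms)
  then show ?thesis by (simp add: inner_ell2.rep_eq Rep_to_ell2 assms inner_complex_def)
qed

lemma H2_norm_eq: "F \<in> H2 d \<Longrightarrow> H2_norm d F = norm (to_ell2 d F)"
proof -
  assume F: "F \<in> H2 d"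
  then have "(\<lambda>p. (cmod (H2_coeffs d F p))\<^sup>2) summable_on UNIV"
    using H2_square_summable by (simp add: square_summable_def)
  from infsum_pairs_finite_snd[OF this, of d]
  have "H2_norm d F = sqrt (\<Sum>\<^sub>\<infinity>p. (cmod (H2_coeffs d F p))\<^sup>2)"
    by (simp add: H2_norm_def H2_coeffs_def sums_iff)
  also have "\<dots> = sqrt ((norm (to_ell2 d F))\<^sup>2)"
    by (simp add: ell2_norm_square Rep_to_ell2 F)
  finally show ?thesis by simp
qed

lemma H2_coeffs_add:
  "disc_holomorphic F \<Longrightarrow> disc_holomorphic G \<Longrightarrow> H2_coeffs d (F + G) = (\<lambda>p. H2_coeffs d F p + H2_coeffs d G p)"
  by (auto simp: H2_coeffs_def taylor_coeff_fps taylor_fps_add)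

lemma H2_coeffs_cscale:
  "disc_holomorphic F \<Longrightarrow> H2_coeffs d (cscale c F) = (\<lambda>p. c * H2_coeffs d F p)"
  by (auto simp: H2_coeffs_def taylor_coeff_fps taylor_fps_cscale)

lemma H2_coeffs_bshift:
  "disc_holomorphic F \<Longrightarrow> H2_coeffs d (bshift F) = (\<lambda>p. H2_coeffs d F (Suc (fst p), snd p))"
  by (auto simp: H2_coeffs_def taylor_coeff_bshift)

lemma H2_coeffs_shift:
  "disc_holomorphic F \<Longrightarrow> H2_coeffs d (shift F) = (\<lambda>p. if fst p = 0 then 0 else H2_coeffs d F (fst p - 1, snd p))"
  by (auto simp: H2_coeffs_def taylor_coeff_fps taylor_fps_shift fun_eq_iff)

lemma taylor_fps_0 [simp]: "taylor_fps 0 i = 0"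
  by (rule taylor_fps_eqI) auto

lemma H2_0: "0 \<in> H2 d"
proof (rule H2I)
  have "H2_coeffs d 0 = (\<lambda>_. 0)" by (auto simp: H2_coeffs_def taylor_coeff_fps)
  then show "square_summable (H2_coeffs d 0)" by (simp add: square_summable_0)
qed (auto simp: disc_holomorphic_def)

lemma H2_add: "F \<in> H2 d \<Longrightarrow> G \<in> H2 d \<Longrightarrow> F + G \<in> H2 d"
proof (rule H2I)
  assume F: "F \<in> H2 d" and G: "G \<in> H2 d"
  show "disc_holomorphic (F + G)" using F G by (intro disc_holomorphic_add H2_disc_holomorphic)
  show "(F + G) z i = 0" if "z \<notin> ball 0 1 \<or> d \<le> i" for z i
    using H2_zero[OF F that] H2_zero[OF G that] by simp
  show "square_summable (H2_coeffs d (F + G))"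
    using F G by (simp add: H2_coeffs_add H2_disc_holomorphic square_summable_add H2_square_summable)
qed

lemma H2_cscale: "F \<in> H2 d \<Longrightarrow> cscale c F \<in> H2 d"
proof (rule H2I)
  assume F: "F \<in> H2 d"
  show "disc_holomorphic (cscale c F)" using F by (intro disc_holomorphic_cscale H2_disc_holomorphic)
  show "cscale c F z i = 0" if "z \<notin> ball 0 1 \<or> d \<le> i" for z i
    using H2_zero[OF F that] by (simp add: cscale_def)
  show "square_summable (H2_coeffs d (cscale c F))"
    using F by (simp add: H2_coeffs_cscale H2_disc_holomorphic square_summable_mult H2_square_summable)
qed

lemma subspace_H2: "cvfun.subspace (H2 d)"
  unfolding cvfun.subspace_def by (auto intro: H2_0 H2_add H2_cscale)

lemmas H2_diff = cvfun.subspace_diff[OF subspace_H2]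
lemmas H2_sum = cvfun.subspace_sum[OF subspace_H2]

lemma to_ell2_add: "F \<in> H2 d \<Longrightarrow> G \<in> H2 d \<Longrightarrow> to_ell2 d (F + G) = to_ell2 d F + to_ell2 d G"
  by (rule ell2_eqI) (simp add: plus_ell2.rep_eq Rep_to_ell2 H2_add H2_coeffs_add H2_disc_holomorphic)

lemma to_ell2_scaleR: "F \<in> H2 d \<Longrightarrow> to_ell2 d (cscale (of_real c) F) = c *\<^sub>R to_ell2 d F"
  by (rule ell2_eqI)
    (simp add: scaleR_ell2.rep_eq Rep_to_ell2 H2_cscale H2_coeffs_cscale H2_disc_holomorphic scaleR_conv_of_real)

lemma to_ell2_diff: "F \<in> H2 d \<Longrightarrow> G \<in> H2 d \<Longrightarrow> to_ell2 d (F - G) = to_ell2 d F - to_ell2 d G"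
  using to_ell2_add[of "F - G" d G] by (simp add: H2_diff)

lemma H2_bshift: "F \<in> H2 d \<Longrightarrow> bshift F \<in> H2 d"
proof (rule H2I)
  assume F: "F \<in> H2 d"
  show "disc_holomorphic (bshift F)" using F by (intro disc_holomorphic_bshift H2_disc_holomorphic)
  show "bshift F z i = 0" if "z \<notin> ball 0 1 \<or> d \<le> i" for z i
  proof (cases "d \<le> i")
    case True
    then have "(\<lambda>w. F w i) = (\<lambda>_. 0)" using F by (auto simp: H2_zero)
    then have "F w i = 0" for w by metis
    with \<open>(\<lambda>w. F w i) = (\<lambda>_. 0)\<close> show ?thesis by (simp add: bshift_def)
  qed (use that in \<open>auto simp: bshift_def\<close>)
  show "square_summable (H2_coeffs d (bshift F))"
    using Rep_ell2[of "ell2_bshift (to_ell2 d F)"] F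
    by (simp add: ell2_bshift.rep_eq Rep_to_ell2 H2_coeffs_bshift H2_disc_holomorphic)
qed

lemma to_ell2_bshift: "F \<in> H2 d \<Longrightarrow> to_ell2 d (bshift F) = ell2_bshift (to_ell2 d F)"
  by (rule ell2_eqI)
    (simp add: ell2_bshift.rep_eq Rep_to_ell2 H2_bshift H2_coeffs_bshift H2_disc_holomorphic)

lemma H2_shift: "F \<in> H2 d \<Longrightarrow> shift F \<in> H2 d"
proof (rule H2I)
  assume F: "F \<in> H2 d"
  show "disc_holomorphic (shift F)" using F by (intro disc_holomorphic_shift H2_disc_holomorphic)
  show "shift F z i = 0" if "z \<notin> ball 0 1 \<or> d \<le> i" for z i
    using H2_zero[OF F that] by (simp add: shift_def)
  show "square_summable (H2_coeffs d (shift F))"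
    using Rep_ell2[of "ell2_shift (to_ell2 d F)"] F
    by (simp add: ell2_shift.rep_eq Rep_to_ell2 H2_coeffs_shift H2_disc_holomorphic cong: if_cong)
qed

lemma to_ell2_shift: "F \<in> H2 d \<Longrightarrow> to_ell2 d (shift F) = ell2_shift (to_ell2 d F)"
  by (rule ell2_eqI)
    (simp add: ell2_shift.rep_eq Rep_to_ell2 H2_shift H2_coeffs_shift H2_disc_holomorphic)

lemma H2_eqI:
  assumes F: "F \<in> H2 d" and G: "G \<in> H2 d" and eq: "\<And>i. i < d \<Longrightarrow> taylor_fps F i = taylor_fps G i"
  shows "F = G"
proof (intro ext)
  fix z i
  show "F z i = G z i"
  proof (cases "z \<in> ball 0 1 \<and> i < d")
    case True
    then show ?thesis
      using eq_on_disc_if_taylor_fps_eq[OF H2_disc_holomorphic[OF F] H2_disc_holomorphic[OF G] eq] by blast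
  next
    case False
    then have "z \<notin> ball 0 1 \<or> d \<le> i" by auto
    then show ?thesis using H2_zero[OF F] H2_zero[OF G] by simp
  qed
qed

lemma to_ell2_inj: "F \<in> H2 d \<Longrightarrow> G \<in> H2 d \<Longrightarrow> to_ell2 d F = to_ell2 d G \<Longrightarrow> F = G"
proof (rule H2_eqI)
  fix i assume *: "F \<in> H2 d" "G \<in> H2 d" "to_ell2 d F = to_ell2 d G" "i < d"
  then have "H2_coeffs d F (n, i) = H2_coeffs d G (n, i)" for n using Rep_to_ell2 by metis
  then show "taylor_fps F i = taylor_fps G i"
    using *(4) by (simp add: H2_coeffs_def taylor_coeff_fps fps_eq_iff)
qed

text \<open>Each coefficient is bounded by the norm of the family, so the series is dominated by a
  geometric one inside the disc.\<close>

lemma square_summable_conv_radius: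
  assumes "square_summable a"
  shows "fps_conv_radius (Abs_fps (\<lambda>n. a (n, i))) \<ge> 1"
  unfolding fps_conv_radius_def
proof (rule conv_radius_geI_ex')
  fix r :: real assume r: "0 < r" "ereal r < 1"
  obtain x where x: "a = Rep_ell2 x" using assms Rep_ell2_cases[of a] by auto
  have "summable (\<lambda>n. norm x * r ^ n)" using r by (intro summable_mult summable_geometric) auto
  then show "summable (\<lambda>n. fps_nth (Abs_fps (\<lambda>n. a (n, i))) n * of_real r ^ n)"
    by (rule summable_comparison_test'[where N=0])
      (use r norm_coord_le in \<open>auto simp: x norm_mult norm_power intro!: mult_right_mono\<close>)
qed

text \<open>The function is the sum of the power series, cut off to 0 outside the disc as
  \<open>H2\<close> demands. This surjectivity is what later turns a sequence of coefficients into
  an element of the model space.\<close>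

lemma exists_H2_of_coeffs:
  assumes a: "square_summable a" and d: "\<And>n i. d \<le> i \<Longrightarrow> a (n, i) = 0"
  obtains F where "F \<in> H2 d" "\<And>i. taylor_fps F i = Abs_fps (\<lambda>n. a (n, i))" "H2_coeffs d F = a"
proof
  let ?P = "\<lambda>i. Abs_fps (\<lambda>n. a (n, i))"
  let ?F = "\<lambda>z i. if z \<in> ball 0 1 then eval_fps (?P i) z else 0"
  have rad: "fps_conv_radius (?P i) \<ge> 1" for i by (rule square_summable_conv_radius[OF a])
  show fps: "taylor_fps ?F i = ?P i" for i
  proof (rule taylor_fps_eqI)
    have "eventually (\<lambda>z. eval_fps (?P i) z = ?F z i) (nhds 0)"
      using eventually_nhds_in_open[of "ball 0 1" "0::complex"] by (auto elim!: eventually_mono)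
    moreover have "fps_conv_radius (?P i) > 0" using rad[of i] by (rule less_le_trans[rotated]) simp
    ultimately show "(\<lambda>z. ?F z i) has_fps_expansion ?P i" by (simp add: has_fps_expansion_def)
  qed
  show co: "H2_coeffs d ?F = a"
    by (auto simp: H2_coeffs_def taylor_coeff_fps fps d fun_eq_iff simp del: mem_ball mem_ball_0)
  show "?F \<in> H2 d"
  proof (rule H2I)
    show "disc_holomorphic ?F" unfolding disc_holomorphic_def
    proof
      fix i
      have "eval_fps (?P i) holomorphic_on ball 0 1"
      proof (rule holomorphic_on_eval_fps, rule subsetI)
        fix z :: complex assume "z \<in> ball 0 1"
        then have "ereal (norm z) < 1" by simp
        also have "\<dots> \<le> fps_conv_radius (?P i)" by (rule rad)
        finally show "z \<in> eball 0 (fps_conv_radius (?P i))" by simp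
      qed
      then show "(\<lambda>z. ?F z i) holomorphic_on ball 0 1" by (rule holomorphic_transform) auto
    qed
    show "?F z i = 0" if "z \<notin> ball 0 1 \<or> d \<le> i" for z i
      using that d by (auto simp: eval_fps_def)
    show "square_summable (H2_coeffs d ?F)" unfolding co by (rule a)
  qed
qed

lemma to_ell2_image:
  "to_ell2 d ` H2 d = {x. \<forall>n i. d \<le> i \<longrightarrow> Rep_ell2 x (n, i) = 0}"
proof (intro equalityI subsetI)
  fix x :: "(nat \<times> nat) ell2" assume "x \<in> {x. \<forall>n i. d \<le> i \<longrightarrow> Rep_ell2 x (n, i) = 0}"
  then have "Rep_ell2 x (n, i) = 0" if "d \<le> i" for n i using that by blast
  then obtain F where F: "F \<in> H2 d" "H2_coeffs d F = Rep_ell2 x"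
    by (rule exists_H2_of_coeffs[OF square_summable_Rep, of d x]) ((assumption | rule that)+)
  then have "x = to_ell2 d F" by (intro ell2_eqI) (simp add: Rep_to_ell2)
  then show "x \<in> to_ell2 d ` H2 d" using F(1) by blast
next
  fix x assume "x \<in> to_ell2 d ` H2 d"
  then show "x \<in> {x. \<forall>n i. d \<le> i \<longrightarrow> Rep_ell2 x (n, i) = 0}"
    by (auto simp: Rep_to_ell2 H2_coeffs_def)
qed

text \<open>For closedness, a limit in the sequence space still vanishes in the coordinates from d
  on, hence comes from a function in \<open>H2 d\<close>; closedness of M in the Hardy norm then
  applies.\<close>

lemma closed_subspace_to_ell2:
  assumes "closed_subspace_H2 d M"
  shows "subspace (to_ell2 d ` M)" "closed (to_ell2 d ` M)"
proof -
  have sub: "M \<subseteq> H2 d" and sp: "cvfun.subspace M" using assms by (auto simp: closed_subspace_H2_def)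
  show "subspace (to_ell2 d ` M)"
    unfolding subspace_def
  proof (intro conjI ballI allI)
    show "0 \<in> to_ell2 d ` M"
      using to_ell2_scaleR[OF H2_0, of d 0] cvfun.subspace_0[OF sp] by (auto simp: image_iff intro!: bexI[of _ 0])
    show "x + y \<in> to_ell2 d ` M" if "x \<in> to_ell2 d ` M" "y \<in> to_ell2 d ` M" for x y
    proof -
      from that obtain F G where "F \<in> M" "G \<in> M" "x = to_ell2 d F" "y = to_ell2 d G" by blast
      then have "x + y = to_ell2 d (F + G)" using sub by (simp add: to_ell2_add subset_iff)
      then show ?thesis using cvfun.subspace_add[OF sp \<open>F \<in> M\<close> \<open>G \<in> M\<close>] by blast
    qed
    show "c *\<^sub>R x \<in> to_ell2 d ` M" if "x \<in> to_ell2 d ` M" for c x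
    proof -
      from that obtain F where "F \<in> M" "x = to_ell2 d F" by blast
      then have "c *\<^sub>R x = to_ell2 d (cscale (of_real c) F)" using sub by (simp add: to_ell2_scaleR subset_iff)
      then show ?thesis using cvfun.subspace_scale[OF sp \<open>F \<in> M\<close>] by blast
    qed
  qed
  show "closed (to_ell2 d ` M)"
    unfolding closed_sequential_limits
  proof (intro allI impI, elim conjE)
    fix x l assume x: "\<forall>n. x n \<in> to_ell2 d ` M" and lim: "x \<longlonglongrightarrow> l"
    then have "\<forall>n. \<exists>F. F \<in> M \<and> x n = to_ell2 d F" by blast
    then obtain X where X: "\<And>n. X n \<in> M" "\<And>n. x n = to_ell2 d (X n)" by metis
    have "Rep_ell2 l (n, i) = 0" if "d \<le> i" for n i
    proof -
      have "Rep_ell2 (x k) (n, i) = 0" for k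
      proof -
        have "X k \<in> H2 d" using X(1) sub by blast
        then show ?thesis using that by (simp add: X(2) Rep_to_ell2 H2_coeffs_def)
      qed
      then show ?thesis using tendsto_coord[OF lim, of "(n, i)"] by (simp add: LIMSEQ_const_iff)
    qed
    then have "l \<in> to_ell2 d ` H2 d" by (simp add: to_ell2_image)
    then obtain F where F: "F \<in> H2 d" "l = to_ell2 d F" by blast
    have "(\<lambda>n. norm (x n - l)) \<longlonglongrightarrow> 0" using lim by (simp add: LIM_zero tendsto_norm_zero)
    also have "(\<lambda>n. norm (x n - l)) = (\<lambda>n. H2_norm d (X n - F))"
    proof
      fix n
      have "X n \<in> H2 d" using X sub by blast
      then show "norm (x n - l) = H2_norm d (X n - F)"
        using F X by (simp add: H2_norm_eq H2_diff flip: to_ell2_diff)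
    qed
    finally have "(\<forall>n. X n \<in> M) \<and> F \<in> H2 d \<and> (\<lambda>n. H2_norm d (X n - F)) \<longlonglongrightarrow> 0"
      using X(1) F(1) by simp
    then have "F \<in> M" using assms unfolding closed_subspace_H2_def by metis
    then show "l \<in> to_ell2 d ` M" using F(2) by blast
  qed
qed

section \<open>Orthonormal bases and column multiplication\<close>

lemma H2_inner_commute: "F \<in> H2 d \<Longrightarrow> G \<in> H2 d \<Longrightarrow> H2_inner d G F = cnj (H2_inner d F G)"
  by (simp add: H2_inner_eq_infsum mult.commute flip: infsum_cnj)

lemma H2_inner_add_left:
  assumes "F \<in> H2 d" "F' \<in> H2 d" "G \<in> H2 d"
  shows "H2_inner d (F + F') G = H2_inner d F G + H2_inner d F' G"
proof -
  have "H2_inner d (F + F') G = (\<Sum>\<^sub>\<infinity>p. H2_coeffs d F p * cnj (H2_coeffs d G p) + H2_coeffs d F' p * cnj (H2_coeffs d G p))"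
    by (simp add: H2_inner_eq_infsum H2_add assms H2_coeffs_add H2_disc_holomorphic[of _ d] distrib_right)
  also have "\<dots> = H2_inner d F G + H2_inner d F' G"
    unfolding H2_inner_eq_infsum[OF assms(1,3)] H2_inner_eq_infsum[OF assms(2,3)]
    by (intro infsum_add square_summable_mult_cnj H2_square_summable assms)
  finally show ?thesis .
qed

lemma H2_inner_cscale_left:
  assumes "F \<in> H2 d" "G \<in> H2 d"
  shows "H2_inner d (cscale c F) G = c * H2_inner d F G"
proof -
  have "H2_inner d (cscale c F) G = (\<Sum>\<^sub>\<infinity>p. c * (H2_coeffs d F p * cnj (H2_coeffs d G p)))"
    by (simp add: H2_inner_eq_infsum H2_cscale assms H2_coeffs_cscale H2_disc_holomorphic[of _ d] mult.assoc)
  also have "\<dots> = c * H2_inner d F G"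
    unfolding H2_inner_eq_infsum[OF assms]
    by (intro infsum_cmult_right square_summable_mult_cnj H2_square_summable assms)
  finally show ?thesis .
qed

lemma H2_inner_0_left: "G \<in> H2 d \<Longrightarrow> H2_inner d 0 G = 0"
  using H2_inner_cscale_left[of 0 d G 0] by (simp add: H2_0)

lemma H2_inner_diff_left:
  assumes "F \<in> H2 d" "F' \<in> H2 d" "G \<in> H2 d"
  shows "H2_inner d (F - F') G = H2_inner d F G - H2_inner d F' G"
  using H2_inner_add_left[of "F - F'" d F' G] assms by (simp add: H2_diff)

lemma H2_inner_sum_left:
  assumes "G \<in> H2 d" "\<And>i. i \<in> I \<Longrightarrow> F i \<in> H2 d"
  shows "H2_inner d (\<Sum>i\<in>I. F i) G = (\<Sum>i\<in>I. H2_inner d (F i) G)"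
  using assms(2)
  by (induction I rule: infinite_finite_induct)
    (simp_all add: H2_inner_0_left H2_inner_add_left H2_sum assms(1))

lemma H2_inner_self: "F \<in> H2 d \<Longrightarrow> H2_inner d F F = of_real ((H2_norm d F)\<^sup>2)"
proof -
  assume F: "F \<in> H2 d"
  have "Im (H2_inner d F F) = 0" using arg_cong[OF H2_inner_commute[OF F F], of Im] by simp
  moreover have "Re (H2_inner d F F) = (H2_norm d F)\<^sup>2"
    using F by (simp add: H2_norm_eq power2_norm_eq_inner inner_to_ell2)
  ultimately show ?thesis by (simp add: complex_eq_iff)
qed

lemma H2_norm_eq_0: "F \<in> H2 d \<Longrightarrow> H2_norm d F = 0 \<Longrightarrow> F = 0"
proof (rule to_ell2_inj[OF _ H2_0])
  assume F: "F \<in> H2 d" and "H2_norm d F = 0"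
  have "to_ell2 d 0 = 0" using to_ell2_scaleR[OF H2_0, of d 0] by simp
  with F \<open>H2_norm d F = 0\<close> show "to_ell2 d F = to_ell2 d 0" by (simp add: H2_norm_eq)
qed

lemma H2_inner_zero_right: "F \<in> H2 d \<Longrightarrow> G \<in> H2 d \<Longrightarrow> H2_inner d F G = 0 \<Longrightarrow> H2_inner d G F = 0"
  by (simp add: H2_inner_commute[of F d G])

text \<open>The embedding is used as a real-linear map only; a complex multiple becomes a real
  combination of the images of F and \<i> F.\<close>

lemma to_ell2_cscale:
  assumes "F \<in> H2 d"
  shows "to_ell2 d (cscale c F) = Re c *\<^sub>R to_ell2 d F + Im c *\<^sub>R to_ell2 d (cscale \<i> F)"
proof -
  have "cscale c F = cscale (of_real (Re c)) F + cscale (of_real (Im c)) (cscale \<i> F)"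
    by (simp add: cscale_def fun_eq_iff complex_eq_iff)
  then show ?thesis using assms by (simp add: to_ell2_add to_ell2_scaleR H2_cscale del: cvfun.scale_scale)
qed

lemma to_ell2_sum:
  assumes "\<And>i. i \<in> I \<Longrightarrow> F i \<in> H2 d"
  shows "to_ell2 d (\<Sum>i\<in>I. F i) = (\<Sum>i\<in>I. to_ell2 d (F i))"
proof -
  have "to_ell2 d 0 = 0" using to_ell2_scaleR[OF H2_0, of d 0] by simp
  with assms show ?thesis
    by (induction I rule: infinite_finite_induct) (simp_all add: to_ell2_add H2_sum)
qed

lemma orthonormal_sum_inner:
  fixes E :: "nat \<Rightarrow> cvfun"
  assumes "\<And>i. i < n \<Longrightarrow> E i \<in> H2 d" "\<And>i j. i < n \<Longrightarrow> j < n \<Longrightarrow> H2_inner d (E i) (E j) = (if i = j then 1 else 0)"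
    and "j < n"
  shows "H2_inner d (\<Sum>i<n. cscale (c i) (E i)) (E j) = c j"
proof -
  have "H2_inner d (\<Sum>i<n. cscale (c i) (E i)) (E j) = (\<Sum>i<n. c i * (if i = j then 1 else 0))"
    using assms by (subst H2_inner_sum_left) (auto simp: H2_cscale H2_inner_cscale_left intro!: sum.cong)
  also have "\<dots> = c j" using assms(3) by (subst sum.mono_neutral_right[of _ "{j}"]) auto
  finally show ?thesis .
qed

text \<open>The vectors equal to their own expansion form a subspace, and this subspace contains the
  basis, hence its span.\<close>

lemma orthonormal_basis_expansion:
  assumes E: "orthonormal_basis_H2 d n E V" and v: "v \<in> V"
  shows "v = (\<Sum>j<n. cscale (H2_inner d v (E j)) (E j))"
proof -
  have EH: "E i \<in> H2 d" if "i < n" for i using E that by (auto simp: orthonormal_basis_H2_def)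
  let ?S = "{v \<in> H2 d. v = (\<Sum>j<n. cscale (H2_inner d v (E j)) (E j))}"
  have "v \<in> cvfun.span (E ` {..<n})" using E v by (simp add: orthonormal_basis_H2_def)
  moreover have "cvfun.subspace ?S"
    unfolding cvfun.subspace_def
  proof (intro conjI ballI allI)
    show "0 \<in> ?S" by (simp add: H2_0 EH H2_inner_0_left)
    show "x + y \<in> ?S" if "x \<in> ?S" "y \<in> ?S" for x y
    proof -
      have "x + y = (\<Sum>j<n. cscale (H2_inner d x (E j)) (E j)) + (\<Sum>j<n. cscale (H2_inner d y (E j)) (E j))"
        using that by auto
      also have "\<dots> = (\<Sum>j<n. cscale (H2_inner d (x + y) (E j)) (E j))"
        using that by (simp add: EH H2_inner_add_left cvfun.scale_left_distrib sum.distrib)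
      finally show ?thesis using that by (auto intro: H2_add)
    qed
    show "cscale c x \<in> ?S" if "x \<in> ?S" for c x
    proof -
      have xH: "x \<in> H2 d" and x: "x = (\<Sum>j<n. cscale (H2_inner d x (E j)) (E j))" using that by auto
      have "cscale c x = cscale c (\<Sum>j<n. cscale (H2_inner d x (E j)) (E j))" using x by simp
      also have "\<dots> = (\<Sum>j<n. cscale (H2_inner d (cscale c x) (E j)) (E j))"
        using xH by (simp add: EH H2_inner_cscale_left cvfun.scale_sum_right)
      finally show ?thesis using xH by (auto intro: H2_cscale)
    qed
  qed
  moreover have "E ` {..<n} \<subseteq> ?S"
  proof clarify
    fix i assume i: "i < n"
    have "(\<Sum>j<n. cscale (H2_inner d (E i) (E j)) (E j)) = (\<Sum>j<n. if j = i then E i else 0)"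
      using E i by (intro sum.cong) (auto simp: orthonormal_basis_H2_def)
    also have "\<dots> = E i" using i by simp
    finally show "E i \<in> H2 d \<and> E i = (\<Sum>j<n. cscale (H2_inner d (E i) (E j)) (E j))"
      using EH[OF i] by simp
  qed
  ultimately have "v \<in> ?S" using cvfun.span_minimal by blast
  then show ?thesis by blast
qed

lemma orthonormal_norm:
  fixes E :: "nat \<Rightarrow> cvfun"
  assumes "\<And>i. i < n \<Longrightarrow> E i \<in> H2 d" "\<And>i j. i < n \<Longrightarrow> j < n \<Longrightarrow> H2_inner d (E i) (E j) = (if i = j then 1 else 0)"
  shows "(H2_norm d (\<Sum>i<n. cscale (c i) (E i)))\<^sup>2 = (\<Sum>i<n. (cmod (c i))\<^sup>2)"
proof -
  let ?v = "\<Sum>i<n. cscale (c i) (E i)"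
  have v: "?v \<in> H2 d" using assms(1) by (intro H2_sum H2_cscale) auto
  have "H2_inner d ?v ?v = (\<Sum>i<n. c i * H2_inner d (E i) ?v)"
    using v assms(1) by (subst H2_inner_sum_left) (auto simp: H2_cscale H2_inner_cscale_left intro!: sum.cong)
  also have "\<dots> = (\<Sum>i<n. c i * cnj (c i))"
    using orthonormal_sum_inner[OF assms] v assms(1)
    by (intro sum.cong refl) (simp add: H2_inner_commute[of ?v d])
  also have "\<dots> = of_real (\<Sum>i<n. (cmod (c i))\<^sup>2)" by (simp only: of_real_sum complex_norm_square)
  finally show ?thesis using H2_inner_self[OF v] by (simp only: of_real_eq_iff)
qed

lemma pythagoras_H2:
  assumes "F \<in> H2 d" "G \<in> H2 d" "H2_inner d F G = 0"
  shows "(H2_norm d (F + G))\<^sup>2 = (H2_norm d F)\<^sup>2 + (H2_norm d G)\<^sup>2"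
proof -
  have "inner (to_ell2 d F) (to_ell2 d G) = 0" using assms by (simp add: inner_to_ell2)
  then show ?thesis using assms
    by (simp add: H2_norm_eq H2_add to_ell2_add power2_norm_eq_inner inner_simps inner_commute)
qed

text \<open>Gram-Schmidt, one vector for each step of the induction over B.\<close>

lemma exists_orthonormal_basis:
  assumes "finite B" "cvfun.independent B" "B \<subseteq> H2 d"
  shows "\<exists>E. orthonormal_basis_H2 d (card B) E (cvfun.span B)"
  using assms
proof (induction B rule: finite_induct)
  case empty
  then show ?case by (simp add: orthonormal_basis_H2_def)
next
  case (insert b B)
  let ?n = "card B"
  have ind: "cvfun.independent B" "b \<notin> cvfun.span B"
    using insert.prems(1) insert.hyps(2) by (auto simp: cvfun.independent_insert)
  with insert obtain E where E: "orthonormal_basis_H2 d ?n E (cvfun.span B)" by auto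
  have EH: "E i \<in> H2 d" if "i < ?n" for i using E that by (auto simp: orthonormal_basis_H2_def)
  have Eo: "H2_inner d (E i) (E j) = (if i = j then 1 else 0)" if "i < ?n" "j < ?n" for i j
    using E that by (auto simp: orthonormal_basis_H2_def)
  have Esp: "cvfun.span (E ` {..<?n}) = cvfun.span B" using E by (simp add: orthonormal_basis_H2_def)
  define s where "s = (\<Sum>i<?n. cscale (H2_inner d b (E i)) (E i))"
  define b' where "b' = b - s"
  have bH: "b \<in> H2 d" using insert.prems by blast
  have sH: "s \<in> H2 d" unfolding s_def by (intro H2_sum H2_cscale EH) simp
  have b'H: "b' \<in> H2 d" unfolding b'_def using bH sH by (rule H2_diff)
  have ssp: "s \<in> cvfun.span (E ` {..<?n})"
    unfolding s_def by (intro cvfun.span_sum cvfun.span_scale cvfun.span_base) auto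
  \<comment> \<open>Linear independence keeps b out of the span of the earlier vectors, so the
    residue can be normalized.\<close>
  have "b' \<noteq> 0" using ind(2) ssp unfolding Esp b'_def by auto
  then have nz: "H2_norm d b' \<noteq> 0" using H2_norm_eq_0[OF b'H] by blast
  define e where "e = cscale (of_real (inverse (H2_norm d b'))) b'"
  have eH: "e \<in> H2 d" unfolding e_def using b'H by (rule H2_cscale)
  have orth: "H2_inner d e (E j) = 0" if "j < ?n" for j
  proof -
    have "H2_inner d b' (E j) = 0"
      unfolding b'_def using orthonormal_sum_inner[of ?n E d, OF EH Eo that, of "\<lambda>i. H2_inner d b (E i)"]
      by (simp add: H2_inner_diff_left bH sH EH that s_def[symmetric])
    then show ?thesis by (simp add: e_def H2_inner_cscale_left b'H EH that)
  qed
  have one: "H2_inner d e e = 1"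
  proof -
    have "H2_inner d b' e = cnj (of_real (inverse (H2_norm d b')) * H2_inner d b' b')"
      using H2_inner_commute[OF eH b'H] by (simp add: e_def H2_inner_cscale_left b'H)
    then have "H2_inner d e e = of_real (inverse (H2_norm d b') * (inverse (H2_norm d b') * (H2_norm d b')\<^sup>2))"
      by (subst e_def) (simp add: H2_inner_cscale_left b'H eH H2_inner_self)
    also have "inverse (H2_norm d b') * (inverse (H2_norm d b') * (H2_norm d b')\<^sup>2) = 1"
      using nz by (simp add: power2_eq_square field_simps)
    finally show ?thesis by simp
  qed
  define E' where "E' = E(?n := e)"
  have img: "E' ` {..<Suc ?n} = insert e (E ` {..<?n})" by (auto simp: E'_def lessThan_Suc)
  have "cvfun.span (insert e (E ` {..<?n})) = cvfun.span (insert b B)"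
  proof (rule equalityI; rule cvfun.span_minimal[OF _ cvfun.subspace_span])
    have sub1: "cvfun.span (E ` {..<?n}) \<subseteq> cvfun.span (insert b B)"
      unfolding Esp by (rule cvfun.span_mono) blast
    then have 1: "E ` {..<?n} \<subseteq> cvfun.span (insert b B)" by (rule order_trans[OF cvfun.span_superset])
    have "s \<in> cvfun.span (insert b B)" using ssp sub1 by (rule subsetD[rotated])
    then have "e \<in> cvfun.span (insert b B)"
      unfolding e_def b'_def by (intro cvfun.span_scale cvfun.span_diff) (auto intro: cvfun.span_base)
    with 1 show "insert e (E ` {..<?n}) \<subseteq> cvfun.span (insert b B)" by blast
    have sub2: "cvfun.span (E ` {..<?n}) \<subseteq> cvfun.span (insert e (E ` {..<?n}))"
      by (rule cvfun.span_mono) blast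
    then have 2: "B \<subseteq> cvfun.span (insert e (E ` {..<?n}))"
      unfolding Esp by (rule order_trans[OF cvfun.span_superset])
    have "b = cscale (of_real (H2_norm d b')) e + s"
      using nz by (simp add: e_def b'_def)
    moreover have "s \<in> cvfun.span (insert e (E ` {..<?n}))"
      using ssp sub2 by (rule subsetD[rotated])
    moreover have "cscale (of_real (H2_norm d b')) e \<in> cvfun.span (insert e (E ` {..<?n}))"
      by (intro cvfun.span_scale cvfun.span_base insertI1)
    ultimately have "b \<in> cvfun.span (insert e (E ` {..<?n}))"
      using cvfun.span_add by metis
    with 2 show "insert b B \<subseteq> cvfun.span (insert e (E ` {..<?n}))" by blast
  qed
  moreover have "H2_inner d (E' i) (E' j) = (if i = j then 1 else 0)" if "i < Suc ?n" "j < Suc ?n" for i j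
    using that orth one Eo H2_inner_zero_right[OF eH EH orth]
    by (cases "i = ?n"; cases "j = ?n") (simp_all add: E'_def less_Suc_eq)
  moreover have "E' ` {..<Suc ?n} \<subseteq> H2 d" unfolding img using eH EH by auto
  ultimately have "orthonormal_basis_H2 d (Suc ?n) E' (cvfun.span (insert b B))"
    by (simp add: orthonormal_basis_H2_def img)
  then show ?case using insert.hyps by auto
qed

section \<open>Multiplication by a matrix of columns\<close>

definition column_mult :: "nat \<Rightarrow> (nat \<Rightarrow> cvfun) \<Rightarrow> cvfun \<Rightarrow> cvfun" where
  "column_mult n D k = (\<lambda>z i. \<Sum>l<n. D l z i * k z l)"

lemma disc_holomorphic_column_mult:
  assumes "\<And>l. l < n \<Longrightarrow> disc_holomorphic (D l)" "disc_holomorphic k"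
  shows "disc_holomorphic (column_mult n D k)"
  using assms by (auto simp: disc_holomorphic_def column_mult_def intro!: holomorphic_intros)

lemma taylor_fps_column_mult:
  assumes "\<And>l. l < n \<Longrightarrow> disc_holomorphic (D l)" "disc_holomorphic k"
  shows "taylor_fps (column_mult n D k) i = (\<Sum>l<n. taylor_fps (D l) i * taylor_fps k l)"
  unfolding column_mult_def
  by (rule taylor_fps_eqI) (auto intro!: fps_expansion_intros has_fps_expansion_taylor_fps assms)

lemma taylor_fps_sum_cscale:
  fixes F :: "nat \<Rightarrow> cvfun"
  assumes "\<And>l. l < n \<Longrightarrow> F l \<in> H2 d"
  shows "taylor_fps (\<Sum>l<n. cscale (c l) (F l)) i = (\<Sum>l<n. fps_const (c l) * taylor_fps (F l) i)"
  using assms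
proof (induction n)
  case (Suc n)
  have "(\<Sum>l<n. cscale (c l) (F l)) \<in> H2 d" using Suc.prems by (intro H2_sum H2_cscale) auto
  then have 1: "disc_holomorphic (\<Sum>l<n. cscale (c l) (F l))" by (rule H2_disc_holomorphic)
  have 2: "disc_holomorphic (F n)" using Suc.prems by (intro H2_disc_holomorphic) auto
  show ?case
    unfolding sum.lessThan_Suc taylor_fps_add[OF 1 disc_holomorphic_cscale[OF 2]] taylor_fps_cscale[OF 2]
    using Suc by simp
qed simp

text \<open>Write D k = D k(0) + z D (bshift k) and apply \<open>bshift\<close>: the first term is
  differenced column by column, in the second the factor z is removed. Membership of both products
  in \<open>H2 d\<close> is assumed, since multiplication by D may leave the space.\<close>

lemma bshift_column_mult:
  assumes D: "\<And>l. l < n \<Longrightarrow> D l \<in> H2 d" and k: "k \<in> H2 n"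
    and mem: "column_mult n D k \<in> H2 d" "column_mult n D (bshift k) \<in> H2 d"
  shows "bshift (column_mult n D k) = (\<Sum>l<n. cscale (k 0 l) (bshift (D l))) + column_mult n D (bshift k)"
proof (rule H2_eqI[of _ d])
  have sumH: "(\<Sum>l<n. cscale (k 0 l) (bshift (D l))) \<in> H2 d"
    using D by (intro H2_sum H2_cscale H2_bshift) auto
  show "bshift (column_mult n D k) \<in> H2 d" using mem(1) by (rule H2_bshift)
  show "(\<Sum>l<n. cscale (k 0 l) (bshift (D l))) + column_mult n D (bshift k) \<in> H2 d"
    using sumH mem(2) by (rule H2_add)
  fix i
  have Dh: "disc_holomorphic (D l)" if "l < n" for l using D[OF that] by (rule H2_disc_holomorphic)
  have kh: "disc_holomorphic k" using k by (rule H2_disc_holomorphic)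
  have cmh: "disc_holomorphic (column_mult n D k)"
    by (rule disc_holomorphic_column_mult[OF _ kh]) (rule Dh)
  have cm: "taylor_fps (column_mult n D k) i = (\<Sum>l<n. taylor_fps (D l) i * taylor_fps k l)"
    "taylor_fps (column_mult n D (bshift k)) i = (\<Sum>l<n. taylor_fps (D l) i * taylor_fps (bshift k) l)"
    by (rule taylor_fps_column_mult[OF _ kh], erule Dh)
      (rule taylor_fps_column_mult[OF _ disc_holomorphic_bshift[OF kh]], erule Dh)
  have kl: "taylor_fps k l = fps_const (k 0 l) + fps_X * taylor_fps (bshift k) l" for l
    using kh by (rule taylor_fps_decomp)
  have Dl: "taylor_fps (D l) i = fps_const (D l 0 i) + fps_X * taylor_fps (bshift (D l)) i" if "l < n" for l
    using Dh[OF that] by (rule taylor_fps_decomp)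
  let ?P = "\<lambda>l. taylor_fps (D l) i" and ?c = "\<lambda>l. fps_const (k 0 l)"
  have "fps_const (column_mult n D k 0 i) + fps_X * taylor_fps (bshift (column_mult n D k)) i
      = (\<Sum>l<n. ?P l * taylor_fps k l)"
    unfolding cm(1)[symmetric] by (rule taylor_fps_decomp[OF cmh, symmetric])
  have distrib: "a * (b + x * c) = b * a + x * (a * c)" for a b c x :: "complex fps"
    by (simp add: algebra_simps)
  note \<open>fps_const (column_mult n D k 0 i) + fps_X * taylor_fps (bshift (column_mult n D k)) i
      = (\<Sum>l<n. ?P l * taylor_fps k l)\<close>
  \<comment> \<open>First k is expanded at 0, then \<open>D l\<close> only in the term with the
    constant \<open>k 0 l\<close>; thus the factor of \<open>bshift k\<close> remains the full
    column.\<close>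
  also have "(\<Sum>l<n. ?P l * taylor_fps k l) = (\<Sum>l<n. ?c l * ?P l + fps_X * (?P l * taylor_fps (bshift k) l))"
    by (intro sum.cong refl) (subst kl, rule distrib)
  also have "\<dots> = (\<Sum>l<n. fps_const (D l 0 i * k 0 l) + fps_X * (?c l * taylor_fps (bshift (D l)) i)
       + fps_X * (?P l * taylor_fps (bshift k) l))"
  proof (intro sum.cong refl)
    fix l assume "l \<in> {..<n}"
    then have "?c l * ?P l = fps_const (D l 0 i * k 0 l) + fps_X * (?c l * taylor_fps (bshift (D l)) i)"
      unfolding fps_const_mult[symmetric] by (subst Dl) (simp, rule distrib)
    then show "?c l * ?P l + fps_X * (?P l * taylor_fps (bshift k) l) = 
      fps_const (D l 0 i * k 0 l) + fps_X * (?c l * taylor_fps (bshift (D l)) i)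
       + fps_X * (?P l * taylor_fps (bshift k) l)" by (simp only:)
  qed
  also have "\<dots> = (\<Sum>l<n. fps_const (D l 0 i * k 0 l)) + fps_X *
     ((\<Sum>l<n. ?c l * taylor_fps (bshift (D l)) i) + (\<Sum>l<n. ?P l * taylor_fps (bshift k) l))"
    by (simp only: sum.distrib sum_distrib_left distrib_left add.assoc)
  also have "(\<Sum>l<n. fps_const (D l 0 i * k 0 l)) = fps_const (column_mult n D k 0 i)"
    by (simp add: column_mult_def fps_eq_iff fps_sum_nth)
  also have "(\<Sum>l<n. ?c l * taylor_fps (bshift (D l)) i) + (\<Sum>l<n. ?P l * taylor_fps (bshift k) l)
     = taylor_fps ((\<Sum>l<n. cscale (k 0 l) (bshift (D l))) + column_mult n D (bshift k)) i"
    unfolding taylor_fps_add[OF H2_disc_holomorphic[OF sumH] H2_disc_holomorphic[OF mem(2)]]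
      cm(2)
    by (subst taylor_fps_sum_cscale[where d = d]) (auto intro: H2_bshift D)
  \<comment> \<open>The constant terms on both sides agree, and the common factor
    \<open>fps_X\<close> cancels.\<close>
  finally show "taylor_fps (bshift (column_mult n D k)) i = 
     taylor_fps ((\<Sum>l<n. cscale (k 0 l) (bshift (D l))) + column_mult n D (bshift k)) i"
    by (simp only: add_left_cancel mult_cancel_left fps_X_neq_zero simp_thms)
qed

section \<open>The model of an almost invariant subspace\<close>

lemma H2_coeffs_inj: "F \<in> H2 d \<Longrightarrow> G \<in> H2 d \<Longrightarrow> H2_coeffs d F = H2_coeffs d G \<Longrightarrow> F = G"
  by (rule to_ell2_inj, assumption+) (simp only: to_ell2_def)

lemma bshift_linear:
  assumes "F \<in> H2 d" "G \<in> H2 d"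
  shows "bshift (cscale c F + G) = cscale c (bshift F) + bshift G"
proof (rule H2_coeffs_inj)
  have h: "disc_holomorphic F" "disc_holomorphic G" using assms H2_disc_holomorphic by blast+
  show "H2_coeffs d (bshift (cscale c F + G)) = H2_coeffs d (cscale c (bshift F) + bshift G)"
    by (simp add: H2_coeffs_bshift H2_coeffs_add H2_coeffs_cscale h disc_holomorphic_add
       disc_holomorphic_cscale disc_holomorphic_bshift)
qed (intro H2_bshift H2_add H2_cscale assms)+

lemma shift_bshift:
  assumes F: "F \<in> H2 d" and "F 0 = 0"
  shows "shift (bshift F) = F"
proof (intro ext)
  fix z i
  show "shift (bshift F) z i = F z i"
  proof (cases "z \<in> ball 0 1")
    case True
    then show ?thesis using bshift_decomp[of z F i] assms(2) by (simp add: shift_def)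
  next
    case False
    then show ?thesis using H2_zero[OF F] H2_zero[OF H2_bshift[OF F]] by (simp add: shift_def)
  qed
qed

lemma bshift_shift:
  assumes "F \<in> H2 d" shows "bshift (shift F) = F"
proof (rule H2_coeffs_inj)
  show "H2_coeffs d (bshift (shift F)) = H2_coeffs d F"
    using H2_disc_holomorphic[OF assms]
    by (simp add: H2_coeffs_bshift H2_coeffs_shift disc_holomorphic_shift)
qed (intro H2_bshift H2_shift assms)+

lemma shift_H2_iff: "F \<in> H2 d \<Longrightarrow> F \<in> shift ` H2 d \<longleftrightarrow> F 0 = 0"
proof
  assume "F \<in> shift ` H2 d"
  then show "F 0 = 0" by (auto simp: shift_def fun_eq_iff)
next
  assume "F \<in> H2 d" "F 0 = 0"
  then show "F \<in> shift ` H2 d" using shift_bshift[of F d] H2_bshift[of F d] by (metis imageI)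
qed

lemma H2_norm_shift: "F \<in> H2 d \<Longrightarrow> H2_norm d (shift F) = H2_norm d F"
  by (simp add: H2_norm_eq H2_shift to_ell2_shift norm_ell2_shift)

text \<open>The value at 0 is the coefficient of degree 0. Evaluation there is thus continuous,
  which makes the functions of M vanishing at 0 a closed subspace.\<close>

lemma norm_value_0_le:
  assumes "F \<in> H2 d" shows "cmod (F 0 i) \<le> H2_norm d F"
proof (cases "i < d")
  case True
  then have "F 0 i = Rep_ell2 (to_ell2 d F) (0, i)"
    using assms by (simp add: Rep_to_ell2 H2_coeffs_def taylor_coeff_0)
  then show ?thesis using norm_coord_le assms by (simp add: H2_norm_eq)
next
  case False
  then have "F 0 i = 0" using H2_zero[OF assms] by simp
  then show ?thesis using assms by (simp add: H2_norm_eq)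
qed

section \<open>Closed subspaces and orthogonal projections in the Hardy space\<close>

lemma closed_subspace_vanishing:
  assumes "closed_subspace_H2 d M"
  shows "closed_subspace_H2 d {F \<in> M. F 0 = 0}"
  unfolding closed_subspace_H2_def
proof (intro conjI allI impI)
  have sp: "cvfun.subspace M" and sub: "M \<subseteq> H2 d" using assms by (auto simp: closed_subspace_H2_def)
  show "{F \<in> M. F 0 = 0} \<subseteq> H2 d" using sub by blast
  show "cvfun.subspace {F \<in> M. F 0 = 0}"
    unfolding cvfun.subspace_def
    using cvfun.subspace_0[OF sp] cvfun.subspace_add[OF sp] cvfun.subspace_scale[OF sp]
    by (auto simp: cscale_def fun_eq_iff)
  fix X F
  assume *: "(\<forall>n. X n \<in> {F \<in> M. F 0 = 0}) \<and> F \<in> H2 d \<and> (\<lambda>n. H2_norm d (X n - F)) \<longlonglongrightarrow> 0"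
  then have "(\<forall>n. X n \<in> M) \<and> F \<in> H2 d \<and> (\<lambda>n. H2_norm d (X n - F)) \<longlonglongrightarrow> 0" by simp
  then have "F \<in> M" using assms unfolding closed_subspace_H2_def by metis
  moreover have "F 0 i = 0" for i
  proof -
    have "cmod (F 0 i) \<le> H2_norm d (X n - F)" for n
    proof -
      have "X n - F \<in> H2 d" using * sub by (intro H2_diff) auto
      from norm_value_0_le[OF this, of i] show ?thesis using * by simp
    qed
    then have "cmod (F 0 i) \<le> 0" using * LIMSEQ_le_const[of "\<lambda>n. H2_norm d (X n - F)" 0] by blast
    then show ?thesis by simp
  qed
  ultimately show "F \<in> {F \<in> M. F 0 = 0}" by (auto simp: fun_eq_iff)
qed

lemma orth_proj_to_ell2:
  assumes M: "closed_subspace_H2 d M" and F: "F \<in> H2 d" and G: "G \<in> M"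
    and orth: "\<And>H. H \<in> M \<Longrightarrow> H2_inner d (F - G) H = 0"
  shows "orth_proj (to_ell2 d ` M) (to_ell2 d F) = to_ell2 d G"
proof (rule orth_proj_unique[OF closed_subspace_to_ell2[OF M]])
  have sub: "M \<subseteq> H2 d" using M by (auto simp: closed_subspace_H2_def)
  show "to_ell2 d G \<in> to_ell2 d ` M" using G by blast
  fix y assume "y \<in> to_ell2 d ` M"
  then obtain H where H: "H \<in> M" "y = to_ell2 d H" by blast
  have "G \<in> H2 d" "H \<in> H2 d" using G H sub by blast+
  then show "inner (to_ell2 d F - to_ell2 d G) y = 0"
    using F orth[OF H(1)] H(2) by (simp add: inner_to_ell2 H2_diff flip: to_ell2_diff)
qed

text \<open>The real projection already gives complex orthogonality: M is closed under
  multiplication by \<i>, and testing against H and \<i> H annihilates real and imaginary part of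
  the inner product.\<close>

lemma exists_H2_orth_proj:
  assumes M: "closed_subspace_H2 d M" and F: "F \<in> H2 d"
  obtains G where "G \<in> M" "\<And>H. H \<in> M \<Longrightarrow> H2_inner d (F - G) H = 0"
proof -
  have sub: "M \<subseteq> H2 d" and sp: "cvfun.subspace M" using M by (auto simp: closed_subspace_H2_def)
  note M' = closed_subspace_to_ell2[OF M]
  obtain G where G: "G \<in> M" "orth_proj (to_ell2 d ` M) (to_ell2 d F) = to_ell2 d G"
    using orth_proj_in[OF M', of "to_ell2 d F"] by blast
  have GH: "G \<in> H2 d" using G sub by blast
  have re: "Re (H2_inner d (F - G) H) = 0" if "H \<in> M" for H
  proof -
    have "H \<in> H2 d" using that sub by blast
    then show ?thesis
      using orth_proj_orth[OF M', of "to_ell2 d H" "to_ell2 d F"] that F GH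
      by (simp add: G(2) inner_to_ell2 H2_diff flip: to_ell2_diff)
  qed
  have "H2_inner d (F - G) H = 0" if H: "H \<in> M" for H
  proof -
    have HH: "H \<in> H2 d" and FG: "F - G \<in> H2 d" using H sub F GH H2_diff by blast+
    have "cscale \<i> H \<in> M" using cvfun.subspace_scale[OF sp H] .
    moreover have "H2_inner d (F - G) (cscale \<i> H) = cnj (\<i> * H2_inner d H (F - G))"
      using H2_inner_commute[OF H2_cscale[OF HH] FG, of \<i>] by (simp add: H2_inner_cscale_left HH FG)
    moreover have "H2_inner d H (F - G) = cnj (H2_inner d (F - G) H)" by (rule H2_inner_commute[OF FG HH])
    ultimately show ?thesis using re[of "cscale \<i> H"] re[OF H] by (simp add: complex_eq_iff)
  qed
  with G(1) that show thesis by blast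
qed

definition model_columns :: "nat \<Rightarrow> (nat \<Rightarrow> cvfun) \<Rightarrow> (nat \<Rightarrow> cvfun) \<Rightarrow> nat \<Rightarrow> cvfun" where
  "model_columns r W E l = (if l < r then W l else shift (E (l - r)))"

lemma sum_lessThan_add: "(\<Sum>l<r + p. f l) = (\<Sum>l<r. f l) + (\<Sum>j<p. f (r + j))"
  for f :: "nat \<Rightarrow> 'a::comm_monoid_add"
  by (induction p) (simp_all add: add.assoc)

lemma shift_add: "shift (F + G) = shift F + shift G"
  by (simp add: shift_def fun_eq_iff algebra_simps)

lemma shift_sum_cscale: "shift (\<Sum>j<n. cscale (c j) (G j)) = (\<Sum>j<n. cscale (c j) (shift (G j)))"
  for n :: nat
proof (induction n)
  case (Suc n)
  have "shift (cscale (c n) (G n)) = cscale (c n) (shift (G n))"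
    by (simp add: shift_def cscale_def fun_eq_iff)
  with Suc show ?case by (simp only: sum.lessThan_Suc shift_add)
qed (simp add: shift_def fun_eq_iff)

section \<open>The recursion attached to an almost invariant subspace\<close>

locale almost_invariant_data =
  fixes m r p :: nat and M V :: "cvfun set" and W E :: "nat \<Rightarrow> cvfun"
  assumes cM: "closed_subspace_H2 m M"
    and W: "orthonormal_basis_H2 m r W (ominus_H2 m M (M \<inter> shift ` H2 m))"
    and E: "orthonormal_basis_H2 m p E V"
    and orth: "orthogonal_H2 m V M"
    and inv: "bshift ` M \<subseteq> M + V"
begin

definition "M0 = {F \<in> M. F 0 = 0}"
abbreviation "D \<equiv> model_columns r W E"
text \<open>Explicit formulas for Q F, for the coefficients c (index below r) and d (index from r
  on), and for A F, on the level of functions. As finite sums they make linearity and norm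
  identities accessible; that they are the projections is derived from the two orthonormal
  bases.\<close>

definition "vanishing_part F = F - (\<Sum>l<r. cscale (H2_inner m F (W l)) (W l))"
definition "coef i F = (if i < r then H2_inner m F (W i)
   else H2_inner m (bshift (vanishing_part F)) (E (i - r)))"
definition "step F = bshift (vanishing_part F)
   - (\<Sum>j<p. cscale (H2_inner m (bshift (vanishing_part F)) (E j)) (E j))"

lemma MH: "F \<in> M \<Longrightarrow> F \<in> H2 m" and spM: "cvfun.subspace M"
  using cM by (auto simp: closed_subspace_H2_def)

lemma EH: "j < p \<Longrightarrow> E j \<in> H2 m" and EV: "j < p \<Longrightarrow> E j \<in> V"
  and Eo: "i < p \<Longrightarrow> j < p \<Longrightarrow> H2_inner m (E i) (E j) = (if i = j then 1 else 0)"
  using E cvfun.span_base[of _ "E ` {..<p}"] by (auto simp: orthonormal_basis_H2_def)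

lemma VH: "v \<in> V \<Longrightarrow> v \<in> H2 m"
proof -
  assume "v \<in> V"
  moreover have "cvfun.span (E ` {..<p}) \<subseteq> H2 m"
    by (rule cvfun.span_minimal[OF _ subspace_H2]) (auto simp: EH)
  ultimately show ?thesis using E by (auto simp: orthonormal_basis_H2_def)
qed

lemma M_inter_shift: "M \<inter> shift ` H2 m = M0"
  unfolding M0_def using shift_H2_iff MH by auto

lemma WH: "l < r \<Longrightarrow> W l \<in> H2 m"
  and Wo: "i < r \<Longrightarrow> j < r \<Longrightarrow> H2_inner m (W i) (W j) = (if i = j then 1 else 0)"
  using W by (auto simp: orthonormal_basis_H2_def)

lemma W_ominus: "l < r \<Longrightarrow> W l \<in> ominus_H2 m M M0"
  using W cvfun.span_base[of "W l" "W ` {..<r}"] by (auto simp: orthonormal_basis_H2_def M_inter_shift)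

lemma WM: "l < r \<Longrightarrow> W l \<in> M"
  using W_ominus by (auto simp: ominus_H2_def)

lemma W_orth: "l < r \<Longrightarrow> G \<in> M0 \<Longrightarrow> H2_inner m G (W l) = 0"
  using W_ominus[of l] MH WH by (auto simp: ominus_H2_def M0_def intro: H2_inner_zero_right)

lemma M0_M: "F \<in> M0 \<Longrightarrow> F \<in> M" by (simp add: M0_def)

lemma cM0: "closed_subspace_H2 m M0"
  unfolding M0_def by (rule closed_subspace_vanishing[OF cM])

text \<open>Let H be the projection of F to \<open>M0\<close>. Then F - H lies in the span of the
  \<open>W l\<close>, and its coefficients equal those of F because H is orthogonal to each
  \<open>W l\<close>.\<close>

lemma vanishing_part_in: "F \<in> M \<Longrightarrow> vanishing_part F \<in> M0"
  and vanishing_part_orth: "F \<in> M \<Longrightarrow> G \<in> M0 \<Longrightarrow> H2_inner m (F - vanishing_part F) G = 0"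
proof -
  assume F: "F \<in> M"
  from exists_H2_orth_proj[OF cM0 MH[OF F]] obtain H where
    H: "H \<in> M0" "\<And>G. G \<in> M0 \<Longrightarrow> H2_inner m (F - H) G = 0" by blast
  have HH: "H \<in> H2 m" using H(1) M0_M MH by blast
  have "F - H \<in> M" using cvfun.subspace_diff[OF spM F] H(1) M0_M by blast
  then have "F - H \<in> ominus_H2 m M (M \<inter> shift ` H2 m)"
    using H(2) by (simp add: ominus_H2_def M_inter_shift)
  from orthonormal_basis_expansion[OF W this]
  have "F - H = (\<Sum>l<r. cscale (H2_inner m (F - H) (W l)) (W l))" .
  also have "\<dots> = (\<Sum>l<r. cscale (H2_inner m F (W l)) (W l))"
    by (intro sum.cong refl) (simp add: H2_inner_diff_left MH[OF F] HH WH W_orth H(1))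
  finally have "vanishing_part F = H" unfolding vanishing_part_def by (metis diff_diff_eq2 add_diff_cancel_left')
  with H show "vanishing_part F \<in> M0" "G \<in> M0 \<Longrightarrow> H2_inner m (F - vanishing_part F) G = 0" by auto
qed

lemma vanishing_part_H2: "F \<in> M \<Longrightarrow> vanishing_part F \<in> H2 m"
  using vanishing_part_in M0_M MH by blast

text \<open>Almost invariance splits the backward shift of the vanishing part as H + v with H in M
  and v in V. Since V is orthogonal to M, the inner products with the \<open>E j\<close> see only v,
  and subtracting them leaves H.\<close>

lemma step_in: "F \<in> M \<Longrightarrow> step F \<in> M"
  and step_orth: "F \<in> M \<Longrightarrow> G \<in> M \<Longrightarrow> H2_inner m (bshift (vanishing_part F) - step F) G = 0"
proof -
  assume F: "F \<in> M"
  let ?B = "bshift (vanishing_part F)"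
  have "?B \<in> M + V" using inv vanishing_part_in[OF F] M0_M by blast
  then obtain H v where Hv: "?B = H + v" "H \<in> M" "v \<in> V" by (rule set_plus_elim)
  have HH: "H \<in> H2 m" and vH: "v \<in> H2 m" using Hv MH VH by auto
  have vM: "H2_inner m v G = 0" if "G \<in> M" for G
    using orth Hv(3) that by (auto simp: orthogonal_H2_def)
  have "H2_inner m H (E j) = 0" if "j < p" for j
    using orth EV[OF that] Hv(2) HH EH[OF that] by (auto simp: orthogonal_H2_def intro: H2_inner_zero_right)
  then have "H2_inner m ?B (E j) = H2_inner m v (E j)" if "j < p" for j
    using that by (simp add: Hv(1) H2_inner_add_left HH vH EH)
  then have "step F = ?B - (\<Sum>j<p. cscale (H2_inner m v (E j)) (E j))"
    unfolding step_def by (intro arg_cong2[of _ _ _ _ "(-)"] refl sum.cong) auto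
  also have "\<dots> = H" unfolding orthonormal_basis_expansion[OF E Hv(3), symmetric] Hv(1) by simp
  finally have "step F = H" .
  then show "step F \<in> M" "G \<in> M \<Longrightarrow> H2_inner m (bshift (vanishing_part F) - step F) G = 0"
    using Hv vM by auto
qed

lemma step_pow_in: "F \<in> M \<Longrightarrow> (step ^^ n) F \<in> M"
  by (induction n) (auto intro: step_in)

lemma DH: "l < r + p \<Longrightarrow> D l \<in> H2 m"
  by (auto simp: model_columns_def WH intro!: H2_shift EH)

lemma decomposition:
  assumes F: "F \<in> M"
  shows "F = (\<Sum>l<r + p. cscale (coef l F) (D l)) + shift (step F)"
proof -
  let ?B = "bshift (vanishing_part F)"
  have v: "vanishing_part F = shift ?B"
    using shift_bshift[OF vanishing_part_H2[OF F]] vanishing_part_in[OF F] by (simp add: M0_def)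
  have "?B = (\<Sum>j<p. cscale (H2_inner m ?B (E j)) (E j)) + step F" by (simp add: step_def)
  then have "shift ?B = shift (\<Sum>j<p. cscale (H2_inner m ?B (E j)) (E j)) + shift (step F)"
    by (metis shift_add)
  also have "shift (\<Sum>j<p. cscale (H2_inner m ?B (E j)) (E j)) = (\<Sum>j<p. cscale (coef (r + j) F) (D (r + j)))"
    unfolding shift_sum_cscale by (simp add: coef_def model_columns_def)
  finally have "vanishing_part F = (\<Sum>j<p. cscale (coef (r + j) F) (D (r + j))) + shift (step F)"
    by (rule trans[OF v])
  moreover have "F = (\<Sum>l<r. cscale (H2_inner m F (W l)) (W l)) + vanishing_part F"
    by (simp add: vanishing_part_def)
  moreover have "(\<Sum>l<r. cscale (H2_inner m F (W l)) (W l)) = (\<Sum>l<r. cscale (coef l F) (D l))"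
    by (intro sum.cong) (auto simp: coef_def model_columns_def)
  ultimately have "F = (\<Sum>l<r. cscale (coef l F) (D l))
      + ((\<Sum>j<p. cscale (coef (r + j) F) (D (r + j))) + shift (step F))"
    by (simp only:)
  then show ?thesis by (simp only: sum_lessThan_add add.assoc)
qed

text \<open>Pythagoras is applied twice, before and after the backward shift; between the two the
  norm is unchanged because the vanishing part is the shift of its backward shift.\<close>

lemma norm_decomposition:
  assumes F: "F \<in> M"
  shows "(\<Sum>l<r + p. (cmod (coef l F))\<^sup>2) = (H2_norm m F)\<^sup>2 - (H2_norm m (step F))\<^sup>2"
proof -
  let ?Q = "vanishing_part F" and ?B = "bshift (vanishing_part F)"
  let ?w = "\<Sum>l<r. cscale (H2_inner m F (W l)) (W l)"
  let ?e = "\<Sum>j<p. cscale (H2_inner m ?B (E j)) (E j)"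
  have QH: "?Q \<in> H2 m" by (rule vanishing_part_H2[OF F])
  have wH: "?w \<in> H2 m" by (intro H2_sum H2_cscale WH) simp
  have eH: "?e \<in> H2 m" by (intro H2_sum H2_cscale EH) simp
  have sH: "step F \<in> H2 m" using step_in[OF F] MH by blast
  have "H2_inner m ?w ?Q = 0"
    using vanishing_part_orth[OF F vanishing_part_in[OF F]] by (simp add: vanishing_part_def)
  from pythagoras_H2[OF wH QH this]
  have 1: "(H2_norm m F)\<^sup>2 = (\<Sum>l<r. (cmod (H2_inner m F (W l)))\<^sup>2) + (H2_norm m ?Q)\<^sup>2"
    using orthonormal_norm[of r W m, OF WH Wo] by (simp add: vanishing_part_def)
  have "H2_inner m ?e (step F) = 0"
    using step_orth[OF F step_in[OF F]] by (simp add: step_def)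
  from pythagoras_H2[OF eH sH this]
  have 2: "(H2_norm m ?B)\<^sup>2 = (\<Sum>j<p. (cmod (H2_inner m ?B (E j)))\<^sup>2) + (H2_norm m (step F))\<^sup>2"
    using orthonormal_norm[of p E m, OF EH Eo] by (simp add: step_def)
  have "H2_norm m ?Q = H2_norm m ?B"
    using H2_norm_shift[OF H2_bshift[OF QH]] shift_bshift[OF QH] vanishing_part_in[OF F] by (simp add: M0_def)
  with 1 2 show ?thesis by (simp add: sum_lessThan_add coef_def)
qed

text \<open>The recursion is transported to the sequence space, where \<open>step\<close> becomes
  the compressed backward shift \<open>A\<close>.\<close>

lemma step_orbit_tendsto_0:
  assumes F: "F \<in> M"
  shows "(\<lambda>n. H2_norm m ((step ^^ n) F)) \<longlonglongrightarrow> 0"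
proof -
  let ?t = "to_ell2 m"
  \<comment> \<open>Each complex coefficient is split into two real ones, indexed by a boolean:
    \<open>True\<close> selects the real part. The argument is a family, so the function in M is
    recovered with the inverse of the embedding.\<close>
  define c where "c = (\<lambda>(l, b) f. (if b then Re else Im) (coef l (inv_into M ?t f)))"
  \<comment> \<open>The matching vectors: a column for the real part and \<i> times that column for
    the imaginary part.\<close>
  define C where "C = (\<lambda>(l, b). ?t (if b then D l else cscale \<i> (D l)))"
  have inj: "inj_on ?t M" using to_ell2_inj MH by (auto simp: inj_on_def)
  have c: "c (l, b) (?t F) = (if b then Re else Im) (coef l F)" if "F \<in> M" for l b F
    using that inj by (simp add: c_def)
  have PQ: "orth_proj (?t ` M) (ell2_bshift (orth_proj (?t ` M0) (?t F))) = ?t (step F)" if F: "F \<in> M" for F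
  proof -
    have "orth_proj (?t ` M0) (?t F) = ?t (vanishing_part F)"
      by (rule orth_proj_to_ell2[OF cM0 MH[OF F] vanishing_part_in[OF F] vanishing_part_orth[OF F]])
    then have "ell2_bshift (orth_proj (?t ` M0) (?t F)) = ?t (bshift (vanishing_part F))"
      using vanishing_part_H2[OF F] by (simp add: to_ell2_bshift)
    also have "orth_proj (?t ` M) \<dots> = ?t (step F)"
      by (rule orth_proj_to_ell2[OF cM H2_bshift[OF vanishing_part_H2[OF F]] step_in[OF F] step_orth[OF F]])
    finally show ?thesis .
  qed
  interpret compressed_backward_shift ell2_shift ell2_bshift "?t ` M" "?t ` M0" "{..<r + p} \<times> UNIV" c C
  proof
    show "?t ` M0 \<subseteq> ?t ` M" using M0_M by blast
    fix f assume "f \<in> ?t ` M"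
    then obtain F where F: "F \<in> M" "f = ?t F" by blast
    have "(\<Sum>a\<in>{..<r + p} \<times> UNIV. c a f *\<^sub>R C a) = (\<Sum>l<r + p. \<Sum>b\<in>UNIV. c (l, b) f *\<^sub>R C (l, b))"
      by (simp add: sum.cartesian_product)
    also have "\<dots> = (\<Sum>l<r + p. ?t (cscale (coef l F) (D l)))"
    proof (intro sum.cong refl)
      fix l assume "l \<in> {..<r + p}"
      then show "(\<Sum>b\<in>UNIV. c (l, b) f *\<^sub>R C (l, b)) = ?t (cscale (coef l F) (D l))"
        by (simp add: F c UNIV_bool C_def to_ell2_cscale[OF DH, of l "coef l F"] add.commute)
    qed
    also have "\<dots> = ?t (\<Sum>l<r + p. cscale (coef l F) (D l))"
      by (rule to_ell2_sum[symmetric]) (simp add: H2_cscale DH)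
    finally have 1: "(\<Sum>a\<in>{..<r + p} \<times> UNIV. c a f *\<^sub>R C a) = ?t (\<Sum>l<r + p. cscale (coef l F) (D l))" .
    have sH: "step F \<in> H2 m" using step_in[OF F(1)] MH by blast
    have "?t F = ?t ((\<Sum>l<r + p. cscale (coef l F) (D l)) + shift (step F))"
      using decomposition[OF F(1)] by simp
    also have "\<dots> = ?t (\<Sum>l<r + p. cscale (coef l F) (D l)) + ell2_shift (?t (step F))"
      using sH by (subst to_ell2_add) (auto intro: H2_sum H2_cscale DH H2_shift simp: to_ell2_shift)
    finally show "f = (\<Sum>a\<in>{..<r + p} \<times> UNIV. c a f *\<^sub>R C a)
        + ell2_shift (orth_proj (?t ` M) (ell2_bshift (orth_proj (?t ` M0) f)))"
      using PQ[OF F(1)] 1 F(2) by simp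
    have "(\<Sum>a\<in>{..<r + p} \<times> UNIV. (c a f)\<^sup>2) = (\<Sum>l<r + p. \<Sum>b\<in>UNIV. (c (l, b) f)\<^sup>2)"
      by (simp add: sum.cartesian_product)
    also have "\<dots> = (\<Sum>l<r + p. (cmod (coef l F))\<^sup>2)"
      by (simp add: F c UNIV_bool cmod_power2 add.commute)
    also have "\<dots> = (norm f)\<^sup>2 - (norm (?t (step F)))\<^sup>2"
      using norm_decomposition[OF F(1)] MH[OF F(1)] sH by (simp add: F(2) H2_norm_eq)
    finally show "(\<Sum>a\<in>{..<r + p} \<times> UNIV. (c a f)\<^sup>2)
      \<le> (norm f)\<^sup>2 - (norm (orth_proj (?t ` M) (ell2_bshift (orth_proj (?t ` M0) f))))\<^sup>2"
      using PQ[OF F(1)] F(2) by simp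
  qed (simp_all add: linear_add[OF linear_ell2_shift] linear_scale[OF linear_ell2_shift] norm_ell2_shift
      linear_add[OF linear_ell2_bshift] linear_scale[OF linear_ell2_bshift] ell2_shift_adjoint
      ell2_bshift_stable closed_subspace_to_ell2[OF cM] closed_subspace_to_ell2[OF cM0])
  have "(A ^^ n) (?t F) = ?t ((step ^^ n) F)" for n
    by (induction n) (simp_all add: A_def PQ step_pow_in[OF F])
  then have "(\<lambda>n. norm (?t ((step ^^ n) F))) \<longlonglongrightarrow> 0"
    using tendsto_norm_zero[OF orbit_tendsto_0[of "?t F"]] by simp
  then show ?thesis using step_pow_in[OF F] MH by (simp add: H2_norm_eq)
qed

text \<open>The norm identity telescopes along the orbit, and the last term disappears by stability.
  Here the convergence theorem turns an inequality between norms into an equality.\<close>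

lemma coef_square_sums:
  assumes F: "F \<in> M"
  shows "(\<lambda>n. \<Sum>l<r + p. (cmod (coef l ((step ^^ n) F)))\<^sup>2) sums (H2_norm m F)\<^sup>2"
proof -
  have "(\<lambda>n. (H2_norm m ((step ^^ n) F))\<^sup>2) \<longlonglongrightarrow> 0"
    using tendsto_power[OF step_orbit_tendsto_0[OF F], of 2] by simp
  from telescope_sums'[OF this]
  have "(\<lambda>n. (H2_norm m ((step ^^ n) F))\<^sup>2 - (H2_norm m ((step ^^ Suc n) F))\<^sup>2) sums (H2_norm m F)\<^sup>2"
    by simp
  then show ?thesis by (simp add: norm_decomposition step_pow_in[OF F])
qed

section \<open>The isometric representation with orbit coefficients as Taylor coefficients\<close>

definition "orbit_coeffs F q = (if snd q < r + p then coef (snd q) ((step ^^ fst q) F) else 0)"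

definition "model F = (SOME k. k \<in> H2 (r + p) \<and> H2_coeffs (r + p) k = orbit_coeffs F)"

lemma model_H2: "F \<in> M \<Longrightarrow> model F \<in> H2 (r + p)"
  and model_coeffs: "F \<in> M \<Longrightarrow> H2_coeffs (r + p) (model F) = orbit_coeffs F"
proof -
  assume F: "F \<in> M"
  have "square_summable (orbit_coeffs F)"
    unfolding square_summable_def
    by (rule summable_pairs_finite_snd[where d = "r + p"])
      (use coef_square_sums[OF F] in \<open>auto simp: orbit_coeffs_def sums_iff\<close>)
  then obtain k where "k \<in> H2 (r + p)" "H2_coeffs (r + p) k = orbit_coeffs F"
    by (rule exists_H2_of_coeffs[of _ "r + p"]) (auto simp: orbit_coeffs_def intro: that)
  then have "\<exists>k. k \<in> H2 (r + p) \<and> H2_coeffs (r + p) k = orbit_coeffs F" by blast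
  from someI_ex[OF this]
  show "model F \<in> H2 (r + p)" "H2_coeffs (r + p) (model F) = orbit_coeffs F"
    unfolding model_def by blast+
qed

lemma taylor_fps_model:
  "F \<in> M \<Longrightarrow> l < r + p \<Longrightarrow> taylor_fps (model F) l = Abs_fps (\<lambda>n. coef l ((step ^^ n) F))"
  using fun_cong[OF model_coeffs, of F "(n, l)" for n]
  by (simp add: fps_eq_iff H2_coeffs_def orbit_coeffs_def taylor_coeff_fps)

lemma norm_model:
  assumes F: "F \<in> M" shows "H2_norm (r + p) (model F) = H2_norm m F"
proof -
  have "taylor_coeff (model F) n l = coef l ((step ^^ n) F)" if "l < r + p" for n l
    using taylor_fps_model[OF F that] by (simp add: taylor_coeff_fps)
  then have "H2_norm (r + p) (model F) = sqrt ((H2_norm m F)\<^sup>2)"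
    using coef_square_sums[OF F] by (simp add: H2_norm_def[of "r + p"] sums_iff)
  also have "\<dots> = H2_norm m F" using MH[OF F] by (simp add: H2_norm_eq)
  finally show ?thesis .
qed

text \<open>Dropping the first Taylor coefficient is the same as starting the orbit one step later;
  this gives the invariance of the model space.\<close>

lemma bshift_model:
  assumes F: "F \<in> M" shows "bshift (model F) = model (step F)"
proof (rule H2_coeffs_inj)
  show "bshift (model F) \<in> H2 (r + p)" "model (step F) \<in> H2 (r + p)"
    using F by (auto intro: H2_bshift model_H2 step_in)
  have "H2_coeffs (r + p) (bshift (model F)) = (\<lambda>q. orbit_coeffs F (Suc (fst q), snd q))"
    by (simp only: H2_coeffs_bshift[OF H2_disc_holomorphic[OF model_H2[OF F]]] model_coeffs[OF F])
  also have "\<dots> = orbit_coeffs (step F)"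
    by (auto simp: orbit_coeffs_def funpow_swap1)
  finally show "H2_coeffs (r + p) (bshift (model F)) = H2_coeffs (r + p) (model (step F))"
    using model_coeffs[OF step_in[OF F]] by simp
qed

text \<open>The difference of the two Taylor series satisfies \<Delta> F = X \<Delta> (step F).
  Applied repeatedly, this makes it divisible by every power of X, so it is zero; the identity is
  purely formal and uses no convergence of the orbit.\<close>

lemma column_mult_model:
  assumes F: "F \<in> M" shows "column_mult (r + p) D (model F) = F"
proof (intro ext)
  fix z i
  let ?\<Delta> = "\<lambda>F. taylor_fps F i - (\<Sum>l<r + p. taylor_fps (D l) i * taylor_fps (model F) l)"
  have rec: "?\<Delta> G = fps_X * ?\<Delta> (step G)" if G: "G \<in> M" for G
  proof -
    have sH: "step G \<in> H2 m" using step_in[OF G] MH by blast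
    have cH: "(\<Sum>l<r + p. cscale (coef l G) (D l)) \<in> H2 m" by (intro H2_sum H2_cscale DH) simp
    have "taylor_fps G i = taylor_fps (\<Sum>l<r + p. cscale (coef l G) (D l)) i + taylor_fps (shift (step G)) i"
      by (subst decomposition[OF G], rule taylor_fps_add)
        (rule H2_disc_holomorphic[OF cH] H2_disc_holomorphic[OF H2_shift[OF sH]])+
    also have "taylor_fps (\<Sum>l<r + p. cscale (coef l G) (D l)) i
        = (\<Sum>l<r + p. fps_const (coef l G) * taylor_fps (D l) i)"
      by (rule taylor_fps_sum_cscale[where d = m]) (rule DH)
    also have "taylor_fps (shift (step G)) i = fps_X * taylor_fps (step G) i"
      by (rule taylor_fps_shift[OF H2_disc_holomorphic[OF sH]])
    finally have 1: "taylor_fps G i = (\<Sum>l<r + p. fps_const (coef l G) * taylor_fps (D l) i)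
       + fps_X * taylor_fps (step G) i" .
    have "taylor_fps (model G) l = fps_const (coef l G) + fps_X * taylor_fps (model (step G)) l"
      if l: "l < r + p" for l
    proof (rule fps_ext)
      fix n
      show "fps_nth (taylor_fps (model G) l) n = fps_nth (fps_const (coef l G) + fps_X * taylor_fps (model (step G)) l) n"
        using l G by (cases n) (simp_all add: taylor_fps_model step_in funpow_swap1)
    qed
    then have "(\<Sum>l<r + p. taylor_fps (D l) i * taylor_fps (model G) l) =
        (\<Sum>l<r + p. fps_const (coef l G) * taylor_fps (D l) i
          + fps_X * (taylor_fps (D l) i * taylor_fps (model (step G)) l))"
      by (intro sum.cong refl) (simp add: algebra_simps)
    then show ?thesis
      unfolding 1 by (simp add: sum.distrib sum_distrib_left algebra_simps)
  qed
  have "fps_nth (?\<Delta> G) n = 0" if "G \<in> M" for G n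
    using that
  proof (induction n arbitrary: G)
    case 0
    then show ?case by (subst rec) (auto simp: fps_X_mult_nth)
  next
    case (Suc n)
    then show ?case by (subst rec) (auto simp: fps_X_mult_nth step_in)
  qed
  then have "?\<Delta> F = 0" using F by (simp only: fps_eq_iff fps_zero_nth) simp
  then have eq: "taylor_fps (column_mult (r + p) D (model F)) i = taylor_fps F i"
    by (subst taylor_fps_column_mult) (auto intro: H2_disc_holomorphic[OF DH] H2_disc_holomorphic[OF model_H2[OF F]])
  show "column_mult (r + p) D (model F) z i = F z i"
  proof (cases "z \<in> ball 0 1")
    case True
    show ?thesis
      by (rule eq_on_disc_if_taylor_fps_eq[OF disc_holomorphic_column_mult H2_disc_holomorphic[OF MH[OF F]] eq True])
        (auto intro: H2_disc_holomorphic[OF DH] H2_disc_holomorphic[OF model_H2[OF F]])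
  next
    \<comment> \<open>Off the disc both sides are 0 by the convention for Hardy functions.\<close>
    case False
    then have "F z i = 0" and "model F z l = 0" for l
      using H2_zero[OF MH[OF F]] H2_zero[OF model_H2[OF F]] by blast+
    then show ?thesis by (simp add: column_mult_def)
  qed
qed

lemma vanishing_part_linear:
  assumes "F \<in> M" "G \<in> M"
  shows "vanishing_part (cscale c F + G) = cscale c (vanishing_part F) + vanishing_part G"
proof -
  have "(\<Sum>l<r. cscale (H2_inner m (cscale c F + G) (W l)) (W l)) =
    cscale c (\<Sum>l<r. cscale (H2_inner m F (W l)) (W l)) + (\<Sum>l<r. cscale (H2_inner m G (W l)) (W l))"
    unfolding cvfun.scale_sum_right sum.distrib[symmetric]
    by (intro sum.cong refl)
      (simp add: H2_inner_add_left H2_inner_cscale_left H2_cscale WH MH assms cvfun.scale_left_distrib)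
  then show ?thesis
    unfolding vanishing_part_def by (simp only: cvfun.scale_right_diff_distrib algebra_simps)
qed

lemma bshift_vanishing_part_linear:
  assumes "F \<in> M" "G \<in> M"
  shows "bshift (vanishing_part (cscale c F + G)) = cscale c (bshift (vanishing_part F)) + bshift (vanishing_part G)"
  unfolding vanishing_part_linear[OF assms] by (rule bshift_linear[OF vanishing_part_H2 vanishing_part_H2]) fact+

lemma coef_linear:
  assumes "F \<in> M" "G \<in> M" "l < r + p"
  shows "coef l (cscale c F + G) = c * coef l F + coef l G"
proof -
  have "bshift (vanishing_part F) \<in> H2 m" "bshift (vanishing_part G) \<in> H2 m"
    using assms by (auto intro: H2_bshift vanishing_part_H2)
  moreover have "l - r < p" if "\<not> l < r" using that assms(3) by simp
  ultimately show ?thesis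
    by (simp add: coef_def bshift_vanishing_part_linear assms H2_inner_add_left
      H2_inner_cscale_left H2_cscale WH EH MH)
qed

lemma step_linear:
  assumes "F \<in> M" "G \<in> M"
  shows "step (cscale c F + G) = cscale c (step F) + step G"
proof -
  let ?B = "\<lambda>F. bshift (vanishing_part F)"
  have B: "?B F \<in> H2 m" "?B G \<in> H2 m" using assms by (auto intro: H2_bshift vanishing_part_H2)
  have "(\<Sum>j<p. cscale (H2_inner m (cscale c (?B F) + ?B G) (E j)) (E j)) =
    cscale c (\<Sum>j<p. cscale (H2_inner m (?B F) (E j)) (E j)) + (\<Sum>j<p. cscale (H2_inner m (?B G) (E j)) (E j))"
    unfolding cvfun.scale_sum_right sum.distrib[symmetric]
    by (intro sum.cong refl)
      (simp add: H2_inner_add_left H2_inner_cscale_left H2_cscale EH B cvfun.scale_left_distrib)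
  then show ?thesis
    unfolding step_def bshift_vanishing_part_linear[OF assms]
    by (simp only: cvfun.scale_right_diff_distrib algebra_simps)
qed

lemma M_linear: "F \<in> M \<Longrightarrow> G \<in> M \<Longrightarrow> cscale c F + G \<in> M"
  using cvfun.subspace_add[OF spM] cvfun.subspace_scale[OF spM] by blast

text \<open>Both \<open>coef\<close> and \<open>step\<close> are linear on M, hence so is every
  coefficient of the orbit.\<close>

lemma model_linear:
  assumes F: "F \<in> M" and G: "G \<in> M"
  shows "model (cscale c F + G) = cscale c (model F) + model G"
proof (rule H2_coeffs_inj)
  note FG = M_linear[OF F G, of c]
  show "model (cscale c F + G) \<in> H2 (r + p)" by (rule model_H2[OF FG])
  show "cscale c (model F) + model G \<in> H2 (r + p)" by (intro H2_add H2_cscale model_H2 F G)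
  have pow: "(step ^^ n) (cscale c F + G) = cscale c ((step ^^ n) F) + (step ^^ n) G" for n
  proof (induction n)
    case (Suc n)
    show ?case
      unfolding funpow.simps o_apply Suc by (rule step_linear[OF step_pow_in[OF F] step_pow_in[OF G]])
  qed simp
  have h: "disc_holomorphic (model F)" "disc_holomorphic (model G)"
    using model_H2 F G H2_disc_holomorphic by blast+
  have "H2_coeffs (r + p) (cscale c (model F) + model G) = (\<lambda>q. c * orbit_coeffs F q + orbit_coeffs G q)"
    by (simp add: H2_coeffs_add disc_holomorphic_cscale h H2_coeffs_cscale model_coeffs F G)
  also have "\<dots> = orbit_coeffs (cscale c F + G)"
  proof
    fix q show "c * orbit_coeffs F q + orbit_coeffs G q = orbit_coeffs (cscale c F + G) q"
      by (simp add: orbit_coeffs_def pow coef_linear[OF step_pow_in[OF F] step_pow_in[OF G]])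
  qed
  finally show "H2_coeffs (r + p) (model (cscale c F + G)) = H2_coeffs (r + p) (cscale c (model F) + model G)"
    by (simp add: model_coeffs[OF FG])
qed

text \<open>An isometric image of a complete space is closed: if the models of \<open>Y n\<close>
  converge, then \<open>Y n\<close> is Cauchy, has a limit F in M, and the limit of the models is
  the model of F.\<close>

lemma closed_subspace_model: "closed_subspace_H2 (r + p) (model ` M)"
  unfolding closed_subspace_H2_def
proof (intro conjI allI impI)
  have z: "0 \<in> M" using cvfun.subspace_0[OF spM] .
  have add: "model (F + G) = model F + model G" if "F \<in> M" "G \<in> M" for F G
    using model_linear[OF that, of 1] by (simp only: cvfun.scale_one)
  have m0: "model 0 = 0" using add[OF z z] by (simp only: add_0_right add_cancel_right_right)
  have scale: "model (cscale c F) = cscale c (model F)" if "F \<in> M" for c F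
    using model_linear[OF that z, of c] by (simp only: m0 add_0_right)
  have diff: "model (F - G) = model F - model G" if "F \<in> M" "G \<in> M" for F G
    using add[OF cvfun.subspace_diff[OF spM that] that(2)] by (simp only: diff_add_cancel eq_diff_eq)
  show "model ` M \<subseteq> H2 (r + p)" using model_H2 by blast
  show "cvfun.subspace (model ` M)"
    unfolding cvfun.subspace_def
  proof (intro conjI ballI allI)
    show "0 \<in> model ` M" by (rule image_eqI[where x = 0]) (simp_all only: m0 z)
    show "x + y \<in> model ` M" if "x \<in> model ` M" "y \<in> model ` M" for x y
    proof -
      from that obtain F G where "F \<in> M" "G \<in> M" "x = model F" "y = model G" by blast
      then show ?thesis by (intro image_eqI[of _ _ "F + G"] cvfun.subspace_add[OF spM]) (simp_all only: add)
    qed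
    show "cscale c x \<in> model ` M" if "x \<in> model ` M" for c x
    proof -
      from that obtain F where "F \<in> M" "x = model F" by blast
      then show ?thesis
        by (intro image_eqI[of _ _ "cscale c F"] cvfun.subspace_scale[OF spM]) (simp_all only: scale)
    qed
  qed
  fix X k
  assume *: "(\<forall>n. X n \<in> model ` M) \<and> k \<in> H2 (r + p) \<and> (\<lambda>n. H2_norm (r + p) (X n - k)) \<longlonglongrightarrow> 0"
  then have "\<forall>n. \<exists>F. F \<in> M \<and> X n = model F" by blast
  from choice[OF this] obtain Y where Y: "\<And>n. Y n \<in> M" "\<And>n. X n = model (Y n)" by blast
  have kH: "k \<in> H2 (r + p)" using * by blast
  let ?t = "to_ell2 m" and ?s = "to_ell2 (r + p)"
  have norm_s: "norm (?s (model F) - ?s k) = H2_norm (r + p) (model F - k)" if "F \<in> M" for F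
    by (simp only: H2_norm_eq[OF H2_diff[OF model_H2[OF that] kH]] to_ell2_diff[OF model_H2[OF that] kH])
  have iso: "norm (?t F - ?t G) = norm (?s (model F) - ?s (model G))" if F: "F \<in> M" and G: "G \<in> M" for F G
  proof -
    have FG: "F - G \<in> M" by (rule cvfun.subspace_diff[OF spM F G])
    have "norm (?t F - ?t G) = H2_norm m (F - G)"
      by (simp only: H2_norm_eq[OF MH[OF FG]] to_ell2_diff[OF MH[OF F] MH[OF G]])
    also have "\<dots> = norm (?s (model (F - G)))"
      by (simp only: norm_model[OF FG, symmetric] H2_norm_eq[OF model_H2[OF FG]])
    also have "\<dots> = norm (?s (model F) - ?s (model G))"
      by (simp only: diff[OF F G] to_ell2_diff[OF model_H2[OF F] model_H2[OF G]])
    finally show ?thesis .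
  qed
  have dist: "dist (?t (Y i)) (?t (Y j)) = dist (?s (X i)) (?s (X j))" for i j
    unfolding dist_norm Y(2) by (rule iso[OF Y(1) Y(1)])
  have "(\<lambda>n. ?s (X n)) \<longlonglongrightarrow> ?s k"
  proof (rule LIM_zero_cancel, rule tendsto_norm_zero_cancel)
    show "(\<lambda>n. norm (?s (X n) - ?s k)) \<longlonglongrightarrow> 0"
      unfolding Y(2) norm_s[OF Y(1)] using * unfolding Y(2) by blast
  qed
  then have "Cauchy (\<lambda>n. ?s (X n))" by (rule LIMSEQ_imp_Cauchy)
  then have "Cauchy (\<lambda>n. ?t (Y n))" unfolding Cauchy_def dist .
  then obtain y where y: "(\<lambda>n. ?t (Y n)) \<longlonglongrightarrow> y" using Cauchy_convergent_iff convergent_def by blast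
  have "y \<in> ?t ` M"
    by (rule closed_sequentially[OF closed_subspace_to_ell2(2)[OF cM] _ y]) (use Y(1) in blast)
  then obtain F where F: "F \<in> M" "y = ?t F" by blast
  have "(\<lambda>n. norm (?t (Y n) - ?t F)) \<longlonglongrightarrow> 0"
    using y F(2) by (simp add: LIM_zero tendsto_norm_zero)
  moreover have "norm (?t (Y n) - ?t F) = norm (?s (X n) - ?s (model F))" for n
    unfolding Y(2) by (rule iso[OF Y(1) F(1)])
  ultimately have "(\<lambda>n. ?s (X n)) \<longlonglongrightarrow> ?s (model F)"
    by (subst LIM_zero_iff[symmetric], subst tendsto_norm_zero_iff[symmetric]) simp
  with \<open>(\<lambda>n. ?s (X n)) \<longlonglongrightarrow> ?s k\<close> have "?s k = ?s (model F)" using LIMSEQ_unique by blast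
  then have "k = model F" by (intro to_ell2_inj[OF kH model_H2[OF F(1)]])
  then show "k \<in> model ` M" using F(1) by blast
qed

theorem model_space:
  obtains K where "closed_subspace_H2 (r + p) K" "bshift ` K \<subseteq> K"
    "M = column_mult (r + p) (model_columns r W E) ` K"
    "\<And>k. k \<in> K \<Longrightarrow> H2_norm m (column_mult (r + p) (model_columns r W E) k) = H2_norm (r + p) k"
proof
  show "closed_subspace_H2 (r + p) (model ` M)" by (rule closed_subspace_model)
  show "bshift ` model ` M \<subseteq> model ` M"
  proof (intro subsetI, elim imageE)
    fix k k' F assume "k = bshift k'" "k' = model F" "F \<in> M"
    then have "k = model (step F)" using bshift_model by blast
    then show "k \<in> model ` M" using step_in[OF \<open>F \<in> M\<close>] by blast
  qed
  show "M = column_mult (r + p) (model_columns r W E) ` model ` M"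
  proof -
    have "column_mult (r + p) D ` model ` M = (\<lambda>F. F) ` M"
      unfolding image_image by (rule image_cong[OF refl column_mult_model])
    then show ?thesis by (simp only: image_ident)
  qed
  show "H2_norm m (column_mult (r + p) (model_columns r W E) k) = H2_norm (r + p) k" if "k \<in> model ` M" for k
  proof -
    from that obtain F where F: "F \<in> M" "k = model F" by blast
    show ?thesis unfolding F(2) column_mult_model[OF F(1)] by (rule norm_model[OF F(1), symmetric])
  qed
qed

end

section \<open>From the column form to the stated formulas, and the converse direction\<close>

lemma column_mult_columns:
  "column_mult (r + p) (model_columns r W E) k =
    (\<lambda>z i. mat_vec r (matrix_of_columns W z) (vec_part r k z) i + (\<Sum>j<p. z * scalar_part r k j z * E j z i))"
  by (simp add: column_mult_def model_columns_def sum_lessThan_add mat_vec_def matrix_of_columns_def vec_part_def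
      scalar_part_def shift_def mult_ac fun_eq_iff)

lemma column_mult_columns_0:
  "column_mult p (model_columns 0 W E) k = (\<lambda>z i. \<Sum>j<p. z * scalar_part 0 k j z * E j z i)"
  using column_mult_columns[of 0 p W E k] by (simp add: mat_vec_def)

lemma H2_norm_vec_scalar_parts:
  assumes k: "k \<in> H2 (r + p)"
  shows "(H2_norm (r + p) k)\<^sup>2 = (H2_norm r (vec_part r k))\<^sup>2 + (\<Sum>j<p. (scalar_norm (scalar_part r k j))\<^sup>2)"
proof -
  have s: "summable (\<lambda>n. \<Sum>i<r + p. (cmod (taylor_coeff k n i))\<^sup>2)" using k by (simp add: H2_def)
  have si: "summable (\<lambda>n. (cmod (taylor_coeff k n i))\<^sup>2)" if "i < r + p" for i
    by (rule summable_comparison_test'[OF s, of 0])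
      (use that member_le_sum[of i "{..<r + p}" "\<lambda>i. (cmod (taylor_coeff k n i))\<^sup>2" for n] in auto)
  have v: "(H2_norm r (vec_part r k))\<^sup>2 = (\<Sum>n. \<Sum>i<r. (cmod (taylor_coeff k n i))\<^sup>2)"
  proof -
    have "taylor_coeff (vec_part r k) n i = taylor_coeff k n i" if "i < r" for n i
      using that by (simp add: taylor_coeff_def vec_part_def)
    moreover have "summable (\<lambda>n. \<Sum>i<r. (cmod (taylor_coeff k n i))\<^sup>2)" by (intro summable_sum si) simp
    ultimately show ?thesis
      unfolding H2_norm_def by (simp add: real_sqrt_pow2 suminf_nonneg sum_nonneg)
  qed
  have c: "(scalar_norm (scalar_part r k j))\<^sup>2 = (\<Sum>n. (cmod (taylor_coeff k n (r + j)))\<^sup>2)" if "j < p" for j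
  proof -
    have "taylor_coeff (\<lambda>z i. if i = 0 then scalar_part r k j z else 0) n 0 = taylor_coeff k n (r + j)" for n
      by (simp add: taylor_coeff_def scalar_part_def)
    then show ?thesis using that
      unfolding scalar_norm_def H2_norm_def by (simp add: real_sqrt_pow2 suminf_nonneg si)
  qed
  have "(H2_norm (r + p) k)\<^sup>2 = (\<Sum>n. \<Sum>i<r + p. (cmod (taylor_coeff k n i))\<^sup>2)"
    unfolding H2_norm_def using s by (simp add: real_sqrt_pow2 suminf_nonneg sum_nonneg)
  also have "\<dots> = (\<Sum>n. \<Sum>i<r. (cmod (taylor_coeff k n i))\<^sup>2) + (\<Sum>n. \<Sum>j<p. (cmod (taylor_coeff k n (r + j)))\<^sup>2)"
    unfolding sum_lessThan_add by (intro suminf_add[symmetric] summable_sum) (auto intro: si)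
  also have "(\<Sum>n. \<Sum>j<p. (cmod (taylor_coeff k n (r + j)))\<^sup>2) = (\<Sum>j<p. \<Sum>n. (cmod (taylor_coeff k n (r + j)))\<^sup>2)"
    by (rule suminf_sum) (auto intro: si)
  finally show ?thesis by (simp add: v c)
qed

text \<open>By the product rule for \<open>bshift\<close>, the image of D k is a combination of the
  backward shifts of the columns plus D (bshift k). The last term is in M because K is invariant;
  the shifts of the \<open>W l\<close> are in M + V by assumption, and those of the columns z E_j
  are the \<open>E j\<close> themselves.\<close>

lemma bshift_column_mult_subset:
  assumes M: "M \<subseteq> H2 m" "cvfun.subspace M" and V: "cvfun.subspace V"
    and K: "K \<subseteq> H2 (r + p)" "bshift ` K \<subseteq> K"
    and MK: "M = column_mult (r + p) (model_columns r W E) ` K"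
    and W: "\<And>l. l < r \<Longrightarrow> W l \<in> H2 m" "\<And>l. l < r \<Longrightarrow> bshift (W l) \<in> M + V"
    and E: "\<And>j. j < p \<Longrightarrow> E j \<in> H2 m" "\<And>j. j < p \<Longrightarrow> E j \<in> V"
  shows "bshift ` M \<subseteq> M + V"
proof
  have sp: "cvfun.subspace (M + V)"
  proof -
    have "M + V = {x + y |x y. x \<in> M \<and> y \<in> V}" unfolding set_plus_def by blast
    then show ?thesis using cvfun.subspace_sums[OF M(2) V] by (simp only:)
  qed
  have M_sub: "F \<in> M + V" if "F \<in> M" for F
    using set_plus_intro[OF that cvfun.subspace_0[OF V]] by simp
  have D: "model_columns r W E l \<in> H2 m" if "l < r + p" for l
    using that W(1) E(1) by (auto simp: model_columns_def intro!: H2_shift)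
  fix G assume "G \<in> bshift ` M"
  then obtain k where k: "k \<in> K" "G = bshift (column_mult (r + p) (model_columns r W E) k)" using MK by blast
  have kb: "bshift k \<in> K" using k(1) K(2) by blast
  have mem: "column_mult (r + p) (model_columns r W E) k \<in> M" "column_mult (r + p) (model_columns r W E) (bshift k) \<in> M"
    using MK k(1) kb by blast+
  have "G = (\<Sum>l<r + p. cscale (k 0 l) (bshift (model_columns r W E l))) + column_mult (r + p) (model_columns r W E) (bshift k)"
    unfolding k(2)
  proof (rule bshift_column_mult)
    show "k \<in> H2 (r + p)" using k(1) K(1) by blast
  qed (use mem M(1) D in blast)+
  moreover have "bshift (model_columns r W E l) \<in> M + V" if "l < r + p" for l
  proof (cases "l < r")
    case False
    then have j: "l - r < p" using that by simp
    have "E (l - r) \<in> M + V"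
      using set_plus_intro[OF cvfun.subspace_0[OF M(2)] E(2)[OF j]] by simp
    then show ?thesis using False bshift_shift[OF E(1)[OF j]] by (simp add: model_columns_def)
  qed (simp add: model_columns_def W(2))
  ultimately show "G \<in> M + V"
    using M_sub[OF mem(2)]
    by (simp only:) (intro cvfun.subspace_add[OF sp] cvfun.subspace_sum[OF sp] cvfun.subspace_scale[OF sp]; simp)
qed

text \<open>Both alternatives are instances of one representation by columns: when all functions of
  M vanish at 0, the basis W is empty, and (ii) is the representation for r = 0.\<close>

theorem corollary3p6:
  fixes m p r :: nat
    and M :: "cvfun set"
    and W :: "nat \<Rightarrow> cvfun"
    and F0 :: "complex \<Rightarrow> nat \<Rightarrow> nat \<Rightarrow> complex"
  assumes "m \<ge> 1" and "p \<ge> 1"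
    and "closed_subspace_H2 m M"
    and "orthonormal_basis_H2 m r W (ominus_H2 m M (M \<inter> shift ` H2 m))"
    and "F0 = matrix_of_columns W"
  shows "almost_invariant_bshift m p M \<longleftrightarrow>
    (\<exists>V E. subspace_H2_dim m p V \<and> orthogonal_H2 m V M \<and> orthonormal_basis_H2 m p E V \<and>
      (((\<exists>F\<in>M. F 0 \<noteq> 0) \<and>
        (\<exists>K. closed_subspace_H2 (r + p) K \<and> bshift ` K \<subseteq> K \<and>
          M = {F. \<exists>k\<in>K. F = (\<lambda>z i. mat_vec r (F0 z) (vec_part r k z) i
                                  + (\<Sum>j<p. z * scalar_part r k j z * E j z i))} \<and>
          (\<forall>k\<in>K. \<forall>F. F = (\<lambda>z i. mat_vec r (F0 z) (vec_part r k z) i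
                                  + (\<Sum>j<p. z * scalar_part r k j z * E j z i)) \<longrightarrow>
             (H2_norm m F)\<^sup>2 = (H2_norm r (vec_part r k))\<^sup>2
                               + (\<Sum>j<p. (scalar_norm (scalar_part r k j))\<^sup>2))) \<and>
        (\<forall>i<r. bshift (W i) \<in> M + V))
      \<or>
       ((\<forall>F\<in>M. F 0 = 0) \<and>
        (\<exists>K. closed_subspace_H2 p K \<and> bshift ` K \<subseteq> K \<and>
          M = {F. \<exists>k\<in>K. F = (\<lambda>z i. \<Sum>j<p. z * scalar_part 0 k j z * E j z i)} \<and>
          (\<forall>k\<in>K. \<forall>F. F = (\<lambda>z i. \<Sum>j<p. z * scalar_part 0 k j z * E j z i) \<longrightarrow>
             (H2_norm m F)\<^sup>2 = (\<Sum>j<p. (scalar_norm (scalar_part 0 k j))\<^sup>2))))))"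
proof -
  note M = assms(3) and W = assms(4)
  have MH: "M \<subseteq> H2 m" and spM: "cvfun.subspace M" using M by (auto simp: closed_subspace_H2_def)
  have WH: "W l \<in> H2 m" and WM: "W l \<in> M" if "l < r" for l
    using W that cvfun.span_base[of "W l" "W ` {..<r}"] by (auto simp: orthonormal_basis_H2_def ominus_H2_def)
  let ?D = "\<lambda>E. column_mult (r + p) (model_columns r W E)" and ?Dv = "\<lambda>E. column_mult p (model_columns 0 W E)"
  \<comment> \<open>If everything vanishes at 0, then M lies inside the range of the shift, and a
    basis vector of the difference space would be orthogonal to itself.\<close>
  have r0: "r = 0" if "\<forall>F\<in>M. F 0 = 0"
  proof (rule ccontr)
    assume "r \<noteq> 0"
    then have "0 < r" by simp
    have "F \<in> shift ` H2 m" if "F \<in> M" for F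
      using that \<open>\<forall>F\<in>M. F 0 = 0\<close> shift_H2_iff[of F m] MH by blast
    then have "M \<inter> shift ` H2 m = M" by blast
    then have "W 0 \<in> ominus_H2 m M M"
      using W cvfun.span_base[of "W 0" "W ` {..<r}"] \<open>0 < r\<close> by (auto simp: orthonormal_basis_H2_def)
    then have "H2_inner m (W 0) (W 0) = 0" using WM[OF \<open>0 < r\<close>] by (simp add: ominus_H2_def)
    then show False using W \<open>0 < r\<close> by (simp add: orthonormal_basis_H2_def)
  qed
  let ?i = "\<lambda>V E. (\<exists>F\<in>M. F 0 \<noteq> 0) \<and>
        (\<exists>K. closed_subspace_H2 (r + p) K \<and> bshift ` K \<subseteq> K \<and> M = {F. \<exists>k\<in>K. F = ?D E k} \<and>
          (\<forall>k\<in>K. \<forall>F. F = ?D E k \<longrightarrow> (H2_norm m F)\<^sup>2 = (H2_norm r (vec_part r k))\<^sup>2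
                               + (\<Sum>j<p. (scalar_norm (scalar_part r k j))\<^sup>2))) \<and>
        (\<forall>i<r. bshift (W i) \<in> M + V)"
  let ?ii = "\<lambda>E. (\<forall>F\<in>M. F 0 = 0) \<and>
        (\<exists>K. closed_subspace_H2 p K \<and> bshift ` K \<subseteq> K \<and> M = {F. \<exists>k\<in>K. F = ?Dv E k} \<and>
          (\<forall>k\<in>K. \<forall>F. F = ?Dv E k \<longrightarrow> (H2_norm m F)\<^sup>2 = (\<Sum>j<p. (scalar_norm (scalar_part 0 k j))\<^sup>2)))"
  have "almost_invariant_bshift m p M \<longleftrightarrow>
    (\<exists>V E. subspace_H2_dim m p V \<and> orthogonal_H2 m V M \<and> orthonormal_basis_H2 m p E V \<and> (?i V E \<or> ?ii E))"
  proof
    assume "almost_invariant_bshift m p M"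
    then obtain V where V: "subspace_H2_dim m p V" "orthogonal_H2 m V M" "bshift ` M \<subseteq> M + V"
      unfolding almost_invariant_bshift_def by (elim conjE exE)
    obtain B where B: "finite B" "card B = p" "cvfun.independent B" "cvfun.span B = V" and VH: "V \<subseteq> H2 m"
      using V(1) unfolding subspace_H2_dim_def by (elim conjE exE)
    have "B \<subseteq> H2 m" using cvfun.span_superset[of B] VH unfolding B(4) by (rule order_trans)
    from exists_orthonormal_basis[OF B(1,3) this] obtain E where E: "orthonormal_basis_H2 m p E V"
      unfolding B(2,4) by (elim exE)
    interpret almost_invariant_data m r p M V W E by unfold_locales fact+
    obtain K where K: "closed_subspace_H2 (r + p) K" "bshift ` K \<subseteq> K" "M = ?D E ` K"
      "\<And>k. k \<in> K \<Longrightarrow> H2_norm m (?D E k) = H2_norm (r + p) k" by (rule model_space) (rule that)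
    have KH: "K \<subseteq> H2 (r + p)" using K(1) by (simp add: closed_subspace_H2_def)
    have norm: "(H2_norm m (?D E k))\<^sup>2 = (H2_norm r (vec_part r k))\<^sup>2 + (\<Sum>j<p. (scalar_norm (scalar_part r k j))\<^sup>2)"
      if "k \<in> K" for k
      unfolding K(4)[OF that] by (rule H2_norm_vec_scalar_parts[OF subsetD[OF KH that]])
    have MK: "M = {F. \<exists>k\<in>K. F = ?D E k}" using K(3) by blast
    have "?i V E \<or> ?ii E"
    proof (cases "\<forall>F\<in>M. F 0 = 0")
      case True
      \<comment> \<open>For r = 0 the vector part contributes nothing, since the norm on
        \<open>H2 0\<close> is an empty sum.\<close>
      have z: "(H2_norm 0 G)\<^sup>2 + x = x" for G and x :: real by (simp add: H2_norm_def)
      have "?ii E"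
        by (rule conjI[OF True exI[of _ K]], intro conjI ballI allI impI)
          (use K(1,2) MK norm in \<open>simp_all only: r0[OF True] add_0 z\<close>)
      then show ?thesis ..
    next
      case False
      have "\<forall>i<r. bshift (W i) \<in> M + V" using WM V(3) by blast
      moreover have "\<exists>K. closed_subspace_H2 (r + p) K \<and> bshift ` K \<subseteq> K \<and> M = {F. \<exists>k\<in>K. F = ?D E k} \<and>
          (\<forall>k\<in>K. \<forall>F. F = ?D E k \<longrightarrow> (H2_norm m F)\<^sup>2 = (H2_norm r (vec_part r k))\<^sup>2
                               + (\<Sum>j<p. (scalar_norm (scalar_part r k j))\<^sup>2))"
        by (rule exI[of _ K], intro conjI ballI allI impI) (use K(1,2) MK norm in \<open>simp_all only:\<close>)
      ultimately show ?thesis using False by (intro disjI1 conjI) simp_all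
    qed
    then show "\<exists>V E. subspace_H2_dim m p V \<and> orthogonal_H2 m V M \<and> orthonormal_basis_H2 m p E V \<and> (?i V E \<or> ?ii E)"
      by (intro exI[of _ V] exI[of _ E] conjI V(1,2) E)
  next
    assume "\<exists>V E. subspace_H2_dim m p V \<and> orthogonal_H2 m V M \<and> orthonormal_basis_H2 m p E V \<and> (?i V E \<or> ?ii E)"
    then obtain V E where V: "subspace_H2_dim m p V" "orthogonal_H2 m V M" and E: "orthonormal_basis_H2 m p E V"
      and i_ii: "?i V E \<or> ?ii E" by (elim exE conjE)
    have spV: "cvfun.subspace V" using V(1) unfolding subspace_H2_dim_def by (metis cvfun.subspace_span)
    have E': "E j \<in> H2 m" "E j \<in> V" if "j < p" for j
      using E that cvfun.span_base[of "E j" "E ` {..<p}"] by (auto simp: orthonormal_basis_H2_def)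
    from i_ii have "bshift ` M \<subseteq> M + V"
    proof
      assume "?i V E"
      then obtain K where K: "closed_subspace_H2 (r + p) K" "bshift ` K \<subseteq> K" "M = {F. \<exists>k\<in>K. F = ?D E k}"
        and Wb: "\<forall>i<r. bshift (W i) \<in> M + V" by (elim exE conjE)
      have "K \<subseteq> H2 (r + p)" using K(1) by (simp add: closed_subspace_H2_def)
      moreover have "M = ?D E ` K" using K(3) by blast
      ultimately show ?thesis
        by (rule bshift_column_mult_subset[OF MH spM spV _ K(2)]) (use WH Wb E' in blast)+
    next
      assume "?ii E"
      then obtain K where K: "closed_subspace_H2 p K" "bshift ` K \<subseteq> K" "M = {F. \<exists>k\<in>K. F = ?Dv E k}"
        by (elim exE conjE)
      have "K \<subseteq> H2 (0 + p)" using K(1) by (simp add: closed_subspace_H2_def)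
      moreover have "M = column_mult (0 + p) (model_columns 0 W E) ` K"
        using K(3) unfolding add_0 by blast
      ultimately show ?thesis
        \<comment> \<open>With no columns from W, the condition on their backward shifts is
          vacuous.\<close>
        by (rule bshift_column_mult_subset[OF MH spM spV _ K(2)]) (simp_all add: E')
    qed
    then show "almost_invariant_bshift m p M"
      unfolding almost_invariant_bshift_def by (intro conjI exI[of _ V] M V)
  qed
  then show ?thesis by (simp only: column_mult_columns column_mult_columns_0 assms(5))
qed

end
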